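(* Let $p\ge1$ and let $1\le k\le p+2$. With the pseudo-Riemannian manifolds $\mathcal{H}_{6+4p,k}$ and $\mathcal{S}_{6+4p}$ defined in the context: \begin{enumerate} \item $\mathcal{H}_{6+4p,k}$ is $0$-modeled on the indecomposable symmetric space $\mathcal{S}_{6+4p}$. \item If $1\le j<k$, then (a) $\mathcal{H}_{6+4p,k}$ is $j$-modeled on $\mathcal{H}_{6+4p,j}$; (b) $\mathcal{H}_{6+4p,j}$ is not $k$-modeled on $\mathcal{H}_{6+4p,k}$. \item $\mathcal{H}_{6+4p,k}$ is a homogeneous space which is not symmetric. \end{enumerate}
   Context: Let $(x,z_0,\dots,z_p,\tilde z_0,\dots,\tilde z_p,x^*,z_0^*,\dots,z_p^*,\tilde z_0^*,\dots,\tilde z_p^* )$ be coordinates on $\mathbb{R}^{6+4p}$. For a smooth function $f=f(z_0,\dots,z_p)$ on $\mathbb{R}^{p+1}$, $\mathcal{M}_{6+4p,f}:=(\mathbb{R}^{6+4p},g_{6+4p,f})$, where $g_{6+4p,f}$ is the metric of neutral signature $(3+2p,3+2p)$ whose only non-zero components (up to symmetry) are $$g_{6+4p,f}(\partial_x,\partial_x)=-2\{f(z_0,\dots,z_p)+z_0\tilde z_0+\dots+z_p\tilde z_p\},$$ $$g_{6+4p,f}(\partial_x,\partial_{x^*})=g_{6+4p,f}(\partial_{z_i},\partial_{z_i^*})=g_{6+4p,f}(\partial_{\tilde z_i},\partial_{\tilde z_i^*})=1\quad(0\le i\le p).$$ Set $\mathcal{S}_{6+4p}:=\mathcal{M}_{6+4p,0}$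 (the case $f=0$) and $\mathcal{H}_{6+4p,k}:=\mathcal{M}_{6+4p,f_k}$, where $$f_k:=z_1z_0^2+\dots+z_kz_0^{k+1}\quad\text{if }1\le k\le p,$$ $$f_{p+1}:=z_1z_0^2+\dots+z_pz_0^{p+1}+z_0^{p+3},\qquad f_{p+2}:=z_1z_0^2+\dots+z_pz_0^{p+1}+e^{z_0}.$$ For a pseudo-Riemannian manifold $\mathcal{M}=(M,g)$ with Levi-Civita connection $\nabla$, curvature tensor $R(\xi_1,\xi_2,\xi_3,\xi_4)=g((\nabla_{\xi_1}\nabla_{\xi_2}-\nabla_{\xi_2}\nabla_{\xi_1}-\nabla_{[\xi_1,\xi_2]})\xi_3,\xi_4)$ and $P\in M$, set $\mathfrak{M}^k(\mathcal{M},P):=(T_PM,g_P,R_P,\dots,\nabla^kR_P)$. An isomorphism between two such objects is a linear isomorphism of the tangent spaces which pulls back the metric and all the tensors $\nabla^iR$, $0\le i\le k$, to one another. $\mathcal{M}$ is $k$-modeled on a homogeneous pseudo-Riemannian manifold $\mathcal{N}$ if $\mathfrak{M}^k(\mathcal{M},P)$ and $\mathfrak{M}^k(\mathcal{N},Q)$ are isomorphic for any $P\in M$ and $Q\in N$. Homogeneous means that the group of isometries acts transitively. A pseudo-Riemannian manifold is indecomposable if there does not exist a non-trivial orthogonal direct sum decomposition of $T_PM$ which is invariant under the holonomy representation. *)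

theory Defs
  imports "HOL-Analysis.Analysis"
begin

text \<open>
  All manifolds involved are Euclidean spaces carrying one global chart. Tangent spaces are
  identified with the model space through the coordinate frame, so a metric \<open>g\<close> assigns to a
  point \<open>P\<close> a bilinear form \<open>g P\<close>.
\<close>

type_synonym 'n point = "real ^ 'n"
type_synonym 'n vfield = "real ^ 'n \<Rightarrow> real ^ 'n"
type_synonym 'n metric = "real ^ 'n \<Rightarrow> real ^ 'n \<Rightarrow> real ^ 'n \<Rightarrow> real"
type_synonym 'n connection = "real ^ 'n \<Rightarrow> real ^ 'n \<Rightarrow> real ^ 'n \<Rightarrow> real ^ 'n"
type_synonym 'n tensor_field = "real ^ 'n \<Rightarrow> (real ^ 'n) list \<Rightarrow> real"

section \<open>Levi-Civita connection and curvature\<close>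

definition dir_deriv ::
    "('a::real_normed_vector \<Rightarrow> 'b::real_normed_vector) \<Rightarrow> 'a \<Rightarrow> 'a \<Rightarrow> 'b"
  where "dir_deriv F P u = frechet_derivative F (at P) u"

text \<open>
  A connection is given by its Christoffel map \<open>\<Gamma> P u v\<close>, which is the value at \<open>P\<close> of
  the covariant derivative of the constant vector field \<open>v\<close> in direction \<open>u\<close>. Constant
  fields commute, so for these torsion-freeness is symmetry of \<open>\<Gamma> P\<close>.
\<close>

definition is_levi_civita :: "'n::finite metric \<Rightarrow> 'n connection \<Rightarrow> bool"
  where "is_levi_civita g \<Gamma> \<longleftrightarrow>
    (\<forall>P. bilinear (\<Gamma> P)) \<and>
    (\<forall>P u v. \<Gamma> P u v = \<Gamma> P v u) \<and>
    (\<forall>P u v w. dir_deriv (\<lambda>Q. g Q v w) P u = g P (\<Gamma> P u v) w + g P v (\<Gamma> P u w))"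

definition levi_civita :: "'n::finite metric \<Rightarrow> 'n connection"
  where "levi_civita g = (THE \<Gamma>. is_levi_civita g \<Gamma>)"

definition nabla :: "'n::finite metric \<Rightarrow> 'n vfield \<Rightarrow> 'n vfield \<Rightarrow> 'n vfield"
  where "nabla g X Y = (\<lambda>P. dir_deriv Y P (X P) + levi_civita g P (X P) (Y P))"

definition lie_bracket :: "'n::finite vfield \<Rightarrow> 'n vfield \<Rightarrow> 'n vfield"
  where "lie_bracket X Y = (\<lambda>P. dir_deriv Y P (X P) - dir_deriv X P (Y P))"

definition curvature_op ::
    "'n::finite metric \<Rightarrow> 'n vfield \<Rightarrow> 'n vfield \<Rightarrow> 'n vfield \<Rightarrow> 'n vfield"
  where "curvature_op g X Y Z = (\<lambda>P.
    nabla g X (nabla g Y Z) P - nabla g Y (nabla g X Z) P - nabla g (lie_bracket X Y) Z P)"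

text \<open>
  A covariant tensor field of rank \<open>r\<close> is evaluated on lists of \<open>r\<close> tangent vectors. Values
  at a point are computed by extending tangent vectors to constant vector fields, which by
  tensoriality is no restriction.
\<close>

definition curvature_tensor :: "'n::finite metric \<Rightarrow> 'n tensor_field"
  where "curvature_tensor g P \<xi>s =
    g P (curvature_op g (\<lambda>_. \<xi>s ! 0) (\<lambda>_. \<xi>s ! 1) (\<lambda>_. \<xi>s ! 2) P) (\<xi>s ! 3)"

text \<open>The head of the argument list is the slot of differentiation.\<close>

definition nabla_tensor :: "'n::finite metric \<Rightarrow> 'n tensor_field \<Rightarrow> 'n tensor_field"
  where "nabla_tensor g T P \<xi>s = (let \<eta> = hd \<xi>s; \<zeta>s = tl \<xi>s in
    dir_deriv (\<lambda>Q. T Q \<zeta>s) P \<eta>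
    - (\<Sum>i<length \<zeta>s. T P (\<zeta>s[i := nabla g (\<lambda>_. \<eta>) (\<lambda>_. \<zeta>s ! i) P])))"

definition nabla_curvature :: "'n::finite metric \<Rightarrow> nat \<Rightarrow> 'n tensor_field"
  where "nabla_curvature g i = (nabla_tensor g ^^ i) (curvature_tensor g)"

section \<open>Models\<close>

definition model_isomorphism :: "nat \<Rightarrow> 'n::finite metric \<Rightarrow> 'n point \<Rightarrow>
    'm::finite metric \<Rightarrow> 'm point \<Rightarrow> (real ^ 'n \<Rightarrow> real ^ 'm) \<Rightarrow> bool"
  where "model_isomorphism k g P h Q \<phi> \<longleftrightarrow>
    linear \<phi> \<and> bij \<phi> \<and>
    (\<forall>u v. h Q (\<phi> u) (\<phi> v) = g P u v) \<and>
    (\<forall>i\<le>k. \<forall>\<xi>s. length \<xi>s = 4 + i \<longrightarrow>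
       nabla_curvature h i Q (map \<phi> \<xi>s) = nabla_curvature g i P \<xi>s)"

text \<open>
  \<open>modeled_on k g h\<close> states that \<open>g\<close> is \<open>k\<close>-modeled on \<open>h\<close>. The standing requirement that \<open>h\<close>
  be homogeneous is not built in, so that a negated occurrence really denies the existence of
  isomorphisms.
\<close>

definition modeled_on :: "nat \<Rightarrow> 'n::finite metric \<Rightarrow> 'm::finite metric \<Rightarrow> bool"
  where "modeled_on k g h \<longleftrightarrow> (\<forall>P Q. \<exists>\<phi>. model_isomorphism k g P h Q \<phi>)"

section \<open>Isometries, homogeneous and symmetric spaces\<close>

primrec times_cont_diff ::
    "nat \<Rightarrow> ('a::real_normed_vector \<Rightarrow> 'b::real_normed_vector) \<Rightarrow> bool"
  where
    "times_cont_diff 0 F \<longleftrightarrow> continuous_on UNIV F"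
  | "times_cont_diff (Suc m) F \<longleftrightarrow>
       (\<forall>P. F differentiable at P) \<and> (\<forall>u. times_cont_diff m (\<lambda>P. dir_deriv F P u))"

definition smooth_map :: "('a::real_normed_vector \<Rightarrow> 'b::real_normed_vector) \<Rightarrow> bool"
  where "smooth_map F \<longleftrightarrow> (\<forall>m. times_cont_diff m F)"

definition isometry_of :: "'n::finite metric \<Rightarrow> (real ^ 'n \<Rightarrow> real ^ 'n) \<Rightarrow> bool"
  where "isometry_of g \<phi> \<longleftrightarrow>
    bij \<phi> \<and> smooth_map \<phi> \<and> smooth_map (inv \<phi>) \<and>
    (\<forall>P u v. g (\<phi> P) (dir_deriv \<phi> P u) (dir_deriv \<phi> P v) = g P u v)"

definition homogeneous_space :: "'n::finite metric \<Rightarrow> bool"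
  where "homogeneous_space g \<longleftrightarrow> (\<forall>P Q. \<exists>\<phi>. isometry_of g \<phi> \<and> \<phi> P = Q)"

text \<open>Every point is fixed by an isometry whose differential there is minus the identity.\<close>

definition symmetric_space :: "'n::finite metric \<Rightarrow> bool"
  where "symmetric_space g \<longleftrightarrow>
    (\<forall>P. \<exists>\<sigma>. isometry_of g \<sigma> \<and> \<sigma> P = P \<and> (\<forall>u. dir_deriv \<sigma> P u = - u))"

section \<open>Holonomy and indecomposability\<close>

text \<open>
  Along a piecewise \<open>C\<^sup>1\<close> path the parallel transport equation is imposed off a finite set of
  parameters, the field \<open>Y\<close> along the path being continuous.
\<close>

definition parallel_along ::
    "'n::finite metric \<Rightarrow> (real \<Rightarrow> real ^ 'n) \<Rightarrow> (real \<Rightarrow> real ^ 'n) \<Rightarrow> bool"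
  where "parallel_along g \<gamma> Y \<longleftrightarrow> continuous_on {0..1} Y \<and>
    (\<exists>S. finite S \<and> (\<forall>t\<in>{0..1} - S.
      (Y has_vector_derivative
        - levi_civita g (\<gamma> t) (vector_derivative \<gamma> (at t)) (Y t)) (at t)))"

definition holonomy_group :: "'n::finite metric \<Rightarrow> 'n point \<Rightarrow> (real ^ 'n \<Rightarrow> real ^ 'n) set"
  where "holonomy_group g P = {\<tau>. \<exists>\<gamma>.
    valid_path \<gamma> \<and> pathstart \<gamma> = P \<and> pathfinish \<gamma> = P \<and>
    (\<forall>v. \<exists>Y. parallel_along g \<gamma> Y \<and> Y 0 = v \<and> Y 1 = \<tau> v)}"

definition indecomposable :: "'n::finite metric \<Rightarrow> bool"
  where "indecomposable g \<longleftrightarrow> (\<forall>P. \<not> (\<exists>V W.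
    subspace V \<and> subspace W \<and> V \<noteq> {0} \<and> W \<noteq> {0} \<and>
    V \<inter> W = {0} \<and> (\<forall>u. \<exists>v\<in>V. \<exists>w\<in>W. u = v + w) \<and>
    (\<forall>v\<in>V. \<forall>w\<in>W. g P v w = 0) \<and>
    (\<forall>\<tau>\<in>holonomy_group g P. \<tau> ` V \<subseteq> V \<and> \<tau> ` W \<subseteq> W)))"

section \<open>The manifolds\<close>

text \<open>
  The type \<open>'p\<close> indexes the coordinates \<open>z\<^sub>0, \<dots>, z\<^sub>p\<close>, hence has \<open>p + 1\<close> elements. The
  constructors name \<open>x\<close>, \<open>z\<close>, \<open>z\<close> with a tilde, and the starred coordinates, in this order.
\<close>

datatype 'p coord = CX | CZ 'p | CZt 'p | CXs | CZs 'p | CZts 'p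

lemma UNIV_coord:
  "(UNIV :: 'p coord set) =
     {CX, CXs} \<union> range CZ \<union> range CZt \<union> range CZs \<union> range CZts"
proof -
  have "c \<in> {CX, CXs} \<union> range CZ \<union> range CZt \<union> range CZs \<union> range CZts" for c :: "'p coord"
    by (cases c) auto
  then show ?thesis by blast
qed

instance coord :: (finite) finite
  by standard (simp add: UNIV_coord)

definition z_part :: "real ^ ('p::finite coord) \<Rightarrow> real ^ 'p"
  where "z_part P = (\<chi> a. P $ CZ a)"

definition M_metric :: "(real ^ 'p \<Rightarrow> real) \<Rightarrow> ('p::finite coord) metric"
  where "M_metric f P u v =
    - 2 * (f (z_part P) + (\<Sum>a\<in>UNIV. P $ CZ a * P $ CZt a)) * u $ CX * v $ CX
    + (u $ CX * v $ CXs + u $ CXs * v $ CX)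
    + (\<Sum>a\<in>UNIV. u $ CZ a * v $ CZs a + u $ CZs a * v $ CZ a)
    + (\<Sum>a\<in>UNIV. u $ CZt a * v $ CZts a + u $ CZts a * v $ CZt a)"

definition S_metric :: "('p::finite coord) metric"
  where "S_metric = M_metric (\<lambda>_. 0)"

text \<open>
  The enumeration \<open>e\<close>, a bijection from \<open>{0..p}\<close> onto the index type, determines which
  coordinate is \<open>z\<^sub>i\<close>. Only the values \<open>1 \<le> k \<le> p + 2\<close> are meaningful.
\<close>

definition f_fun :: "(nat \<Rightarrow> 'p) \<Rightarrow> nat \<Rightarrow> nat \<Rightarrow> real ^ 'p \<Rightarrow> real"
  where "f_fun e p k z =
    (if k \<le> p then (\<Sum>i=1..k. z $ e i * (z $ e 0) ^ (i + 1))
     else if k = p + 1 then (\<Sum>i=1..p. z $ e i * (z $ e 0) ^ (i + 1)) + (z $ e 0) ^ (p + 3)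
     else (\<Sum>i=1..p. z $ e i * (z $ e 0) ^ (i + 1)) + exp (z $ e 0))"

definition H_metric :: "(nat \<Rightarrow> 'p) \<Rightarrow> nat \<Rightarrow> nat \<Rightarrow> ('p::finite coord) metric"
  where "H_metric e p k = M_metric (f_fun e p k)"

end

(*
  In the coordinates (x, y, x', y') (primes for the starred ones) with y = (z, z~) the metric is determined by the potential
  F(y) = f(z) + z . z~. Its Christoffel map takes values in the starred directions, which the
  curvature annihilates, so nabla^i R is the derivative of F of order i + 2 contracted with x-y
  bivectors. Hence an affine change of y that carries F to s F plus an affine function, s > 0,
  extends to an isometry, and an equality of the derivatives of F of orders 2, ..., k + 2 up to
  such a change is an isomorphism of k-models. Quadratic polynomials in z can be absorbed into
  z . z~, and the monomials z_0^(i+2) into z_i z_0^(i+1) by a shear; this makes the affine group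
  of f_k transitive and matches the jets of f_k and f_j at the origin up to order j + 2. Conversely
  f_j has degree j + 2, so nabla^k R vanishes for it, but not for f_k.

  A geodesic symmetry would force F(P + v) - F(P - v) to be affine in v, which the cubic term
  z_1 z_0^2 prevents. The holonomy of the symmetric space contains, for every
  vector w, the unipotent map adding (v_y . w) to v_x' and subtracting v_x w from v_y', and these
  maps admit no invariant orthogonal splitting.
*)

theory Submission
  imports Defs
begin

section \<open>Iterated directional derivatives\<close>

text \<open>A degree count explains the choice of the family. With \<open>K = min k p\<close>, the
  shear in z_1, ..., z_K absorbs the powers z_0^3, ..., z_0^(K+2), and z . z~ takes care of the
  degrees up to 2. A translation of \<open>f_k\<close> must therefore leave an error of degree at
  most K + 2. It does: the monomials contribute at most degree K + 1; for k = p + 1 the leading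
  terms of (z_0 + c)^(p+3) - z_0^(p+3) cancel; for k = p + 2 the exponential only acquires the
  factor exp c. This last case is why potentials are compared up to a factor s, which has to be
  positive because x is rescaled by 1 / sqrt s.

  The obstacle in disproving symmetry is that a geodesic symmetry is a mere smooth isometry, without
  any block or affine structure. Geodesics are avoided: Koszul's argument expresses the second
  derivative of an isometry through the Christoffel maps, and since these take values in the starred
  directions, the x- and y-parts of the symmetry turn out to be point reflections. Its starred parts
  then carry the difference F(y) - F(2 y_P - y).\<close>

lemma dir_deriv_eqI:
  assumes "(F has_derivative F') (at P)"
  shows "dir_deriv F P u = F' u"
  unfolding dir_deriv_def using frechet_derivative_at[OF assms] by simp

lemma has_derivative_dir_deriv:
  assumes "F differentiable at P"
  shows "(F has_derivative dir_deriv F P) (at P)"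
proof -
  have "dir_deriv F P = frechet_derivative F (at P)"
    by (auto simp: dir_deriv_def)
  with assms show ?thesis by (simp add: frechet_derivative_works)
qed

lemma linear_dir_deriv: "F differentiable at P \<Longrightarrow> linear (dir_deriv F P)"
  using has_derivative_dir_deriv has_derivative_linear by blast

lemma dir_deriv_const [simp]: "dir_deriv (\<lambda>_. c) P u = 0"
  by (rule dir_deriv_eqI) (auto intro!: derivative_eq_intros)

lemma dir_deriv_add:
  assumes "F differentiable at P" "G differentiable at P"
  shows "dir_deriv (\<lambda>x. F x + G x) P u = dir_deriv F P u + dir_deriv G P u"
  by (rule dir_deriv_eqI)
    (intro has_derivative_add has_derivative_dir_deriv assms)

lemma dir_deriv_bounded_bilinear:
  assumes "bounded_bilinear B" "F differentiable at P" "G differentiable at P"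
  shows "dir_deriv (\<lambda>x. B (F x) (G x)) P u = B (F P) (dir_deriv G P u) + B (dir_deriv F P u) (G P)"
  by (rule dir_deriv_eqI)
    (intro bounded_bilinear.FDERIV[OF assms(1)] has_derivative_dir_deriv assms(2,3))

lemma dir_deriv_bounded_linear_comp:
  assumes "bounded_linear T" "F differentiable at P"
  shows "dir_deriv (\<lambda>x. T (F x)) P u = T (dir_deriv F P u)"
  by (rule dir_deriv_eqI)
    (intro bounded_linear.has_derivative[OF assms(1)] has_derivative_dir_deriv assms(2))

lemma differentiable_bounded_linear_comp:
  assumes "bounded_linear T" "F differentiable at P"
  shows "(\<lambda>x. T (F x)) differentiable at P"
  using bounded_linear.has_derivative[OF assms(1)] assms(2) unfolding differentiable_def by blast

lemma dir_deriv_bounded_linear: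
  "bounded_linear T \<Longrightarrow> dir_deriv T P u = T u"
  by (rule dir_deriv_eqI) (rule bounded_linear_imp_has_derivative)

lemma has_derivative_comp_affine:
  assumes "bounded_linear T" "F differentiable at (T P + b)"
  shows "((\<lambda>x. F (T x + b)) has_derivative (\<lambda>u. dir_deriv F (T P + b) (T u))) (at P)"
proof -
  have "((\<lambda>x. T x + b) has_derivative T) (at P)"
    using bounded_linear_imp_has_derivative[OF assms(1)] by (auto intro!: derivative_eq_intros)
  from diff_chain_at[OF this has_derivative_dir_deriv[OF assms(2)]] show ?thesis
    by (simp add: o_def)
qed

lemma dir_deriv_comp_affine:
  assumes "bounded_linear T" "F differentiable at (T P + b)"
  shows "dir_deriv (\<lambda>x. F (T x + b)) P u = dir_deriv F (T P + b) (T u)"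
  by (rule dir_deriv_eqI) (rule has_derivative_comp_affine[OF assms])

lemma dir_deriv_comp_linear:
  assumes "bounded_linear T" "F differentiable at (T P)"
  shows "dir_deriv (\<lambda>x. F (T x)) P u = dir_deriv F (T P) (T u)"
  using dir_deriv_comp_affine[of T F P 0] assms by simp

section \<open>Closure properties of smooth maps\<close>

lemma times_cont_diff_continuous:
  "times_cont_diff m F \<Longrightarrow> continuous_on UNIV F"
  by (cases m) (auto simp: continuous_on_eq_continuous_at intro: differentiable_imp_continuous_within)

lemma times_cont_diff_mono: "times_cont_diff (Suc m) F \<Longrightarrow> times_cont_diff m F"
proof (induction m arbitrary: F)
  case 0
  then show ?case using times_cont_diff_continuous[of 1 F] by simp
qed simp

lemma times_cont_diff_const: "times_cont_diff m (\<lambda>_. c)"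
  by (induction m arbitrary: c) simp_all

lemma times_cont_diff_add:
  "times_cont_diff m F \<Longrightarrow> times_cont_diff m G \<Longrightarrow> times_cont_diff m (\<lambda>x. F x + G x)"
proof (induction m arbitrary: F G)
  case (Suc m)
  then show ?case by (simp add: dir_deriv_add)
qed (auto intro: continuous_intros)

lemma times_cont_diff_bilinear:
  assumes B: "bounded_bilinear B"
  shows "times_cont_diff m F \<Longrightarrow> times_cont_diff m G \<Longrightarrow> times_cont_diff m (\<lambda>x. B (F x) (G x))"
proof (induction m arbitrary: F G)
  case 0
  then show ?case by (auto intro: bounded_bilinear.continuous_on[OF B])
next
  case (Suc m)
  have "(\<lambda>x. B (F x) (G x)) differentiable at P" for P
    using Suc.prems bounded_bilinear.FDERIV[OF B] unfolding differentiable_def times_cont_diff.simps by blast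
  moreover have "times_cont_diff m (\<lambda>P. dir_deriv (\<lambda>x. B (F x) (G x)) P u)" for u
    using Suc.prems times_cont_diff_mono[OF Suc.prems(1)] times_cont_diff_mono[OF Suc.prems(2)]
    by (simp add: dir_deriv_bounded_bilinear[OF B] times_cont_diff_add Suc.IH)
  ultimately show ?case by simp
qed

lemma times_cont_diff_bounded_linear:
  assumes "bounded_linear T"
  shows "times_cont_diff m T"
proof (cases m)
  case 0
  then show ?thesis using assms by (simp add: linear_continuous_on)
next
  case (Suc n)
  then show ?thesis
    using assms by (simp add: dir_deriv_bounded_linear times_cont_diff_const bounded_linear_imp_differentiable)
qed

lemma times_cont_diff_comp_affine:
  assumes T: "bounded_linear T"
  shows "times_cont_diff m F \<Longrightarrow> times_cont_diff m (\<lambda>x. F (T x + b))"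
proof (induction m arbitrary: F)
  case 0
  have "continuous_on UNIV (\<lambda>x. T x + b)"
    using linear_continuous_on[OF T] by (auto intro: continuous_intros)
  with 0 show ?case by (auto intro: continuous_on_compose2)
next
  case (Suc m)
  then show ?case
    using has_derivative_comp_affine[OF T, of F _ b]
    by (auto simp: dir_deriv_comp_affine[OF T] differentiable_def)
qed

lemma smooth_map_differentiable: "smooth_map F \<Longrightarrow> F differentiable at P"
  unfolding smooth_map_def by (metis times_cont_diff.simps(2))

lemma smooth_map_dir_deriv: "smooth_map F \<Longrightarrow> smooth_map (\<lambda>P. dir_deriv F P u)"
  unfolding smooth_map_def by (metis times_cont_diff.simps(2))

lemma smooth_map_continuous: "smooth_map F \<Longrightarrow> isCont F P"
  by (simp add: smooth_map_differentiable differentiable_imp_continuous_within)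

lemma smooth_map_const: "smooth_map (\<lambda>_. c)"
  by (simp add: smooth_map_def times_cont_diff_const)

lemma smooth_map_add: "smooth_map F \<Longrightarrow> smooth_map G \<Longrightarrow> smooth_map (\<lambda>x. F x + G x)"
  by (simp add: smooth_map_def times_cont_diff_add)

lemma smooth_map_bilinear:
  "bounded_bilinear B \<Longrightarrow> smooth_map F \<Longrightarrow> smooth_map G \<Longrightarrow> smooth_map (\<lambda>x. B (F x) (G x))"
  by (simp add: smooth_map_def times_cont_diff_bilinear)

lemmas smooth_map_mult = smooth_map_bilinear[OF bounded_bilinear_mult]
lemmas smooth_map_scaleR = smooth_map_bilinear[OF bounded_bilinear_scaleR]
lemmas smooth_map_inner = smooth_map_bilinear[OF bounded_bilinear_inner]

lemma smooth_map_linear: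
  fixes T :: "'a::euclidean_space \<Rightarrow> 'b::real_normed_vector"
  shows "linear T \<Longrightarrow> smooth_map T"
  by (simp add: smooth_map_def times_cont_diff_bounded_linear linear_conv_bounded_linear)

lemma smooth_map_comp_affine:
  fixes T :: "'a::euclidean_space \<Rightarrow> 'b::real_normed_vector"
  shows "linear T \<Longrightarrow> smooth_map F \<Longrightarrow> smooth_map (\<lambda>x. F (T x + b))"
  by (simp add: smooth_map_def times_cont_diff_comp_affine linear_conv_bounded_linear)

lemma smooth_map_comp_linear:
  fixes T :: "'a::euclidean_space \<Rightarrow> 'b::real_normed_vector"
  shows "linear T \<Longrightarrow> smooth_map F \<Longrightarrow> smooth_map (\<lambda>x. F (T x))"
  using smooth_map_comp_affine[of T F 0] by simp

lemma smooth_map_linear_comp: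
  fixes T :: "'b::euclidean_space \<Rightarrow> 'c::real_normed_vector"
  assumes "linear T" "smooth_map F"
  shows "smooth_map (\<lambda>x. T (F x))"
proof -
  have "bounded_bilinear (\<lambda>(r::real) x. r *\<^sub>R T x)"
    using bounded_bilinear.comp[OF bounded_bilinear_scaleR bounded_linear_ident] assms(1)
    by (simp add: linear_conv_bounded_linear)
  from smooth_map_bilinear[OF this smooth_map_const[of 1] assms(2)] show ?thesis by simp
qed

lemma smooth_map_sum: "(\<And>i. i \<in> I \<Longrightarrow> smooth_map (F i)) \<Longrightarrow> smooth_map (\<lambda>x. \<Sum>i\<in>I. F i x)"
  by (induction I rule: infinite_finite_induct) (auto intro: smooth_map_add smooth_map_const)

lemma smooth_map_cmult: "smooth_map F \<Longrightarrow> smooth_map (\<lambda>x. c * F x :: real)"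
  by (intro smooth_map_mult smooth_map_const)

lemma smooth_map_minus: "smooth_map F \<Longrightarrow> smooth_map (\<lambda>x. - F x :: 'b::real_normed_vector)"
  using smooth_map_scaleR[OF smooth_map_const[of "-1"], of F] by simp

lemma smooth_map_diff:
  "smooth_map F \<Longrightarrow> smooth_map G \<Longrightarrow> smooth_map (\<lambda>x. F x - G x :: 'b::real_normed_vector)"
  using smooth_map_add[OF _ smooth_map_minus, of F G] by simp

lemma smooth_map_power: "smooth_map F \<Longrightarrow> smooth_map (\<lambda>x. F x ^ n :: real)"
  by (induction n) (auto intro: smooth_map_mult smooth_map_const)

lemma smooth_map_exp: "smooth_map (exp :: real \<Rightarrow> real)"
proof -
  have d: "dir_deriv (\<lambda>x. c * exp x) = (\<lambda>(P::real) u. c * u * exp P)" for c :: real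
    by (intro ext dir_deriv_eqI) (auto intro!: derivative_eq_intros)
  have "times_cont_diff m (\<lambda>x::real. c * exp x)" for m and c :: real
    by (induction m arbitrary: c)
      (auto simp: d intro!: continuous_intros derivative_eq_intros
        differentiableI[of _ "\<lambda>u. u * exp P" for P])
  from this[of _ 1] show ?thesis by (simp add: smooth_map_def)
qed

section \<open>Symmetry of second derivatives\<close>

lemma DERIV_along_line:
  fixes F :: "'a::real_normed_vector \<Rightarrow> real"
  assumes "F differentiable at (P + s *\<^sub>R u)"
  shows "((\<lambda>s. F (P + s *\<^sub>R u)) has_real_derivative dir_deriv F (P + s *\<^sub>R u) u) (at s)"
proof -
  have l: "bounded_linear (\<lambda>s. s *\<^sub>R u)" by (rule bounded_linear_scaleR_left)
  have "((\<lambda>s. F (s *\<^sub>R u + P)) has_derivative (\<lambda>t. dir_deriv F (s *\<^sub>R u + P) (t *\<^sub>R u))) (at s)"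
    using has_derivative_comp_affine[OF l, of F s P] assms by (simp add: add.commute)
  moreover have "linear (dir_deriv F (s *\<^sub>R u + P))"
    using linear_dir_deriv assms by (metis add.commute)
  ultimately show ?thesis
    by (simp add: has_field_derivative_def linear_cmul add.commute mult_commute_abs)
qed

text \<open>The mean value theorem is applied twice, first to the increment in direction
  \<open>v\<close> as a function along \<open>u\<close>, then to the resulting derivative along
  \<open>v\<close>. The second difference is symmetric in \<open>u\<close> and \<open>v\<close>,
  while the right-hand side singles out one order of differentiation.\<close>

lemma second_difference_mean_value:
  fixes F :: "'a::real_normed_vector \<Rightarrow> real"
  assumes F: "smooth_map F" and "0 < h"
  shows "\<exists>r s. 0 < r \<and> r < h \<and> 0 < s \<and> s < h \<and>
    F (P + h *\<^sub>R u + h *\<^sub>R v) - F (P + h *\<^sub>R u) - F (P + h *\<^sub>R v) + F P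
      = h * h * dir_deriv (\<lambda>q. dir_deriv F q u) (P + r *\<^sub>R u + s *\<^sub>R v) v"
proof -
  let ?f = "\<lambda>r. F (P + h *\<^sub>R v + r *\<^sub>R u) - F (P + r *\<^sub>R u)"
  have "DERIV ?f r :> dir_deriv F (P + h *\<^sub>R v + r *\<^sub>R u) u - dir_deriv F (P + r *\<^sub>R u) u" for r
    by (intro DERIV_diff DERIV_along_line smooth_map_differentiable F)
  from MVT2[OF \<open>0 < h\<close> this]
  obtain r where r: "0 < r" "r < h"
    and 1: "?f h - ?f 0 = h * (dir_deriv F (P + h *\<^sub>R v + r *\<^sub>R u) u - dir_deriv F (P + r *\<^sub>R u) u)"
    by auto
  let ?g = "\<lambda>s. dir_deriv F (P + r *\<^sub>R u + s *\<^sub>R v) u"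
  have "DERIV ?g s :> dir_deriv (\<lambda>q. dir_deriv F q u) (P + r *\<^sub>R u + s *\<^sub>R v) v" for s
    using DERIV_along_line[OF smooth_map_differentiable[OF smooth_map_dir_deriv[OF F]]] by blast
  from MVT2[OF \<open>0 < h\<close> this]
  obtain s where s: "0 < s" "s < h"
    and 2: "?g h - ?g 0 = h * dir_deriv (\<lambda>q. dir_deriv F q u) (P + r *\<^sub>R u + s *\<^sub>R v) v"
    by auto
  from r s 1 2 show ?thesis
    by (intro exI[of _ r] exI[of _ s]) (simp add: algebra_simps)
qed

text \<open>Both orders of differentiation compute the same second difference, so the two mixed
  derivatives agree at two points of one small parallelogram. As it shrinks to \<open>P\<close>,
  continuity gives equality there.\<close>

lemma dir_deriv_commute_real:
  fixes F :: "'a::real_normed_vector \<Rightarrow> real"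
  assumes F: "smooth_map F"
  shows "dir_deriv (\<lambda>q. dir_deriv F q u) P v = dir_deriv (\<lambda>q. dir_deriv F q v) P u"
proof -
  let ?G = "\<lambda>u v. \<lambda>P. dir_deriv (\<lambda>q. dir_deriv F q u) P v"
  define h :: "nat \<Rightarrow> real" where "h n = inverse (real (Suc n))" for n
  have h: "h n > 0" "h \<longlonglongrightarrow> 0" for n
    using LIMSEQ_inverse_real_of_nat unfolding h_def[abs_def] by simp_all
  have ex: "\<exists>r s r' s'. 0 < r \<and> r < h n \<and> 0 < s \<and> s < h n \<and> 0 < r' \<and> r' < h n \<and> 0 < s' \<and> s' < h n \<and>
      ?G u v (P + r *\<^sub>R u + s *\<^sub>R v) = ?G v u (P + r' *\<^sub>R v + s' *\<^sub>R u)" for n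
  proof -
    obtain r s where 1: "0 < r" "r < h n" "0 < s" "s < h n"
      "F (P + h n *\<^sub>R u + h n *\<^sub>R v) - F (P + h n *\<^sub>R u) - F (P + h n *\<^sub>R v) + F P
        = h n * h n * ?G u v (P + r *\<^sub>R u + s *\<^sub>R v)"
      using second_difference_mean_value[OF F h(1)] by blast
    obtain r' s' where 2: "0 < r'" "r' < h n" "0 < s'" "s' < h n"
      "F (P + h n *\<^sub>R v + h n *\<^sub>R u) - F (P + h n *\<^sub>R v) - F (P + h n *\<^sub>R u) + F P
        = h n * h n * ?G v u (P + r' *\<^sub>R v + s' *\<^sub>R u)"
      using second_difference_mean_value[OF F h(1)] by blast
    have "F (P + h n *\<^sub>R v + h n *\<^sub>R u) = F (P + h n *\<^sub>R u + h n *\<^sub>R v)"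
      by (simp add: add.commute add.left_commute)
    with 1(5) 2(5) have "h n * h n * ?G u v (P + r *\<^sub>R u + s *\<^sub>R v)
        = h n * h n * ?G v u (P + r' *\<^sub>R v + s' *\<^sub>R u)"
      by linarith
    with h(1)[of n] have "?G u v (P + r *\<^sub>R u + s *\<^sub>R v) = ?G v u (P + r' *\<^sub>R v + s' *\<^sub>R u)"
      by simp
    with 1 2 show ?thesis by blast
  qed
  obtain r s r' s' where rs: "\<And>n. 0 < r n \<and> r n < h n \<and> 0 < s n \<and> s n < h n \<and>
      0 < r' n \<and> r' n < h n \<and> 0 < s' n \<and> s' n < h n \<and>
      ?G u v (P + r n *\<^sub>R u + s n *\<^sub>R v) = ?G v u (P + r' n *\<^sub>R v + s' n *\<^sub>R u)"
    using ex by metis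
  have z: "a \<longlonglongrightarrow> 0" if "\<And>n. 0 < a n \<and> a n < h n" for a
    by (rule real_tendsto_sandwich[OF _ _ tendsto_const h(2)])
      (use that in \<open>auto intro!: always_eventually less_imp_le\<close>)
  have lim: "(\<lambda>n. G (P + a n *\<^sub>R x + b n *\<^sub>R y)) \<longlonglongrightarrow> G P"
    if "smooth_map G" "a \<longlonglongrightarrow> 0" "b \<longlonglongrightarrow> 0" for G :: "'a \<Rightarrow> real" and a b x y
  proof -
    have "(\<lambda>n. P + a n *\<^sub>R x + b n *\<^sub>R y) \<longlonglongrightarrow> P + 0 *\<^sub>R x + 0 *\<^sub>R y"
      by (intro tendsto_intros that)
    with isCont_tendsto_compose[OF smooth_map_continuous[OF that(1)]] show ?thesis by auto
  qed
  have "(\<lambda>n. ?G u v (P + r n *\<^sub>R u + s n *\<^sub>R v)) \<longlonglongrightarrow> ?G u v P"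
    by (rule lim) (use rs in \<open>auto intro!: z smooth_map_dir_deriv F\<close>)
  moreover have "(\<lambda>n. ?G v u (P + r' n *\<^sub>R v + s' n *\<^sub>R u)) \<longlonglongrightarrow> ?G v u P"
    by (rule lim) (use rs in \<open>auto intro!: z smooth_map_dir_deriv F\<close>)
  ultimately show ?thesis using rs LIMSEQ_unique by (metis (no_types, lifting) ext)
qed

lemma dir_deriv_commute:
  fixes F :: "'a::real_normed_vector \<Rightarrow> 'b::euclidean_space"
  assumes F: "smooth_map F"
  shows "dir_deriv (\<lambda>q. dir_deriv F q u) P v = dir_deriv (\<lambda>q. dir_deriv F q v) P u"
proof (rule euclidean_eqI)
  fix b :: 'b
  have Fb: "smooth_map (\<lambda>x. F x \<bullet> b)" by (intro smooth_map_inner F smooth_map_const)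
  have i: "bounded_linear (\<lambda>x. x \<bullet> b)" by (rule bounded_linear_inner_left)
  have c: "dir_deriv (\<lambda>x. G x \<bullet> b) Q w = dir_deriv G Q w \<bullet> b"
    if "smooth_map G" for G :: "'a \<Rightarrow> 'b" and Q w
    using dir_deriv_bounded_linear_comp[OF i smooth_map_differentiable[OF that]] .
  show "dir_deriv (\<lambda>q. dir_deriv F q u) P v \<bullet> b = dir_deriv (\<lambda>q. dir_deriv F q v) P u \<bullet> b"
    using dir_deriv_commute_real[OF Fb, of u P v]
    by (simp add: c F smooth_map_dir_deriv)
qed

text \<open>The head is the direction differentiated last, as in \<open>nabla_tensor\<close>, whose
  head argument is the newest slot. The last list element acts on \<open>F\<close> first, which
  suits inductions on degree and on order of vanishing.\<close>

primrec iter_deriv :: "'a::real_normed_vector list \<Rightarrow> ('a \<Rightarrow> real) \<Rightarrow> 'a \<Rightarrow> real"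
  where
    "iter_deriv [] F = F"
  | "iter_deriv (v # vs) F = (\<lambda>P. dir_deriv (iter_deriv vs F) P v)"

lemma iter_deriv_append: "iter_deriv (us @ vs) F = iter_deriv us (iter_deriv vs F)"
  by (induction us) simp_all

lemma iter_deriv_const: "iter_deriv vs (\<lambda>_. c) = (\<lambda>_. if vs = [] then c else 0)"
  by (induction vs arbitrary: c) auto

lemma smooth_map_iter_deriv: "smooth_map F \<Longrightarrow> smooth_map (iter_deriv vs F)"
  by (induction vs) (simp_all add: smooth_map_dir_deriv)

lemma iter_deriv_add:
  assumes "smooth_map F" "smooth_map G"
  shows "iter_deriv vs (\<lambda>x. F x + G x) = (\<lambda>x. iter_deriv vs F x + iter_deriv vs G x)"
  by (induction vs) (simp_all add: dir_deriv_add smooth_map_differentiable smooth_map_iter_deriv assms)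

lemma iter_deriv_cmult:
  assumes "smooth_map F"
  shows "iter_deriv vs (\<lambda>x. c * F x) = (\<lambda>x. c * iter_deriv vs F x)"
  by (induction vs)
    (simp_all add: dir_deriv_bounded_linear_comp[OF bounded_linear_mult_right]
      smooth_map_differentiable smooth_map_iter_deriv assms)

lemma iter_deriv_comp_affine:
  fixes T :: "'a::euclidean_space \<Rightarrow> 'b::real_normed_vector"
  assumes "linear T" "smooth_map F"
  shows "iter_deriv vs (\<lambda>x. F (T x + b)) = (\<lambda>x. iter_deriv (map T vs) F (T x + b))"
  by (induction vs)
    (use assms in \<open>simp_all add: dir_deriv_comp_affine smooth_map_differentiable smooth_map_iter_deriv
      linear_conv_bounded_linear\<close>)

lemma iter_deriv_zero_direction:
  assumes "smooth_map F" "0 \<in> set vs"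
  shows "iter_deriv vs F = (\<lambda>_. 0)"
  using assms(2)
proof (induction vs)
  case (Cons v vs)
  have "dir_deriv (iter_deriv vs F) P 0 = 0" for P
    by (intro linear_0 linear_dir_deriv smooth_map_differentiable smooth_map_iter_deriv assms)
  with Cons show ?case by auto
qed simp

lemma iter_deriv_affine:
  assumes "linear (l :: 'a::euclidean_space \<Rightarrow> real)" "2 \<le> length vs"
  shows "iter_deriv vs (\<lambda>x. l x + c) = (\<lambda>_. 0)"
proof -
  from assms(2) obtain us v where vs: "vs = us @ [v]" "us \<noteq> []"
    by (cases vs rule: rev_exhaust) force+
  have "dir_deriv (\<lambda>x. l x + c) = (\<lambda>_ u. l u)"
    using assms(1) by (intro ext dir_deriv_eqI) (auto intro!: derivative_eq_intros
      bounded_linear_imp_has_derivative simp: linear_conv_bounded_linear)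
  with vs show ?thesis by (simp add: iter_deriv_append iter_deriv_const)
qed

subsection \<open>Degree and order of vanishing\<close>

text \<open>Degree is measured by repeated differentiation, which avoids polynomials in several
  variables and leads directly to \<open>iter_deriv_degree\<close>.\<close>

primrec degree_at_most :: "nat \<Rightarrow> ('a::real_normed_vector \<Rightarrow> real) \<Rightarrow> bool"
  where
    "degree_at_most 0 F \<longleftrightarrow> (\<exists>c. F = (\<lambda>_. c))"
  | "degree_at_most (Suc d) F \<longleftrightarrow> smooth_map F \<and> (\<forall>u. degree_at_most d (\<lambda>P. dir_deriv F P u))"

lemma degree_at_most_smooth: "degree_at_most d F \<Longrightarrow> smooth_map F"
  by (cases d) (auto simp: smooth_map_const)

lemma degree_at_most_const: "degree_at_most d (\<lambda>_. c)"
  by (induction d arbitrary: c) (auto simp: smooth_map_const)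

lemma degree_at_most_Suc: "degree_at_most d F \<Longrightarrow> degree_at_most (Suc d) F"
proof (induction d arbitrary: F)
  case 0
  then show ?case by (auto simp: smooth_map_const)
next
  case (Suc d)
  then show ?case by (metis degree_at_most.simps(2))
qed

lemma degree_at_most_mono:
  assumes "degree_at_most d F" "d \<le> d'"
  shows "degree_at_most d' F"
  using assms(2,1) by (induction d' rule: dec_induct) (auto simp del: degree_at_most.simps intro: degree_at_most_Suc)

lemma degree_at_most_add:
  "degree_at_most d F \<Longrightarrow> degree_at_most d G \<Longrightarrow> degree_at_most d (\<lambda>x. F x + G x)"
proof (induction d arbitrary: F G)
  case (Suc d)
  then show ?case by (simp add: dir_deriv_add smooth_map_differentiable smooth_map_add)
qed auto

text \<open>Leibniz rule and induction on \<open>a + b\<close>. A factor of degree 0 has no smaller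
  degree to pass to, but it is constant, so its Leibniz term is 0.\<close>

lemma degree_at_most_mult:
  "degree_at_most a F \<Longrightarrow> degree_at_most b G \<Longrightarrow> degree_at_most (a + b) (\<lambda>x. F x * G x)"
proof (induction "a + b" arbitrary: a b F G)
  case 0
  then show ?case by auto
next
  case (Suc n)
  have s: "smooth_map F" "smooth_map G"
    using Suc.prems degree_at_most_smooth by blast+
  have 1: "degree_at_most n (\<lambda>x. F x * dir_deriv G x u)" for u
  proof (cases b)
    case 0
    with Suc.prems have "(\<lambda>x. F x * dir_deriv G x u) = (\<lambda>_. 0)" by auto
    then show ?thesis by (simp add: degree_at_most_const)
  next
    case (Suc b')
    with Suc.hyps Suc.prems show ?thesis
      by (metis add_Suc_right degree_at_most.simps(2) nat.inject)
  qed
  have 2: "degree_at_most n (\<lambda>x. dir_deriv F x u * G x)" for u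
  proof (cases a)
    case 0
    with Suc.prems have "(\<lambda>x. dir_deriv F x u * G x) = (\<lambda>_. 0)" by auto
    then show ?thesis by (simp add: degree_at_most_const)
  next
    case (Suc a')
    with Suc.hyps Suc.prems show ?thesis
      by (metis add_Suc degree_at_most.simps(2) nat.inject)
  qed
  have "(\<lambda>P. dir_deriv (\<lambda>x. F x * G x) P u)
      = (\<lambda>P. F P * dir_deriv G P u + dir_deriv F P u * G P)" for u
    by (simp add: dir_deriv_bounded_bilinear[OF bounded_bilinear_mult] smooth_map_differentiable s)
  with 1 2 s Suc.hyps(2)[symmetric] show ?case
    by (simp add: smooth_map_mult degree_at_most_add)
qed

lemma degree_at_most_power: "degree_at_most d F \<Longrightarrow> degree_at_most (n * d) (\<lambda>x. F x ^ n)"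
  by (induction n) (simp_all add: degree_at_most_const degree_at_most_mult)

lemma degree_at_most_sum:
  "(\<And>i. i \<in> I \<Longrightarrow> degree_at_most d (F i)) \<Longrightarrow> degree_at_most d (\<lambda>x. \<Sum>i\<in>I. F i x)"
  by (induction I rule: infinite_finite_induct) (auto intro: degree_at_most_add degree_at_most_const)

lemma degree_at_most_linear:
  assumes "linear (l :: 'a::euclidean_space \<Rightarrow> real)"
  shows "degree_at_most 1 l"
  using assms by (simp add: smooth_map_linear dir_deriv_bounded_linear linear_conv_bounded_linear) auto

lemma iter_deriv_degree:
  "degree_at_most d F \<Longrightarrow> d < length vs \<Longrightarrow> iter_deriv vs F = (\<lambda>_. 0)"
proof (induction d arbitrary: F vs)
  case 0
  then show ?case by (auto simp: iter_deriv_const)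
next
  case (Suc d)
  then obtain us v where vs: "vs = us @ [v]" by (cases vs rule: rev_exhaust) auto
  with Suc show ?case by (simp add: iter_deriv_append)
qed

text \<open>The derivatives of order less than \<open>n\<close> vanish at \<open>P\<close>, so the
  index is one more than the order of the vanishing jet.\<close>

primrec vanishes_to :: "nat \<Rightarrow> ('a::real_normed_vector \<Rightarrow> real) \<Rightarrow> 'a \<Rightarrow> bool"
  where
    "vanishes_to 0 F P \<longleftrightarrow> True"
  | "vanishes_to (Suc n) F P \<longleftrightarrow> F P = 0 \<and> (\<forall>u. vanishes_to n (\<lambda>Q. dir_deriv F Q u) P)"

lemma vanishes_to_mono: "vanishes_to n F P \<Longrightarrow> m \<le> n \<Longrightarrow> vanishes_to m F P"
proof (induction m arbitrary: n F)
  case (Suc m)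
  then show ?case by (cases n) auto
qed simp

lemma vanishes_to_zero: "vanishes_to n (\<lambda>_. 0) P"
  by (induction n) simp_all

lemma vanishes_to_add:
  "smooth_map F \<Longrightarrow> smooth_map G \<Longrightarrow> vanishes_to n F P \<Longrightarrow> vanishes_to n G P
    \<Longrightarrow> vanishes_to n (\<lambda>x. F x + G x) P"
  by (induction n arbitrary: F G) (simp_all add: dir_deriv_add smooth_map_differentiable smooth_map_dir_deriv)

lemma vanishes_to_mult:
  "smooth_map F \<Longrightarrow> smooth_map G \<Longrightarrow> vanishes_to a F P \<Longrightarrow> vanishes_to b G P
    \<Longrightarrow> vanishes_to (a + b) (\<lambda>x. F x * G x) P"
proof (induction "a + b" arbitrary: a b F G)
  case 0
  then show ?case by auto
next
  case (Suc n)
  have s: "smooth_map F" "smooth_map G" by fact+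
  have 1: "vanishes_to n (\<lambda>x. F x * dir_deriv G x u) P" for u
  proof (cases b)
    case 0
    \<comment> \<open>Differentiating a factor of order 0 gives again order 0, so the order of the
      other factor is lowered to make the sum equal to \<open>n\<close>.\<close>
    have "vanishes_to (a - 1) F P" using Suc.prems vanishes_to_mono by (metis diff_le_self)
    from Suc.hyps(1)[OF _ s(1) smooth_map_dir_deriv[OF s(2)] this, of 0] 0 Suc.hyps(2) show ?thesis
      by auto
  next
    case (Suc b')
    with Suc.hyps Suc.prems show ?thesis
      by (metis add_Suc_right vanishes_to.simps(2) nat.inject smooth_map_dir_deriv)
  qed
  have 2: "vanishes_to n (\<lambda>x. dir_deriv F x u * G x) P" for u
  proof (cases a)
    case 0
    have "vanishes_to (b - 1) G P" using Suc.prems vanishes_to_mono by (metis diff_le_self)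
    from Suc.hyps(1)[OF _ smooth_map_dir_deriv[OF s(1)] s(2) _ this, of 0] 0 Suc.hyps(2) show ?thesis
      by auto
  next
    case (Suc a')
    with Suc.hyps Suc.prems show ?thesis
      by (metis add_Suc vanishes_to.simps(2) nat.inject smooth_map_dir_deriv)
  qed
  have d: "(\<lambda>Q. dir_deriv (\<lambda>x. F x * G x) Q u)
      = (\<lambda>Q. F Q * dir_deriv G Q u + dir_deriv F Q u * G Q)" for u
    by (simp add: dir_deriv_bounded_bilinear[OF bounded_bilinear_mult] smooth_map_differentiable s)
  have "F P = 0 \<or> G P = 0"
    using Suc.hyps(2) Suc.prems(3,4) by (cases a; cases b) auto
  then have "F P * G P = 0" by simp
  moreover have "vanishes_to n (\<lambda>Q. F Q * dir_deriv G Q u + dir_deriv F Q u * G Q) P" for u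
    by (intro vanishes_to_add smooth_map_mult smooth_map_dir_deriv s 1 2)
  ultimately show ?case
    unfolding Suc.hyps(2)[symmetric] by (simp add: d)
qed

lemma vanishes_to_power:
  "smooth_map F \<Longrightarrow> vanishes_to a F P \<Longrightarrow> vanishes_to (n * a) (\<lambda>x. F x ^ n) P"
  by (induction n) (simp_all add: vanishes_to_mult smooth_map_power)

lemma vanishes_to_sum:
  "(\<And>i. i \<in> I \<Longrightarrow> smooth_map (F i) \<and> vanishes_to n (F i) P) \<Longrightarrow> vanishes_to n (\<lambda>x. \<Sum>i\<in>I. F i x) P"
  by (induction I rule: infinite_finite_induct)
    (auto intro!: vanishes_to_add vanishes_to_zero smooth_map_sum)

lemma iter_deriv_vanishes:
  "vanishes_to n F P \<Longrightarrow> length vs < n \<Longrightarrow> iter_deriv vs F P = 0"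
proof (induction n arbitrary: F vs)
  case (Suc n)
  then show ?case
    by (cases vs rule: rev_exhaust) (auto simp: iter_deriv_append)
qed simp

section \<open>Block coordinates\<close>

definition x_coord :: "real ^ ('p::finite coord) \<Rightarrow> real"
  where "x_coord P = P $ CX"

definition y_coord :: "real ^ ('p::finite coord) \<Rightarrow> (real ^ 'p) \<times> (real ^ 'p)"
  where "y_coord P = (z_part P, \<chi> a. P $ CZt a)"

definition xs_coord :: "real ^ ('p::finite coord) \<Rightarrow> real"
  where "xs_coord P = P $ CXs"

definition ys_coord :: "real ^ ('p::finite coord) \<Rightarrow> (real ^ 'p) \<times> (real ^ 'p)"
  where "ys_coord P = (\<chi> a. P $ CZs a, \<chi> a. P $ CZts a)"

definition mk_point ::
    "real \<Rightarrow> (real ^ 'p) \<times> (real ^ 'p) \<Rightarrow> real \<Rightarrow> (real ^ 'p) \<times> (real ^ 'p) \<Rightarrow> real ^ ('p::finite coord)"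
  where "mk_point x y xs ys = (\<chi> c. case c of CX \<Rightarrow> x | CZ a \<Rightarrow> fst y $ a | CZt a \<Rightarrow> snd y $ a
    | CXs \<Rightarrow> xs | CZs a \<Rightarrow> fst ys $ a | CZts a \<Rightarrow> snd ys $ a)"

lemma coords_mk_point [simp]:
  "x_coord (mk_point x y xs ys) = x" "y_coord (mk_point x y xs ys) = y"
  "xs_coord (mk_point x y xs ys) = xs" "ys_coord (mk_point x y xs ys) = ys"
  by (simp_all add: x_coord_def y_coord_def xs_coord_def ys_coord_def mk_point_def z_part_def
      prod_eq_iff vec_eq_iff)

lemma point_eqI:
  assumes "x_coord P = x_coord Q" "y_coord P = y_coord Q"
    "xs_coord P = xs_coord Q" "ys_coord P = ys_coord Q"
  shows "P = Q"
proof -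
  have "P $ c = Q $ c" for c
    using assms by (cases c) (auto simp: x_coord_def y_coord_def xs_coord_def ys_coord_def
        z_part_def prod_eq_iff vec_eq_iff)
  then show ?thesis by (simp add: vec_eq_iff)
qed

lemma coords_add [simp]:
  "x_coord (P + Q) = x_coord P + x_coord Q" "y_coord (P + Q) = y_coord P + y_coord Q"
  "xs_coord (P + Q) = xs_coord P + xs_coord Q" "ys_coord (P + Q) = ys_coord P + ys_coord Q"
  by (simp_all add: x_coord_def y_coord_def xs_coord_def ys_coord_def z_part_def
      prod_eq_iff vec_eq_iff)

lemma coords_diff [simp]:
  "x_coord (P - Q) = x_coord P - x_coord Q" "y_coord (P - Q) = y_coord P - y_coord Q"
  "xs_coord (P - Q) = xs_coord P - xs_coord Q" "ys_coord (P - Q) = ys_coord P - ys_coord Q"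
  by (simp_all add: x_coord_def y_coord_def xs_coord_def ys_coord_def z_part_def
      prod_eq_iff vec_eq_iff)

lemma coords_scaleR [simp]:
  "x_coord (r *\<^sub>R P) = r * x_coord P" "y_coord (r *\<^sub>R P) = r *\<^sub>R y_coord P"
  "xs_coord (r *\<^sub>R P) = r * xs_coord P" "ys_coord (r *\<^sub>R P) = r *\<^sub>R ys_coord P"
  by (simp_all add: x_coord_def y_coord_def xs_coord_def ys_coord_def z_part_def
      prod_eq_iff vec_eq_iff)

lemma coords_uminus [simp]:
  "x_coord (- P) = - x_coord P" "y_coord (- P) = - y_coord P"
  "xs_coord (- P) = - xs_coord P" "ys_coord (- P) = - ys_coord P"
  by (simp_all add: x_coord_def y_coord_def xs_coord_def ys_coord_def z_part_def
      prod_eq_iff vec_eq_iff)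

lemma coords_zero [simp]:
  "x_coord 0 = 0" "y_coord 0 = 0" "xs_coord 0 = 0" "ys_coord 0 = 0"
  by (simp_all add: x_coord_def y_coord_def xs_coord_def ys_coord_def z_part_def
      prod_eq_iff vec_eq_iff)

lemma linear_coords:
  "linear x_coord" "linear y_coord" "linear xs_coord" "linear ys_coord"
  by (simp_all add: linear_iff)

lemma bounded_linear_coords:
  "bounded_linear x_coord" "bounded_linear y_coord" "bounded_linear xs_coord" "bounded_linear ys_coord"
  by (simp_all add: linear_coords flip: linear_conv_bounded_linear)

lemma linear_mk_point:
  "linear (\<lambda>x. mk_point x 0 0 0)" "linear (\<lambda>y. mk_point 0 y 0 0)"
  "linear (\<lambda>xs. mk_point 0 0 xs 0)" "linear (\<lambda>ys. mk_point 0 0 0 ys)"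
  by (auto simp: linear_iff intro: point_eqI)

lemma mk_point_split:
  "mk_point x y xs ys = mk_point x 0 0 0 + mk_point 0 y 0 0 + mk_point 0 0 xs 0 + mk_point 0 0 0 ys"
  by (rule point_eqI) simp_all

lemma has_derivative_mk_point [derivative_intros]:
  assumes "(f1 has_derivative d1) F" "(f2 has_derivative d2) F"
    "(f3 has_derivative d3) F" "(f4 has_derivative d4) F"
  shows "((\<lambda>P. mk_point (f1 P) (f2 P) (f3 P) (f4 P)) has_derivative
    (\<lambda>u. mk_point (d1 u) (d2 u) (d3 u) (d4 u))) F"
  using linear_mk_point[THEN linear_conv_bounded_linear[THEN iffD1]]
  by (subst (1 2) mk_point_split)
    (intro has_derivative_add bounded_linear.has_derivative[OF _ assms(1)]
      bounded_linear.has_derivative[OF _ assms(2)] bounded_linear.has_derivative[OF _ assms(3)]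
      bounded_linear.has_derivative[OF _ assms(4)])

lemma smooth_map_mk_point:
  assumes "smooth_map f1" "smooth_map f2" "smooth_map f3" "smooth_map f4"
  shows "smooth_map (\<lambda>P. mk_point (f1 P) (f2 P) (f3 P) (f4 P))"
  by (subst mk_point_split)
    (intro smooth_map_add smooth_map_linear_comp[OF linear_mk_point(1) assms(1)]
      smooth_map_linear_comp[OF linear_mk_point(2) assms(2)]
      smooth_map_linear_comp[OF linear_mk_point(3) assms(3)]
      smooth_map_linear_comp[OF linear_mk_point(4) assms(4)])

section \<open>Metrics with an arbitrary potential, in block coordinates\<close>

definition wave_metric :: "((real ^ 'p) \<times> (real ^ 'p) \<Rightarrow> real) \<Rightarrow> ('p::finite coord) metric"
  where "wave_metric F P u v =
    - 2 * F (y_coord P) * x_coord u * x_coord v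
    + (x_coord u * xs_coord v + xs_coord u * x_coord v)
    + (y_coord u \<bullet> ys_coord v + ys_coord u \<bullet> y_coord v)"

definition potential :: "(real ^ 'p \<Rightarrow> real) \<Rightarrow> (real ^ 'p) \<times> (real ^ 'p) \<Rightarrow> real"
  where "potential f y = f (fst y) + fst y \<bullet> snd y"

lemma M_metric_eq_wave_metric: "M_metric f = wave_metric (potential f)"
  by (intro ext) (simp add: M_metric_def wave_metric_def potential_def x_coord_def y_coord_def
      xs_coord_def ys_coord_def z_part_def inner_prod_def inner_vec_def sum.distrib)

lemma wave_metric_linear:
  "wave_metric F P (u + u') v = wave_metric F P u v + wave_metric F P u' v"
  "wave_metric F P (u - u') v = wave_metric F P u v - wave_metric F P u' v"
  "wave_metric F P u (v + v') = wave_metric F P u v + wave_metric F P u v'"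
  "wave_metric F P u (v - v') = wave_metric F P u v - wave_metric F P u v'"
  by (simp_all add: wave_metric_def algebra_simps)

lemma wave_metric_commute: "wave_metric F P u v = wave_metric F P v u"
  by (simp add: wave_metric_def algebra_simps inner_commute)

lemma wave_metric_zero [simp]: "wave_metric F P 0 v = 0" "wave_metric F P v 0 = 0"
  by (simp_all add: wave_metric_def)

lemma wave_metric_nondegenerate:
  assumes "\<And>v. wave_metric F P u v = 0"
  shows "u = 0"
proof -
  have "x_coord u = 0" "y_coord u = 0"
    using assms[of "mk_point 0 0 1 0"] assms[of "mk_point 0 0 0 (y_coord u)"]
    by (simp_all add: wave_metric_def)
  moreover from this have "xs_coord u = 0" "ys_coord u = 0"
    using assms[of "mk_point 1 0 0 0"] assms[of "mk_point 0 (ys_coord u) 0 0"]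
    by (simp_all add: wave_metric_def)
  ultimately show ?thesis by (intro point_eqI) simp_all
qed

section \<open>Connection and curvature\<close>

definition grad :: "('a::euclidean_space \<Rightarrow> real) \<Rightarrow> 'a \<Rightarrow> 'a"
  where "grad F y = (\<Sum>b\<in>Basis. dir_deriv F y b *\<^sub>R b)"

lemma grad_inner:
  assumes "F differentiable at y"
  shows "grad F y \<bullet> w = dir_deriv F y w"
proof -
  have "dir_deriv F y w = dir_deriv F y (\<Sum>b\<in>Basis. (w \<bullet> b) *\<^sub>R b)"
    by (simp add: euclidean_representation)
  also have "\<dots> = (\<Sum>b\<in>Basis. (w \<bullet> b) * dir_deriv F y b)"
    using linear_dir_deriv[OF assms] by (simp add: linear_sum linear_cmul)
  finally show ?thesis
    by (simp add: grad_def inner_sum_left inner_commute[of w] mult.commute)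
qed

lemma smooth_map_grad: "smooth_map F \<Longrightarrow> smooth_map (grad F)"
  unfolding grad_def[abs_def] by (intro smooth_map_sum smooth_map_scaleR smooth_map_const smooth_map_dir_deriv)

lemma dir_deriv_grad_inner:
  assumes "smooth_map F"
  shows "dir_deriv (grad F) y u \<bullet> w = dir_deriv (\<lambda>q. dir_deriv F q w) y u"
proof -
  have "dir_deriv (\<lambda>q. grad F q \<bullet> w) y u = dir_deriv (grad F) y u \<bullet> w"
    by (intro dir_deriv_bounded_linear_comp bounded_linear_inner_left smooth_map_differentiable
        smooth_map_grad assms)
  then show ?thesis by (simp add: grad_inner smooth_map_differentiable assms)
qed

lemma dir_deriv_grad_commute:
  "smooth_map F \<Longrightarrow> dir_deriv (grad F) y u \<bullet> w = dir_deriv (grad F) y w \<bullet> u"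
  by (simp add: dir_deriv_grad_inner dir_deriv_commute)

text \<open>Read off from Koszul's formula for constant fields: only the coefficient -2 F of dx dx
  varies, so g(\<Gamma>(u, v), w) is -(v_x dF(u_y) + u_x dF(v_y)) w_x + u_x v_x dF(w_y).\<close>

definition christoffel :: "((real ^ 'p) \<times> (real ^ 'p) \<Rightarrow> real) \<Rightarrow> ('p::finite coord) connection"
  where "christoffel F P u v =
    mk_point 0 0 (- (grad F (y_coord P) \<bullet> (x_coord u *\<^sub>R y_coord v + x_coord v *\<^sub>R y_coord u)))
      ((x_coord u * x_coord v) *\<^sub>R grad F (y_coord P))"

lemma coords_christoffel [simp]:
  "x_coord (christoffel F P u v) = 0" "y_coord (christoffel F P u v) = 0"
  "xs_coord (christoffel F P u v)
    = - (grad F (y_coord P) \<bullet> (x_coord u *\<^sub>R y_coord v + x_coord v *\<^sub>R y_coord u))"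
  "ys_coord (christoffel F P u v) = (x_coord u * x_coord v) *\<^sub>R grad F (y_coord P)"
  by (simp_all add: christoffel_def)

lemma christoffel_zero:
  assumes "x_coord v = 0" "y_coord v = 0"
  shows "christoffel F P u v = 0" "christoffel F P v u = 0"
  using assms by (auto intro!: point_eqI)

lemma dir_deriv_wave_metric:
  assumes "F differentiable at (y_coord P)"
  shows "dir_deriv (\<lambda>Q. wave_metric F Q v w) P u
    = - 2 * (grad F (y_coord P) \<bullet> y_coord u) * x_coord v * x_coord w"
proof -
  have "((\<lambda>Q. F (y_coord Q)) has_derivative (\<lambda>u. grad F (y_coord P) \<bullet> y_coord u)) (at P)"
    using has_derivative_comp_affine[OF bounded_linear_coords(2), of F P 0] assms
    by (simp add: grad_inner)
  then show ?thesis
    unfolding wave_metric_def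
    by (intro dir_deriv_eqI) (auto intro!: derivative_eq_intros)
qed

text \<open>Alternating the two transpositions three times each returns to \<open>D u v w\<close>
  with the opposite sign. This is the algebra behind the uniqueness of the Levi-Civita connection;
  it serves again for the second derivative of an isometry.\<close>

lemma koszul_zero:
  fixes D :: "'a \<Rightarrow> 'a \<Rightarrow> 'a \<Rightarrow> real"
  assumes "\<And>u v w. D u v w = D v u w" "\<And>u v w. D u v w + D u w v = 0"
  shows "D u v w = 0"
  using assms by (smt (verit))

text \<open>\<open>levi_civita\<close> is a definite description, so uniqueness is part of the
  claim: the difference of two candidates, paired with a third vector, satisfies
  \<open>koszul_zero\<close>, and nondegeneracy removes the pairing.\<close>

lemma levi_civita_wave_metric:
  assumes F: "smooth_map F"
  shows "levi_civita (wave_metric F) = christoffel F"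
  unfolding levi_civita_def
proof (rule the_equality)
  have dF: "F differentiable at y" for y by (rule smooth_map_differentiable[OF F])
  have "bilinear (christoffel F P)" for P
    unfolding bilinear_def linear_iff
    by (auto intro!: point_eqI simp: algebra_simps inner_add_right)
  moreover have "christoffel F P u v = christoffel F P v u" for P u v
    by (rule point_eqI) (simp_all add: mult.commute add.commute)
  moreover have "dir_deriv (\<lambda>Q. wave_metric F Q v w) P u
      = wave_metric F P (christoffel F P u v) w + wave_metric F P v (christoffel F P u w)" for P u v w
    unfolding dir_deriv_wave_metric[OF dF]
    by (simp add: wave_metric_def inner_add_right algebra_simps inner_commute)
  ultimately show lc: "is_levi_civita (wave_metric F) (christoffel F)"
    unfolding is_levi_civita_def by blast
  fix \<Gamma> assume \<Gamma>: "is_levi_civita (wave_metric F) \<Gamma>"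
  have "\<Gamma> P u v = christoffel F P u v" for P u v
  proof -
    let ?D = "\<lambda>u v w. wave_metric F P (\<Gamma> P u v - christoffel F P u v) w"
    have "?D u v w = 0" for u v w
    proof (rule koszul_zero[of ?D])
      fix u v w
      show "?D u v w = ?D v u w"
        using lc \<Gamma> unfolding is_levi_civita_def by metis
      have "wave_metric F P (\<Gamma> P u v) w + wave_metric F P v (\<Gamma> P u w)
          = wave_metric F P (christoffel F P u v) w + wave_metric F P v (christoffel F P u w)"
        using lc \<Gamma> unfolding is_levi_civita_def by metis
      then show "?D u v w + ?D u w v = 0"
        by (simp add: wave_metric_linear wave_metric_commute[of F P v] )
    qed
    then have "\<Gamma> P u v - christoffel F P u v = 0"
      by (rule wave_metric_nondegenerate)
    then show ?thesis by simp
  qed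
  then show "\<Gamma> = christoffel F" by (intro ext)
qed

lemma nabla_const:
  assumes "smooth_map F"
  shows "nabla (wave_metric F) (\<lambda>_. u) (\<lambda>_. v) = (\<lambda>P. christoffel F P u v)"
  by (simp add: nabla_def levi_civita_wave_metric[OF assms])

lemma nabla_nabla_const:
  assumes F: "smooth_map F"
  shows "nabla (wave_metric F) (\<lambda>_. u) (nabla (wave_metric F) (\<lambda>_. v) (\<lambda>_. w)) P =
    mk_point 0 0 (- (dir_deriv (grad F) (y_coord P) (y_coord u)
        \<bullet> (x_coord v *\<^sub>R y_coord w + x_coord w *\<^sub>R y_coord v)))
      ((x_coord v * x_coord w) *\<^sub>R dir_deriv (grad F) (y_coord P) (y_coord u))"
proof -
  have d: "((\<lambda>Q. grad F (y_coord Q)) has_derivative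
      (\<lambda>u. dir_deriv (grad F) (y_coord P) (y_coord u))) (at P)"
    using has_derivative_comp_affine[OF bounded_linear_coords(2), of "grad F" P 0]
    by (simp add: smooth_map_differentiable smooth_map_grad F)
  have "dir_deriv (\<lambda>P. christoffel F P v w) P u =
    mk_point 0 0 (- (dir_deriv (grad F) (y_coord P) (y_coord u)
        \<bullet> (x_coord v *\<^sub>R y_coord w + x_coord w *\<^sub>R y_coord v)))
      ((x_coord v * x_coord w) *\<^sub>R dir_deriv (grad F) (y_coord P) (y_coord u))"
    unfolding christoffel_def
    by (rule dir_deriv_eqI[where F' = "\<lambda>u. mk_point 0 0 (- (dir_deriv (grad F) (y_coord P) (y_coord u)
        \<bullet> (x_coord v *\<^sub>R y_coord w + x_coord w *\<^sub>R y_coord v)))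
      ((x_coord v * x_coord w) *\<^sub>R dir_deriv (grad F) (y_coord P) (y_coord u))"])
     (intro has_derivative_mk_point has_derivative_const has_derivative_minus
       has_derivative_inner_left has_derivative_scaleR_right d)
  then show ?thesis
    by (simp add: nabla_const F) (simp add: nabla_def levi_civita_wave_metric F christoffel_zero)
qed

text \<open>The x-y part of the bivector of \<open>u\<close> and \<open>v\<close>, the only part
  that enters the curvature.\<close>

definition wedge :: "real ^ ('p::finite coord) \<Rightarrow> real ^ ('p coord) \<Rightarrow> (real ^ 'p) \<times> (real ^ 'p)"
  where "wedge u v = x_coord u *\<^sub>R y_coord v - x_coord v *\<^sub>R y_coord u"

text \<open>Products of Christoffel maps vanish, so the curvature is linear in the Hessian of
  \<open>F\<close>. Each double covariant derivative has a term pairing the first two y-parts in the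
  Hessian, with the third x-part as factor; antisymmetrization cancels it, and what remains factors
  through two wedges.\<close>

lemma curvature_tensor_wave_metric:
  assumes F: "smooth_map F"
  shows "curvature_tensor (wave_metric F) P \<xi>s =
    - iter_deriv [wedge (\<xi>s ! 0) (\<xi>s ! 1), wedge (\<xi>s ! 2) (\<xi>s ! 3)] F (y_coord P)"
proof -
  let ?H = "dir_deriv (grad F) (y_coord P)"
  note lin = linear_dir_deriv[OF smooth_map_differentiable[OF smooth_map_grad[OF F]]]
  have "lie_bracket (\<lambda>_. u) (\<lambda>_. v) = (\<lambda>_. 0)" for u v :: "real ^ 'a coord"
    by (simp add: lie_bracket_def)
  moreover have "nabla (wave_metric F) (\<lambda>_. 0) (\<lambda>_. w) P = 0" for w
    by (simp add: nabla_const[OF F] christoffel_zero)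
  ultimately have "curvature_tensor (wave_metric F) P \<xi>s
    = - (?H (wedge (\<xi>s ! 0) (\<xi>s ! 1)) \<bullet> wedge (\<xi>s ! 2) (\<xi>s ! 3))"
    unfolding curvature_tensor_def curvature_op_def nabla_nabla_const[OF F]
    by (simp add: wave_metric_def wedge_def inner_add_right inner_diff_right inner_diff_left
        linear_diff[OF lin] linear_cmul[OF lin])
      (use dir_deriv_grad_commute[OF F, of "y_coord P" "y_coord (\<xi>s ! Suc 0)" "y_coord (\<xi>s ! 0)"] in
        \<open>simp add: algebra_simps\<close>)
  also have "\<dots> = - iter_deriv [wedge (\<xi>s ! 0) (\<xi>s ! 1), wedge (\<xi>s ! 2) (\<xi>s ! 3)] F (y_coord P)"
    by (simp add: dir_deriv_grad_inner[OF F])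
  finally show ?thesis .
qed

text \<open>
  No Christoffel terms survive: the Christoffel map takes values in the directions with
  vanishing \<open>x\<close>- and \<open>y\<close>-coordinates, which the curvature tensor and its covariant
  derivatives annihilate.
\<close>

lemma nabla_curvature_wave_metric:
  assumes F: "smooth_map F" and "length \<xi>s = 4 + i"
  shows "nabla_curvature (wave_metric F) i P \<xi>s =
    - iter_deriv (map y_coord (take i \<xi>s) @
        [wedge (\<xi>s ! i) (\<xi>s ! (i + 1)), wedge (\<xi>s ! (i + 2)) (\<xi>s ! (i + 3))]) F (y_coord P)"
  using assms(2)
proof (induction i arbitrary: P \<xi>s)
  case 0
  show ?case
    by (simp add: nabla_curvature_def curvature_tensor_wave_metric[OF F] numeral_2_eq_2)
next
  case (Suc i)
  then obtain \<eta> \<zeta>s where \<xi>s: "\<xi>s = \<eta> # \<zeta>s" and len: "length \<zeta>s = 4 + i"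
    by (cases \<xi>s) auto
  let ?T = "nabla_curvature (wave_metric F) i"
  let ?vs = "\<lambda>\<zeta>s. map y_coord (take i \<zeta>s) @
        [wedge (\<zeta>s ! i) (\<zeta>s ! (i + 1)), wedge (\<zeta>s ! (i + 2)) (\<zeta>s ! (i + 3))]"
  \<comment> \<open>A slot below \<open>i\<close> is a direction of differentiation, one of the last
    four enters a wedge. A vector without x- and y-part turns either into the direction 0.\<close>
  have z: "?T P (\<zeta>s[n := v]) = 0" if n: "n < length \<zeta>s" and v: "x_coord v = 0" "y_coord v = 0" for n v
  proof -
    have "0 \<in> set (?vs (\<zeta>s[n := v]))"
    proof (cases "n < i")
      case True
      then have "v \<in> set (take i (\<zeta>s[n := v]))"
        using n len by (metis length_list_update length_take min_less_iff_conj nth_list_update_eq nth_mem nth_take)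
      then have "y_coord v \<in> y_coord ` set (take i (\<zeta>s[n := v]))" by blast
      with v show ?thesis by simp
    next
      case False
      with n len consider "n = i" | "n = i + 1" | "n = i + 2" | "n = i + 3" by linarith
      then show ?thesis using n len v by cases (simp_all add: wedge_def)
    qed
    from iter_deriv_zero_direction[OF F this] show ?thesis
      using Suc.IH[of "\<zeta>s[n := v]" P] len by (simp only: length_list_update minus_zero)
  qed
  have "nabla_curvature (wave_metric F) (Suc i) P \<xi>s = dir_deriv (\<lambda>Q. ?T Q \<zeta>s) P \<eta>"
  proof -
    have "(\<Sum>n<length \<zeta>s. ?T P (\<zeta>s[n := nabla (wave_metric F) (\<lambda>_. \<eta>) (\<lambda>_. \<zeta>s ! n) P])) = 0"
      by (intro sum.neutral ballI z) (simp_all add: nabla_const[OF F])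
    then show ?thesis
      unfolding nabla_curvature_def by (simp add: nabla_tensor_def \<xi>s)
  qed
  also have "\<dots> = dir_deriv (\<lambda>Q. - iter_deriv (?vs \<zeta>s) F (y_coord Q)) P \<eta>"
    by (simp only: Suc.IH[OF len])
  also have "\<dots> = - dir_deriv (\<lambda>Q. iter_deriv (?vs \<zeta>s) F (y_coord Q)) P \<eta>"
    using smooth_map_comp_linear[OF linear_coords(2) smooth_map_iter_deriv[OF F]]
    by (intro dir_deriv_bounded_linear_comp[OF bounded_linear_minus[OF bounded_linear_ident]]
        smooth_map_differentiable)
  also have "\<dots> = - dir_deriv (iter_deriv (?vs \<zeta>s) F) (y_coord P) (y_coord \<eta>)"
    by (subst dir_deriv_comp_linear)
      (auto intro: bounded_linear_coords smooth_map_differentiable smooth_map_iter_deriv F)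
  finally show ?case by (simp add: \<xi>s add.commute[of 3])
qed

section \<open>Isometries and model isomorphisms\<close>

text \<open>\<open>adjoint L'\<close> is the inverse transpose of \<open>L\<close>: the action on
  the starred coordinates that preserves their pairing with \<open>y\<close>.\<close>

lemma adjoint_inverse:
  fixes L :: "'a::euclidean_space \<Rightarrow> 'a"
  assumes "linear L" "linear L'" "\<And>v. L' (L v) = v"
  shows "L v \<bullet> adjoint L' w = v \<bullet> w" "adjoint L (adjoint L' w) = w"
proof -
  show 1: "L v \<bullet> adjoint L' w = v \<bullet> w" for v
    using assms by (simp add: adjoint_works)
  then have "v \<bullet> adjoint L (adjoint L' w) = v \<bullet> w" for v
    using assms by (simp add: adjoint_works)
  then show "adjoint L (adjoint L' w) = w" by (metis vector_eq_ldot)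
qed

text \<open>
  The affine function \<open>l \<bullet> \<eta> + c\<close> is absorbed by the starred coordinates: it is the
  \<open>x\<close>-derivative of \<open>x (l \<bullet> y + c)\<close>, whose \<open>y\<close>-derivative \<open>x l\<close> is in turn that of
  \<open>x\<^sup>2 l / 2\<close>. Centering \<open>x\<close> at \<open>P\<close> makes the differential at \<open>P\<close> explicit.
\<close>

lemma wave_metric_isometry:
  fixes P Q :: "real ^ ('p::finite coord)"
  assumes L: "linear L" and L': "linear L'"
    and inv: "\<And>v. L' (L v) = v" "\<And>v. L (L' v) = v" and a: "a \<noteq> 0"
    and F: "\<And>\<eta>. a\<^sup>2 * F (L \<eta> + b) = F \<eta> + l \<bullet> \<eta> + c"
    and PQ: "L (y_coord P) + b = y_coord Q"
  obtains \<phi> where "isometry_of (wave_metric F) \<phi>" "\<phi> P = Q"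
    "\<And>u. dir_deriv \<phi> P u = mk_point (a * x_coord u) (L (y_coord u))
       (inverse a * (xs_coord u + x_coord u * (l \<bullet> y_coord P + c))) (adjoint L' (ys_coord u))"
proof -
  define M where "M = adjoint L'"
  have M: "linear M" and N: "linear (adjoint L)"
    by (simp_all add: M_def L L' adjoint_linear)
  have LM: "L v \<bullet> M w = v \<bullet> w" "M w \<bullet> L v = w \<bullet> v" for v w
    using adjoint_inverse[OF L L' inv(1)] by (simp_all add: M_def inner_commute)
  have NM: "adjoint L (M w) = w" for w
    using adjoint_inverse[OF L L' inv(1)] by (simp add: M_def)
  have MN: "M (adjoint L w) = w" for w
    using adjoint_inverse(2)[OF L' L inv(2)] by (simp add: M_def)
  define \<phi> where "\<phi> R = mk_point (a * (x_coord R - x_coord P) + x_coord Q) (L (y_coord R) + b)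
    (inverse a * (xs_coord R - xs_coord P + (x_coord R - x_coord P) * (l \<bullet> y_coord R + c)) + xs_coord Q)
    (M (ys_coord R - ys_coord P - (1/2 * ((x_coord R - x_coord P) * (x_coord R - x_coord P))) *\<^sub>R l) + ys_coord Q)"
    for R
  define \<psi> where "\<psi> S = mk_point (inverse a * (x_coord S - x_coord Q) + x_coord P) (L' (y_coord S - b))
    (a * (xs_coord S - xs_coord Q)
      - inverse a * (x_coord S - x_coord Q) * (l \<bullet> L' (y_coord S - b) + c) + xs_coord P)
    (adjoint L (ys_coord S - ys_coord Q)
      + (1/2 * ((inverse a * (x_coord S - x_coord Q)) * (inverse a * (x_coord S - x_coord Q)))) *\<^sub>R l
      + ys_coord P)"
    for S :: "real ^ 'p coord"
  have aa: "a * (inverse a * t) = t" "inverse a * (a * t) = t" "a * (r * (inverse a * t)) = r * t" for t r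
    using a by simp_all
  have \<psi>\<phi>: "\<psi> (\<phi> R) = R" for R
    by (rule point_eqI) (simp_all add: \<psi>_def \<phi>_def aa inv NM algebra_simps)
  have \<phi>\<psi>: "\<phi> (\<psi> S) = S" for S
    by (rule point_eqI) (simp_all add: \<psi>_def \<phi>_def aa inv MN algebra_simps)
  have bij: "bij \<phi>" by (metis bijI' \<psi>\<phi> \<phi>\<psi>)
  have inv_\<phi>: "inv \<phi> = \<psi>" by (rule inv_equality) (simp_all add: \<psi>\<phi> \<phi>\<psi>)
  note smooth_intros = smooth_map_mk_point smooth_map_diff smooth_map_add smooth_map_mult
    smooth_map_scaleR smooth_map_inner smooth_map_linear[OF linear_coords(1)]
    smooth_map_linear[OF linear_coords(2)] smooth_map_linear[OF linear_coords(3)]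
    smooth_map_linear[OF linear_coords(4)] smooth_map_const
  have smooth: "smooth_map \<phi>"
    unfolding \<phi>_def[abs_def]
    by (intro smooth_intros smooth_map_linear_comp[OF L] smooth_map_linear_comp[OF M])
  have smooth': "smooth_map \<psi>"
    unfolding \<psi>_def[abs_def]
    by (intro smooth_intros smooth_map_linear_comp[OF L'] smooth_map_linear_comp[OF N])
  note bl = bounded_linear_coords[THEN bounded_linear_imp_has_derivative]
  have bL: "bounded_linear L" "bounded_linear M"
    using L M by (simp_all add: linear_conv_bounded_linear)
  have d: "dir_deriv \<phi> R u = mk_point (a * x_coord u) (L (y_coord u))
     (inverse a * (xs_coord u + x_coord u * (l \<bullet> y_coord R + c) + (x_coord R - x_coord P) * (l \<bullet> y_coord u)))
     (M (ys_coord u - ((x_coord R - x_coord P) * x_coord u) *\<^sub>R l))" for R u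
    unfolding \<phi>_def
    by (rule dir_deriv_eqI[where F' = "\<lambda>u. mk_point (a * x_coord u) (L (y_coord u))
     (inverse a * (xs_coord u + x_coord u * (l \<bullet> y_coord R + c) + (x_coord R - x_coord P) * (l \<bullet> y_coord u)))
     (M (ys_coord u - ((x_coord R - x_coord P) * x_coord u) *\<^sub>R l))"])
     (rule has_derivative_mk_point;
       (rule derivative_eq_intros bl bounded_linear.has_derivative[OF bL(1)]
          bounded_linear.has_derivative[OF bL(2)] refl)+,
       simp add: fun_eq_iff algebra_simps)
  \<comment> \<open>The terms containing \<open>x_coord R - x_coord P\<close> cancel between the two
    starred components. What is left over, 2 (l \<bullet> y + c) dx dx, is exactly the change of the
    potential.\<close>
  have "wave_metric F (\<phi> R) (dir_deriv \<phi> R u) (dir_deriv \<phi> R v) = wave_metric F R u v" for R u v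
  proof -
    have "wave_metric F (\<phi> R) (dir_deriv \<phi> R u) (dir_deriv \<phi> R v)
      = - 2 * (a\<^sup>2 * F (L (y_coord R) + b)) * x_coord u * x_coord v
        + (x_coord u * xs_coord v + xs_coord u * x_coord v)
        + (y_coord u \<bullet> ys_coord v + ys_coord u \<bullet> y_coord v)
        + 2 * (l \<bullet> y_coord R + c) * x_coord u * x_coord v"
      unfolding d using a
      by (simp add: wave_metric_def \<phi>_def LM inner_diff_left inner_diff_right)
        (simp add: field_simps power2_eq_square inner_commute)
    then show ?thesis unfolding F by (simp add: wave_metric_def[of F R] algebra_simps)
  qed
  with bij smooth smooth' inv_\<phi> have "isometry_of (wave_metric F) \<phi>"
    by (simp add: isometry_of_def)
  moreover have "\<phi> P = Q"
    using PQ by (intro point_eqI) (simp_all add: \<phi>_def linear_0[OF M])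
  ultimately show thesis using that by (simp add: d M_def)
qed

text \<open>The orbit relation of the affine maps that preserve \<open>F\<close> up to a positive
  factor and an affine function. Positivity of \<open>s\<close> allows the scaling a = 1 / sqrt s of
  \<open>x\<close>.\<close>

definition affinely_related :: "('a::euclidean_space \<Rightarrow> real) \<Rightarrow> 'a \<Rightarrow> 'a \<Rightarrow> bool"
  where "affinely_related F y y' \<longleftrightarrow> (\<exists>L L' b s l c. linear L \<and> linear L' \<and>
    (\<forall>v. L' (L v) = v) \<and> (\<forall>v. L (L' v) = v) \<and> 0 < s \<and> L y + b = y' \<and>
    (\<forall>\<eta>. F (L \<eta> + b) = s * F \<eta> + l \<bullet> \<eta> + c))"

lemma affinely_related_sym:
  assumes "affinely_related F y y'"
  shows "affinely_related F y' y"
proof -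
  from assms obtain L L' b s l c where L: "linear L" "linear L'" "\<And>v. L' (L v) = v" "\<And>v. L (L' v) = v"
    and s: "0 < s" and b: "L y + b = y'" and F: "\<And>\<eta>. F (L \<eta> + b) = s * F \<eta> + l \<bullet> \<eta> + c"
    unfolding affinely_related_def by blast
  have "F (L' \<eta> + L' (- b)) = inverse s * F \<eta> + (- inverse s *\<^sub>R adjoint L' l) \<bullet> \<eta>
      + inverse s * (- (l \<bullet> L' (- b)) - c)" for \<eta>
  proof -
    have "L (L' \<eta> + L' (- b)) + b = \<eta>" by (simp add: linear_add[OF L(1)] L)
    with F[of "L' \<eta> + L' (- b)"] have "F \<eta> = s * F (L' \<eta> + L' (- b)) + l \<bullet> (L' \<eta> + L' (- b)) + c"
      by simp
    moreover have "adjoint L' l \<bullet> \<eta> = l \<bullet> L' \<eta>"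
      by (metis adjoint_works[OF L(2)] inner_commute)
    ultimately show ?thesis using s by (simp add: field_simps inner_add_right)
  qed
  moreover have "L' y' + L' (- b) = y"
    by (simp add: L linear_add[OF L(2), symmetric] flip: b)
  ultimately show ?thesis
    unfolding affinely_related_def using L s by (metis inverse_positive_iff_positive)
qed

lemma affinely_related_trans:
  assumes "affinely_related F y y'" "affinely_related F y' y''"
  shows "affinely_related F y y''"
proof -
  from assms(1) obtain L1 L1' b1 s1 l1 c1 where 1: "linear L1" "linear L1'" "\<And>v. L1' (L1 v) = v" "\<And>v. L1 (L1' v) = v"
    and s1: "0 < s1" and b1: "L1 y + b1 = y'" and F1: "\<And>\<eta>. F (L1 \<eta> + b1) = s1 * F \<eta> + l1 \<bullet> \<eta> + c1"
    unfolding affinely_related_def by blast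
  from assms(2) obtain L2 L2' b2 s2 l2 c2 where 2: "linear L2" "linear L2'" "\<And>v. L2' (L2 v) = v" "\<And>v. L2 (L2' v) = v"
    and s2: "0 < s2" and b2: "L2 y' + b2 = y''" and F2: "\<And>\<eta>. F (L2 \<eta> + b2) = s2 * F \<eta> + l2 \<bullet> \<eta> + c2"
    unfolding affinely_related_def by blast
  have "F (L2 (L1 \<eta>) + (L2 b1 + b2)) = s2 * s1 * F \<eta> + (s2 *\<^sub>R l1 + adjoint L1 l2) \<bullet> \<eta>
      + (s2 * c1 + l2 \<bullet> b1 + c2)" for \<eta>
  proof -
    have "F (L2 (L1 \<eta>) + (L2 b1 + b2)) = F (L2 (L1 \<eta> + b1) + b2)"
      by (simp add: linear_add[OF 2(1)] add.assoc)
    moreover have "\<dots> = s2 * (s1 * F \<eta> + l1 \<bullet> \<eta> + c1) + l2 \<bullet> (L1 \<eta> + b1) + c2"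
      by (simp only: F1 F2)
    moreover have "adjoint L1 l2 \<bullet> \<eta> = l2 \<bullet> L1 \<eta>"
      by (metis adjoint_works[OF 1(1)] inner_commute)
    ultimately show ?thesis by (simp add: inner_add_left inner_add_right algebra_simps)
  qed
  moreover have "L2 (L1 y) + (L2 b1 + b2) = y''"
    by (simp add: linear_add[OF 2(1)] add.assoc flip: b1 b2)
  moreover have "linear (\<lambda>v. L2 (L1 v))" "linear (\<lambda>v. L1' (L2' v))"
    using linear_compose[OF 1(1) 2(1)] linear_compose[OF 2(2) 1(2)] by (simp_all add: o_def)
  moreover have "L1' (L2' (L2 (L1 v))) = v" "L2 (L1 (L1' (L2' v))) = v" for v
    by (simp_all add: 1 2)
  moreover have "0 < s2 * s1" using s1 s2 by simp
  ultimately show ?thesis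
    unfolding affinely_related_def
    by (intro exI[of _ "\<lambda>v. L2 (L1 v)"] exI[of _ "\<lambda>v. L1' (L2' v)"] exI) blast
qed

text \<open>Affine symmetries can be inverted and composed, so reaching every \<open>y\<close> from
  0 is enough. The remaining coordinates can be translated freely in
  \<open>wave_metric_isometry\<close>, which only constrains the y-part of the target.\<close>

lemma homogeneous_wave_metric:
  assumes "\<And>y. affinely_related F 0 y"
  shows "homogeneous_space (wave_metric F)"
  unfolding homogeneous_space_def
proof (intro allI)
  fix P Q :: "real ^ 'a coord"
  have "affinely_related F (y_coord P) (y_coord Q)"
    using assms affinely_related_sym affinely_related_trans by blast
  then obtain L L' b s l c where L: "linear L" "linear L'" "\<And>v. L' (L v) = v" "\<And>v. L (L' v) = v"
    and s: "0 < s" and b: "L (y_coord P) + b = y_coord Q"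
    and F: "\<And>\<eta>. F (L \<eta> + b) = s * F \<eta> + l \<bullet> \<eta> + c"
    unfolding affinely_related_def by blast
  have a: "1 / sqrt s \<noteq> 0" using s by simp
  have "(1 / sqrt s)\<^sup>2 * F (L \<eta> + b) = F \<eta> + (inverse s *\<^sub>R l) \<bullet> \<eta> + inverse s * c" for \<eta>
    unfolding F using s by (simp add: power_divide field_simps)
  from wave_metric_isometry[OF L a this b]
  show "\<exists>\<phi>. isometry_of (wave_metric F) \<phi> \<and> \<phi> P = Q" by blast
qed

text \<open>Derivatives of order less than two are not curvature data, hence are not compared.\<close>

definition jet_equivalent ::
    "nat \<Rightarrow> ('a::euclidean_space \<Rightarrow> real) \<Rightarrow> 'a \<Rightarrow> ('a \<Rightarrow> real) \<Rightarrow> 'a \<Rightarrow> bool"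
  where "jet_equivalent k F y F' y' \<longleftrightarrow> (\<exists>L L' s. linear L \<and> linear L' \<and>
    (\<forall>v. L' (L v) = v) \<and> (\<forall>v. L (L' v) = v) \<and> 0 < s \<and>
    (\<forall>vs. 2 \<le> length vs \<and> length vs \<le> k + 2 \<longrightarrow>
      iter_deriv (map L vs) F' y' = s * iter_deriv vs F y))"

text \<open>The remainder has to vanish to order \<open>k + 3\<close> so that it does not affect
  derivatives of order up to \<open>k + 2\<close>; the affine function disappears from order 2
  on.\<close>

lemma jet_equivalentI:
  assumes L: "linear L" "linear L'" "\<And>v. L' (L v) = v" "\<And>v. L (L' v) = v" "0 < s"
    and F': "\<And>\<eta>. F' (L \<eta> + b) = s * F \<eta> + l \<bullet> \<eta> + c + r \<eta>"
    and smooth: "smooth_map F" "smooth_map F'" "smooth_map r"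
    and r: "vanishes_to (k + 3) r y"
  shows "jet_equivalent k F y F' (L y + b)"
proof -
  have "iter_deriv (map L vs) F' (L y + b) = s * iter_deriv vs F y"
    if vs: "2 \<le> length vs" "length vs \<le> k + 2" for vs
  proof -
    have lin: "linear (\<lambda>\<eta>. l \<bullet> \<eta>)"
      by (simp add: bounded_linear_inner_right linear_conv_bounded_linear)
    have s: "smooth_map (\<lambda>\<eta>. s * F \<eta>)" "smooth_map (\<lambda>\<eta>. l \<bullet> \<eta> + c)"
      "smooth_map (\<lambda>\<eta>. s * F \<eta> + (l \<bullet> \<eta> + c))"
      by (intro smooth_map_add smooth_map_cmult smooth_map_const smooth_map_linear lin smooth)+
    have "iter_deriv (map L vs) F' (L y + b) = iter_deriv vs (\<lambda>\<eta>. F' (L \<eta> + b)) y"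
      by (simp add: iter_deriv_comp_affine L(1) smooth)
    also have "(\<lambda>\<eta>. F' (L \<eta> + b)) = (\<lambda>\<eta>. s * F \<eta> + (l \<bullet> \<eta> + c) + r \<eta>)"
      by (simp add: F' add.assoc)
    also have "iter_deriv vs \<dots> y = s * iter_deriv vs F y"
      unfolding iter_deriv_add[OF s(3) smooth(3)] iter_deriv_add[OF s(1,2)]
        iter_deriv_affine[OF lin vs(1)] iter_deriv_cmult[OF smooth(1)]
      using iter_deriv_vanishes[OF r] vs by simp
    finally show ?thesis .
  qed
  with L show ?thesis unfolding jet_equivalent_def by blast
qed

lemma affinely_related_jet_equivalent:
  assumes "affinely_related F y y'" "smooth_map F"
  shows "jet_equivalent k F y F y'"
proof -
  from assms obtain L L' b s l c where L: "linear L" "linear L'" "\<And>v. L' (L v) = v" "\<And>v. L (L' v) = v"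
    and s: "0 < s" and b: "L y + b = y'" and F: "\<And>\<eta>. F (L \<eta> + b) = s * F \<eta> + l \<bullet> \<eta> + c"
    unfolding affinely_related_def by blast
  have "jet_equivalent k F y F (L y + b)"
    by (rule jet_equivalentI[OF L s _ assms(2) assms(2), where r = "\<lambda>_. 0"])
      (simp_all add: F smooth_map_const vanishes_to_zero)
  with b show ?thesis by simp
qed

lemma jet_equivalent_sym:
  assumes "jet_equivalent k F y F' y'"
  shows "jet_equivalent k F' y' F y"
proof -
  from assms obtain L L' s where L: "linear L" "linear L'" "\<And>v. L' (L v) = v" "\<And>v. L (L' v) = v"
    and s: "0 < s" and F: "\<And>vs. 2 \<le> length vs \<Longrightarrow> length vs \<le> k + 2 \<Longrightarrow>
      iter_deriv (map L vs) F' y' = s * iter_deriv vs F y"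
    unfolding jet_equivalent_def by blast
  have "iter_deriv (map L' vs) F y = inverse s * iter_deriv vs F' y'"
    if "2 \<le> length vs" "length vs \<le> k + 2" for vs
    using F[of "map L' vs"] that s by (simp add: o_def L)
  with L s show ?thesis
    unfolding jet_equivalent_def by (metis inverse_positive_iff_positive)
qed

lemma jet_equivalent_trans:
  assumes "jet_equivalent k F y F' y'" "jet_equivalent k F' y' F'' y''"
  shows "jet_equivalent k F y F'' y''"
proof -
  from assms(1) obtain L1 L1' s1 where 1: "linear L1" "linear L1'" "\<And>v. L1' (L1 v) = v" "\<And>v. L1 (L1' v) = v"
    and s1: "0 < s1" and F1: "\<And>vs. 2 \<le> length vs \<Longrightarrow> length vs \<le> k + 2 \<Longrightarrow>
      iter_deriv (map L1 vs) F' y' = s1 * iter_deriv vs F y"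
    unfolding jet_equivalent_def by blast
  from assms(2) obtain L2 L2' s2 where 2: "linear L2" "linear L2'" "\<And>v. L2' (L2 v) = v" "\<And>v. L2 (L2' v) = v"
    and s2: "0 < s2" and F2: "\<And>vs. 2 \<le> length vs \<Longrightarrow> length vs \<le> k + 2 \<Longrightarrow>
      iter_deriv (map L2 vs) F'' y'' = s2 * iter_deriv vs F' y'"
    unfolding jet_equivalent_def by blast
  have "iter_deriv (map (\<lambda>v. L2 (L1 v)) vs) F'' y'' = s2 * s1 * iter_deriv vs F y"
    if "2 \<le> length vs" "length vs \<le> k + 2" for vs
    using F1[of vs] F2[of "map L1 vs"] that by (simp add: o_def)
  moreover have "linear (\<lambda>v. L2 (L1 v))" "linear (\<lambda>v. L1' (L2' v))"
    using linear_compose[OF 1(1) 2(1)] linear_compose[OF 2(2) 1(2)] by (simp_all add: o_def)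
  moreover have "L1' (L2' (L2 (L1 v))) = v" "L2 (L1 (L1' (L2' v))) = v" for v
    by (simp_all add: 1 2)
  moreover have "0 < s2 * s1" using s1 s2 by simp
  ultimately show ?thesis
    unfolding jet_equivalent_def
    by (intro exI[of _ "\<lambda>v. L2 (L1 v)"] exI[of _ "\<lambda>v. L1' (L2' v)"] exI) blast
qed

text \<open>Rescaling \<open>x\<close> by \<open>a\<close> multiplies every wedge by
  \<open>a\<close>. The curvature contains two of them, and the resulting square compensates the
  factor \<open>s\<close> of the jets.\<close>

lemma iter_deriv_scale_last:
  assumes "smooth_map F"
  shows "iter_deriv (vs @ [a *\<^sub>R u, a *\<^sub>R v]) F = (\<lambda>y. a\<^sup>2 * iter_deriv (vs @ [u, v]) F y)"
proof -
  have 1: "iter_deriv [a *\<^sub>R w] G = (\<lambda>y. a * iter_deriv [w] G y)" if "smooth_map G" for G w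
    using linear_dir_deriv[OF smooth_map_differentiable[OF that]] by (simp add: linear_cmul)
  have s: "smooth_map (iter_deriv ws F)" for ws by (rule smooth_map_iter_deriv[OF assms])
  have "iter_deriv [a *\<^sub>R u, a *\<^sub>R v] F = iter_deriv [a *\<^sub>R u] (iter_deriv [a *\<^sub>R v] F)" by simp
  also have "\<dots> = (\<lambda>y. a * iter_deriv [u] (iter_deriv [a *\<^sub>R v] F) y)"
    by (rule 1[OF s])
  also have "\<dots> = (\<lambda>y. a\<^sup>2 * iter_deriv [u, v] F y)"
    unfolding 1[OF assms] iter_deriv_cmult[OF s] by (simp add: power2_eq_square mult.assoc)
  finally show ?thesis
    unfolding iter_deriv_append by (simp only: iter_deriv_cmult[OF s])
qed

lemma jet_equivalent_model_isomorphism: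
  fixes P Q :: "real ^ ('p::finite coord)"
  assumes "jet_equivalent k F (y_coord P) F' (y_coord Q)"
    and smooth: "smooth_map F" "smooth_map F'"
  shows "\<exists>\<phi>. model_isomorphism k (wave_metric F) P (wave_metric F') Q \<phi>"
proof -
  from assms obtain L L' s where L: "linear L" "linear L'" and inv: "\<And>v. L' (L v) = v" "\<And>v. L (L' v) = v"
    and s: "0 < s" and F: "\<And>vs. 2 \<le> length vs \<Longrightarrow> length vs \<le> k + 2 \<Longrightarrow>
      iter_deriv (map L vs) F' (y_coord Q) = s * iter_deriv vs F (y_coord P)"
    unfolding jet_equivalent_def by blast
  define a where "a = 1 / sqrt s"
  have a: "a \<noteq> 0" "a\<^sup>2 * s = 1" using s by (simp_all add: a_def power_divide)
  \<comment> \<open>The metric sees the value of the potential itself, which the jets leave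
    unconstrained; adding \<kappa> x to the starred x-coordinate corrects it without changing x- and
    y-parts.\<close>
  define \<kappa> where "\<kappa> = a\<^sup>2 * F' (y_coord Q) - F (y_coord P)"
  define \<phi> where "\<phi> u = mk_point (a * x_coord u) (L (y_coord u))
    (inverse a * (xs_coord u + \<kappa> * x_coord u)) (adjoint L' (ys_coord u))" for u :: "real ^ 'p coord"
  define \<psi> where "\<psi> u = mk_point (inverse a * x_coord u) (L' (y_coord u))
    (a * xs_coord u - \<kappa> * (inverse a * x_coord u)) (adjoint L (ys_coord u))" for u :: "real ^ 'p coord"
  note adj = adjoint_inverse[OF L inv(1)] adjoint_inverse(2)[OF L(2,1) inv(2)]
  note N = adjoint_linear[OF L(2)]
  have "linear \<phi>"
    by (rule linearI) (auto simp: \<phi>_def algebra_simps linear_add[OF L(1)] linear_cmul[OF L(1)]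
        linear_add[OF N] linear_cmul[OF N] intro!: point_eqI)
  moreover have "\<psi> (\<phi> u) = u" "\<phi> (\<psi> u) = u" for u
    using a(1) by (auto intro!: point_eqI simp: \<psi>_def \<phi>_def inv adj simp flip: mult.assoc)
  then have "bij \<phi>" by (metis bijI')
  moreover have "wave_metric F' Q (\<phi> u) (\<phi> v) = wave_metric F P u v" for u v
  proof -
    have "wave_metric F' Q (\<phi> u) (\<phi> v)
      = - 2 * (a\<^sup>2 * F' (y_coord Q)) * x_coord u * x_coord v
        + (x_coord u * xs_coord v + xs_coord u * x_coord v) + 2 * \<kappa> * x_coord u * x_coord v
        + (y_coord u \<bullet> ys_coord v + ys_coord u \<bullet> y_coord v)"
      using a(1) adj(1) adj(1)[of "y_coord v" "ys_coord u"]
      by (simp add: wave_metric_def \<phi>_def inner_commute power2_eq_square field_simps)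
    then show ?thesis by (simp add: \<kappa>_def wave_metric_def algebra_simps)
  qed
  moreover have "nabla_curvature (wave_metric F') i Q (map \<phi> \<xi>s) = nabla_curvature (wave_metric F) i P \<xi>s"
    if "i \<le> k" "length \<xi>s = 4 + i" for i \<xi>s
  proof -
    have w: "wedge (\<phi> u) (\<phi> v) = a *\<^sub>R L (wedge u v)" for u v
      by (simp add: wedge_def \<phi>_def linear_diff[OF L(1)] linear_cmul[OF L(1)] algebra_simps)
    let ?vs = "map y_coord (take i \<xi>s)"
    let ?ws = "[wedge (\<xi>s ! i) (\<xi>s ! (i + 1)), wedge (\<xi>s ! (i + 2)) (\<xi>s ! (i + 3))]"
    have "nabla_curvature (wave_metric F') i Q (map \<phi> \<xi>s)
        = - iter_deriv (map L ?vs @ [a *\<^sub>R L (?ws ! 0), a *\<^sub>R L (?ws ! 1)]) F' (y_coord Q)"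
      using that by (subst nabla_curvature_wave_metric[OF smooth(2)])
        (simp_all add: w take_map o_def, simp add: \<phi>_def)
    also have "\<dots> = - (a\<^sup>2 * iter_deriv (map L (?vs @ ?ws)) F' (y_coord Q))"
      by (simp add: iter_deriv_scale_last[OF smooth(2)])
    also have "\<dots> = - (a\<^sup>2 * (s * iter_deriv (?vs @ ?ws) F (y_coord P)))"
      by (subst F) (use that in simp_all)
    also have "\<dots> = - iter_deriv (?vs @ ?ws) F (y_coord P)"
      using a(2) by (simp flip: mult.assoc)
    also have "\<dots> = nabla_curvature (wave_metric F) i P \<xi>s"
      by (simp add: nabla_curvature_wave_metric[OF smooth(1) that(2)])
    finally show ?thesis .
  qed
  ultimately show ?thesis unfolding model_isomorphism_def by blast
qed

section \<open>Potentials\<close>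

text \<open>The linear map \<open>A\<close> is kept explicit because it is itself used in the lift:
  it corrects the coordinates with a tilde.\<close>

definition quadratic :: "('a::euclidean_space \<Rightarrow> real) \<Rightarrow> bool"
  where "quadratic q \<longleftrightarrow> (\<exists>A l c. linear A \<and> q = (\<lambda>z. z \<bullet> A z + l \<bullet> z + c))"

lemma linear_functional_inner:
  fixes g :: "'a::euclidean_space \<Rightarrow> real"
  assumes "linear g"
  obtains l where "\<And>x. g x = l \<bullet> x"
  using adjoint_works[OF assms, of _ 1] by (metis inner_commute inner_real_def mult.right_neutral)

lemma quadratic_add:
  assumes "quadratic p" "quadratic q"
  shows "quadratic (\<lambda>z. p z + q z)"
proof -
  from assms obtain A l c B m d where "linear A" "p = (\<lambda>z. z \<bullet> A z + l \<bullet> z + c)"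
    "linear B" "q = (\<lambda>z. z \<bullet> B z + m \<bullet> z + d)"
    unfolding quadratic_def by blast
  then show ?thesis
    unfolding quadratic_def
    by (intro exI[of _ "\<lambda>z. A z + B z"] exI[of _ "l + m"] exI[of _ "c + d"])
      (auto simp: linear_compose_add inner_add_right inner_add_left)
qed

lemma quadratic_mult_affine:
  fixes a b :: "'a::euclidean_space \<Rightarrow> real"
  assumes "linear a" "linear b"
  shows "quadratic (\<lambda>z. (a z + r) * (b z + s))"
proof -
  obtain l m where l: "\<And>x. a x = l \<bullet> x" and m: "\<And>x. b x = m \<bullet> x"
    using linear_functional_inner assms by metis
  have "linear (\<lambda>z. (m \<bullet> z) *\<^sub>R l)"
    by (simp add: linear_iff inner_add_right algebra_simps)
  then show ?thesis
    unfolding quadratic_def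
    by (intro exI[of _ "\<lambda>z. (m \<bullet> z) *\<^sub>R l"] exI[of _ "s *\<^sub>R l + r *\<^sub>R m"] exI[of _ "r * s"])
      (auto simp: l m inner_add_left algebra_simps inner_commute)
qed

lemma quadratic_const: "quadratic (\<lambda>_. c)"
  unfolding quadratic_def by (intro exI[of _ "\<lambda>_. 0"] exI[of _ 0] exI[of _ c]) (simp add: linear_zero)

lemma quadratic_sum: "(\<And>i. i \<in> I \<Longrightarrow> quadratic (q i)) \<Longrightarrow> quadratic (\<lambda>z. \<Sum>i\<in>I. q i z)"
  by (induction I rule: infinite_finite_induct) (auto intro: quadratic_add quadratic_const)

text \<open>
  The coordinates with a tilde transform by the inverse transpose of \<open>B\<close>, corrected by a linear
  term in \<open>z\<close> that cancels the quadratic error \<open>q\<close>.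
\<close>

lemma potential_lift:
  fixes f f' :: "real ^ 'p::finite \<Rightarrow> real" and B :: "real ^ 'p \<Rightarrow> real ^ 'p"
  assumes B: "linear B" "inj B" and s: "0 < s" and q: "quadratic q"
    and f': "\<And>z. f' (B z + c) = s * f z + q z + r z"
  obtains L L' l \<gamma> where "linear L" "linear L'" "\<And>v. L' (L v) = v" "\<And>v. L (L' v) = v"
    "\<And>\<eta>. potential f' (L \<eta> + (c, d)) = s * potential f \<eta> + l \<bullet> \<eta> + \<gamma> + r (fst \<eta>)"
proof -
  obtain B' where B': "linear B'" "\<And>z. B' (B z) = z" "\<And>z. B (B' z) = z"
    using linear_injective_isomorphism[OF B] by metis
  obtain A m \<delta> where A: "linear A" and q: "\<And>z. q z = z \<bullet> A z + m \<bullet> z + \<delta>"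
    using q unfolding quadratic_def by blast
  note adj = adjoint_inverse[OF B(1) B'(1,2)] adjoint_inverse(2)[OF B'(1) B(1) B'(3)]
  note N = adjoint_linear[OF B(1)] and N' = adjoint_linear[OF B'(1)]
  define K where "K \<eta> = adjoint B' (s *\<^sub>R snd \<eta> - A (fst \<eta>))" for \<eta>
  define L where "L \<eta> = (B (fst \<eta>), K \<eta>)" for \<eta>
  define L' where "L' \<eta> = (B' (fst \<eta>), inverse s *\<^sub>R (adjoint B (snd \<eta>) + A (B' (fst \<eta>))))" for \<eta>
  have K: "linear K"
    unfolding K_def linear_iff
    by (simp add: linear_add[OF A] linear_cmul[OF A] algebra_simps
        flip: linear_add[OF N'] linear_cmul[OF N'])
  have "linear L"
    using K B(1) by (simp add: linear_iff L_def)
  moreover have "linear L'"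
    using N A B'(1) by (simp add: linear_iff L'_def algebra_simps)
  moreover have "L' (L v) = v" "L (L' v) = v" for v
    using s by (simp_all add: L_def L'_def K_def B' adj)
  moreover have "\<exists>l. \<forall>\<eta>. potential f' (L \<eta> + (c, d)) = s * potential f \<eta> + l \<bullet> \<eta> + (\<delta> + c \<bullet> d) + r (fst \<eta>)"
  proof -
    have "linear (\<lambda>\<eta>. m \<bullet> fst \<eta> + c \<bullet> K \<eta> + B (fst \<eta>) \<bullet> d)"
      using K B(1) by (simp add: linear_iff inner_add_left inner_add_right algebra_simps)
    \<comment> \<open>The contributions of the linear part of \<open>q\<close> and of the two
      translations are linear in \<eta>; they become the affine function that isometries and jets
      tolerate.\<close>
    then obtain l where l: "\<And>\<eta>. m \<bullet> fst \<eta> + c \<bullet> K \<eta> + B (fst \<eta>) \<bullet> d = l \<bullet> \<eta>"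
      using linear_functional_inner by blast
    have "B (fst \<eta>) \<bullet> K \<eta> = s * (fst \<eta> \<bullet> snd \<eta>) - fst \<eta> \<bullet> A (fst \<eta>)" for \<eta>
      by (simp add: K_def adj inner_diff_right)
    then have "potential f' (L \<eta> + (c, d)) = s * potential f \<eta> + l \<bullet> \<eta> + (\<delta> + c \<bullet> d) + r (fst \<eta>)" for \<eta>
      unfolding l[symmetric]
      by (simp add: potential_def L_def f' q inner_add_left inner_add_right distrib_left)
    then show ?thesis by blast
  qed
  ultimately show thesis using that by blast
qed

lemma smooth_map_potential:
  assumes "smooth_map f"
  shows "smooth_map (potential f)"
  unfolding potential_def[abs_def]
  by (intro smooth_map_add smooth_map_comp_linear[OF _ assms] smooth_map_inner smooth_map_linear linear_fst linear_snd)

section \<open>The functions \<open>f\<^sub>k\<close>\<close>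

definition tail_fun :: "nat \<Rightarrow> nat \<Rightarrow> real \<Rightarrow> real"
  where "tail_fun p k t = (if k \<le> p then 0 else if k = p + 1 then t ^ (p + 3) else exp t)"

lemma f_fun_eq: "f_fun e p k z = (\<Sum>i=1..min k p. z $ e i * (z $ e 0) ^ (i + 1)) + tail_fun p k (z $ e 0)"
  by (auto simp: f_fun_def tail_fun_def min_def)

text \<open>The index 0 lies outside the family but yields the symmetric space, so its homogeneity
  and the 0-modelling on it are instances of the results for \<open>f_fun\<close>.\<close>

lemma f_fun_zero: "f_fun e p 0 = (\<lambda>_. 0)"
  by (simp add: f_fun_eq tail_fun_def fun_eq_iff)

lemma linear_vec_nth_real: "linear (\<lambda>z :: real ^ 'p. z $ a)"
  by (simp add: linear_iff)

lemma smooth_map_vec_nth: "smooth_map (\<lambda>z :: real ^ 'p::finite. z $ a)"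
  by (rule smooth_map_linear) (rule linear_vec_nth_real)

lemma smooth_map_f_fun:
  fixes e :: "nat \<Rightarrow> 'p::finite"
  shows "smooth_map (f_fun e p k)"
proof -
  have "smooth_map (\<lambda>z. tail_fun p k (z $ e 0))"
    unfolding tail_fun_def
    by (cases "k \<le> p"; cases "k = p + 1")
      (simp_all add: smooth_map_const smooth_map_power smooth_map_vec_nth
        smooth_map_comp_linear[OF linear_vec_nth_real smooth_map_exp])
  then show ?thesis
    unfolding f_fun_eq[abs_def]
    by (intro smooth_map_add smooth_map_sum smooth_map_mult smooth_map_power smooth_map_vec_nth)
qed

section \<open>Polynomials in one variable\<close>

definition poly_fun :: "nat \<Rightarrow> (real \<Rightarrow> real) \<Rightarrow> bool"
  where "poly_fun n g \<longleftrightarrow> (\<exists>R. \<forall>t. g t = (\<Sum>i\<le>n. R i * t ^ i))"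

lemma poly_fun_add: "poly_fun n g \<Longrightarrow> poly_fun n h \<Longrightarrow> poly_fun n (\<lambda>t. g t + h t)"
  unfolding poly_fun_def
proof (elim exE)
  fix R S assume "\<forall>t. g t = (\<Sum>i\<le>n. R i * t ^ i)" "\<forall>t. h t = (\<Sum>i\<le>n. S i * t ^ i)"
  then show "\<exists>R. \<forall>t. g t + h t = (\<Sum>i\<le>n. R i * t ^ i)"
    by (intro exI[of _ "\<lambda>i. R i + S i"]) (simp add: sum.distrib algebra_simps)
qed

lemma poly_fun_cmult: "poly_fun n g \<Longrightarrow> poly_fun n (\<lambda>t. c * g t)"
  unfolding poly_fun_def
proof (elim exE)
  fix R assume "\<forall>t. g t = (\<Sum>i\<le>n. R i * t ^ i)"
  then show "\<exists>R. \<forall>t. c * g t = (\<Sum>i\<le>n. R i * t ^ i)"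
    by (intro exI[of _ "\<lambda>i. c * R i"]) (simp add: sum_distrib_left algebra_simps)
qed

lemma poly_fun_zero: "poly_fun n (\<lambda>_. 0)"
  unfolding poly_fun_def by (intro exI[of _ "\<lambda>_. 0"]) simp

lemma poly_fun_sum: "(\<And>i. i \<in> I \<Longrightarrow> poly_fun n (g i)) \<Longrightarrow> poly_fun n (\<lambda>t. \<Sum>i\<in>I. g i t)"
  by (induction I rule: infinite_finite_induct) (auto intro: poly_fun_add poly_fun_zero)

lemma poly_fun_mono:
  assumes "poly_fun m g" "m \<le> n"
  shows "poly_fun n g"
proof -
  from assms(1) obtain R where R: "\<And>t. g t = (\<Sum>i\<le>m. R i * t ^ i)"
    unfolding poly_fun_def by blast
  have "g t = (\<Sum>i\<le>n. (if i \<le> m then R i else 0) * t ^ i)" for t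
    unfolding R using assms(2) by (intro sum.mono_neutral_cong_left) auto
  then show ?thesis unfolding poly_fun_def by (intro exI allI)
qed

lemma poly_fun_power: "poly_fun n (\<lambda>t. (t + c) ^ n)"
  unfolding poly_fun_def
  by (intro exI[of _ "\<lambda>i. of_nat (n choose i) * c ^ (n - i)"])
    (simp add: binomial_ring algebra_simps)

text \<open>The leading terms cancel, so the degree drops by one. This brings the translate of
  z_0^(p+3) into the range that the shear can absorb.\<close>

lemma poly_fun_power_diff: "poly_fun n (\<lambda>t. (t + c) ^ Suc n - t ^ Suc n)"
  unfolding poly_fun_def
  by (intro exI[of _ "\<lambda>i. of_nat (Suc n choose i) * c ^ (Suc n - i)"])
    (simp only: binomial_ring sum.atMost_Suc, simp add: algebra_simps)

text \<open>Separates the part of degree at most two from the coefficients that are handed to the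
  shear as \<rho>.\<close>

lemma poly_fun_expand:
  assumes "poly_fun (m + 2) g"
  obtains R where "\<And>t. g t = R 0 + R 1 * t + R 2 * t\<^sup>2 + (\<Sum>j=1..m. R (j + 2) * t ^ (j + 2))"
proof -
  from assms obtain R where R: "\<And>t. g t = (\<Sum>i\<le>m+2. R i * t ^ i)"
    unfolding poly_fun_def by blast
  have "(\<Sum>i\<le>m+2. h i) = h 0 + h 1 + h 2 + (\<Sum>j=1..m. h (j + 2))" for h :: "nat \<Rightarrow> real"
    by (induction m) (simp_all add: eval_nat_numeral)
  then show thesis by (intro that[of R]) (simp only: R, simp)
qed

text \<open>Binomial expansion of ((t + c) + (-c))^(j+1), with the terms of order 0 and 1 in t + c
  moved to the other side: z_1 multiplies a square, so no coordinate carries these orders. The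
  common upper bound \<open>K\<close> is possible because the binomials with i > j vanish.\<close>

lemma shifted_binomial_sum:
  assumes "1 \<le> j" "j \<le> K"
  shows "(\<Sum>i=1..K. real (Suc j choose Suc i) * (- c) ^ (j - i) * (t + c) ^ Suc i)
    = t ^ Suc j - real (Suc j) * (- c) ^ j * (t + c) - (- c) ^ Suc j"
proof -
  let ?g = "\<lambda>k. real (Suc j choose k) * (t + c) ^ k * (- c) ^ (Suc j - k)"
  obtain m where j: "j = Suc m" using assms(1) by (cases j) auto
  have "t ^ Suc j = ((t + c) + (- c)) ^ Suc j" by simp
  also have "\<dots> = (\<Sum>k\<le>Suc j. ?g k)" by (rule binomial_ring)
  also have "\<dots> = ?g 0 + (?g 1 + (\<Sum>k\<le>m. ?g (Suc (Suc k))))"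
    unfolding j by (simp only: sum.atMost_Suc_shift One_nat_def)
  also have "(\<Sum>k\<le>m. ?g (Suc (Suc k))) = (\<Sum>i=1..j. ?g (Suc i))"
    unfolding j One_nat_def
    by (subst sum.shift_bounds_cl_Suc_ivl) (simp add: atMost_atLeast0)
  also have "\<dots> = (\<Sum>i=1..K. ?g (Suc i))"
    using assms by (intro sum.mono_neutral_left) (auto simp: binomial_eq_0 simp del: binomial_Suc_Suc)
  finally show ?thesis by (simp add: ac_simps)
qed

text \<open>
  Powers of \<open>z\<^sub>0 + c\<close> are expanded back into powers of \<open>z\<^sub>0\<close>, the unwanted terms of
  degree at least three being absorbed into the coordinates \<open>z\<^sub>1, \<dots>, z\<^sub>K\<close>; the
  coefficients \<open>\<rho>\<close> prescribe monomials \<open>z\<^sub>0\<^sup>j\<^sup>+\<^sup>2\<close> to be subtracted as well.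
\<close>

lemma shear_exists:
  fixes e :: "nat \<Rightarrow> 'p::finite" and \<rho> :: "nat \<Rightarrow> real"
  assumes e: "bij_betw e {0..p} UNIV" and K: "K \<le> p" and s: "0 < s"
  obtains B :: "real ^ 'p \<Rightarrow> real ^ 'p" and q where "linear B" "inj B" "quadratic q"
    "\<And>z. B z $ e 0 = z $ e 0"
    "\<And>z. (\<Sum>i=1..K. B z $ e i * (z $ e 0 + c) ^ (i + 1))
      = (\<Sum>j=1..K. (s * z $ e j - \<rho> j * z $ e 0) * (z $ e 0) ^ (j + 1)) + q z"
proof -
  define idx where "idx a = inv_into {0..p} e a" for a
  have idx: "idx (e i) = i" if "i \<le> p" for i
    using that e by (simp add: idx_def bij_betw_def)
  \<comment> \<open>The coefficient of (z_0 + c)^(i+1) after expanding each z_0^(j+1), with its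
    prescribed linear factor, in powers of z_0 + c.\<close>
  define w where "w i z = (\<Sum>j=1..K. real (Suc j choose Suc i) * (- c) ^ (j - i) * (s * z $ e j - \<rho> j * z $ e 0))"
    for i and z :: "real ^ 'p"
  define B where "B z = (\<chi> a. if idx a = 0 then z $ e 0 else if idx a \<le> K then w (idx a) z else z $ a)"
    for z :: "real ^ 'p"
  \<comment> \<open>The terms of order 0 and 1 omitted from the expansion; each is multiplied by a
    linear form, so the total is quadratic.\<close>
  define q where "q z = (\<Sum>j=1..K. (s * z $ e j - \<rho> j * z $ e 0)
      * (- (real (Suc j) * (- c) ^ j) * (z $ e 0) + (- (real (Suc j) * (- c) ^ j * c) - (- c) ^ Suc j)))"
    for z :: "real ^ 'p"
  have B0: "B z $ e 0 = z $ e 0" for z by (simp add: B_def idx)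
  have Bi: "B z $ e i = w i z" if "1 \<le> i" "i \<le> K" for i z
    using that K by (simp add: B_def idx)
  have B': "B z $ e i = z $ e i" if "K < i" "i \<le> p" for i z
    using that by (simp add: B_def idx)
  have "w i (x + y) = w i x + w i y" "w i (r *\<^sub>R x) = r * w i x" for i r x y
    by (simp_all add: w_def sum_distrib_left algebra_simps flip: sum.distrib)
  then have lin: "linear B"
    by (auto simp: linear_iff B_def vec_eq_iff)
  have "z = 0" if z: "B z = 0" for z
  proof -
    have z0: "z $ e 0 = 0" using B0[of z] z by simp
    \<comment> \<open>The system is triangular: \<open>w i\<close> involves z_0 and the coordinates
      with j \<ge> i, and the coefficient of z_i is s > 0. Hence the coordinates vanish from
      \<open>K\<close> downwards.\<close>
    have zi: "z $ e i = 0" if "1 \<le> i" "i \<le> K" for i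
      using that
    proof (induction "K - i" arbitrary: i rule: less_induct)
      case less
      have "w i z = (\<Sum>j\<in>{i}. real (Suc j choose Suc i) * (- c) ^ (j - i) * (s * z $ e j - \<rho> j * z $ e 0))"
        unfolding w_def
      proof (rule sum.mono_neutral_right)
        show "\<forall>j\<in>{1..K} - {i}. real (Suc j choose Suc i) * (- c) ^ (j - i) * (s * z $ e j - \<rho> j * z $ e 0) = 0"
        proof
          fix j assume j: "j \<in> {1..K} - {i}"
          show "real (Suc j choose Suc i) * (- c) ^ (j - i) * (s * z $ e j - \<rho> j * z $ e 0) = 0"
          proof (cases "j < i")
            case True
            then have "Suc j choose Suc i = 0" by (intro binomial_eq_0) simp
            then show ?thesis by (simp del: binomial_Suc_Suc)
          next
            case False
            with j less have "z $ e j = 0" by (intro less.hyps) auto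
            with z0 show ?thesis by simp
          qed
        qed
      qed (use less in auto)
      then have "w i z = s * z $ e i" by (simp add: z0)
      moreover have "w i z = 0" using Bi[OF less.prems, of z] z by simp
      ultimately show ?case using s by simp
    qed
    have "z $ e i = 0" if "i \<le> p" for i
      using z0 zi[of i] B'[of i z] z that by (cases "i = 0"; cases "i \<le> K") auto
    then have "z $ a = 0" for a
      using e by (metis (no_types, opaque_lifting) UNIV_I atLeastAtMost_iff bij_betw_imp_surj_on imageE)
    then show ?thesis by (simp add: vec_eq_iff)
  qed
  then have inj: "inj B" using linear_injective_0[OF lin] by blast
  have lin_a: "linear (\<lambda>z :: real ^ 'p. s * z $ e j - \<rho> j * z $ e 0)" "linear (\<lambda>z :: real ^ 'p. m * z $ e 0)" for j m
    by (simp_all add: linear_iff algebra_simps)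
  have "quadratic (\<lambda>z :: real ^ 'p. (s * z $ e j - \<rho> j * z $ e 0) * (m * z $ e 0 + n))" for j m n
    using quadratic_mult_affine[OF lin_a(1) lin_a(2), where r = 0] by simp
  then have quad: "quadratic q"
    unfolding q_def by (intro quadratic_sum)
  have "(\<Sum>i=1..K. B z $ e i * (z $ e 0 + c) ^ (i + 1))
      = (\<Sum>j=1..K. (s * z $ e j - \<rho> j * z $ e 0) * (z $ e 0) ^ (j + 1)) + q z" for z
  proof -
    let ?t = "z $ e 0" and ?a = "\<lambda>j. s * z $ e j - \<rho> j * z $ e 0"
    have "(\<Sum>i=1..K. B z $ e i * (?t + c) ^ (i + 1)) = (\<Sum>i=1..K. w i z * (?t + c) ^ Suc i)"
      by (intro sum.cong) (simp_all add: Bi)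
    also have "\<dots> = (\<Sum>i=1..K. \<Sum>j=1..K. ?a j * (real (Suc j choose Suc i) * (- c) ^ (j - i) * (?t + c) ^ Suc i))"
      by (simp only: w_def sum_distrib_right) (simp only: ac_simps)
    also have "\<dots> = (\<Sum>j=1..K. ?a j * (\<Sum>i=1..K. real (Suc j choose Suc i) * (- c) ^ (j - i) * (?t + c) ^ Suc i))"
      by (subst sum.swap) (simp only: sum_distrib_left)
    also have "\<dots> = (\<Sum>j=1..K. ?a j * (?t ^ Suc j - real (Suc j) * (- c) ^ j * (?t + c) - (- c) ^ Suc j))"
      by (intro sum.cong refl) (simp only: shifted_binomial_sum atLeastAtMost_iff)
    also have "\<dots> = (\<Sum>j=1..K. ?a j * ?t ^ (j + 1)) + q z"
      unfolding q_def sum.distrib[symmetric]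
      by (intro sum.cong refl) (simp add: algebra_simps)
    finally show ?thesis .
  qed
  with lin inj quad B0 show thesis using that by blast
qed

text \<open>The translation adds a polynomial in z_0 of degree at most K + 2. Its coefficients from
  degree 3 on are removed by the shear, the others go into the quadratic error.\<close>

lemma f_fun_translation:
  fixes e :: "nat \<Rightarrow> 'p::finite" and c :: "real ^ 'p"
  assumes e: "bij_betw e {0..p} UNIV" and k: "k \<le> p + 2"
  obtains B :: "real ^ 'p \<Rightarrow> real ^ 'p" and s q where "linear B" "inj B" "0 < s" "quadratic q"
    "\<And>z. f_fun e p k (B z + c) = s * f_fun e p k z + q z"
proof -
  define K where "K = min k p"
  define c0 where "c0 = c $ e 0"
  \<comment> \<open>exp (t + c0) is exp c0 times exp t, and no polynomial correction could replace
    this factor; the shear is asked to scale the monomials by the same amount.\<close>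
  define s where "s = (if k = p + 2 then exp c0 else 1)"
  have s: "0 < s" by (simp add: s_def)
  define g where "g t = (\<Sum>i=1..K. c $ e i * (t + c0) ^ (i + 1)) + (tail_fun p k (t + c0) - s * tail_fun p k t)" for t
  have "poly_fun (K + 2) (\<lambda>t. tail_fun p k (t + c0) - s * tail_fun p k t)"
  proof -
    consider "k \<le> p" | "k = p + 1" | "k = p + 2" using k by linarith
    then show ?thesis
    proof cases
      case 2
      then show ?thesis
        using poly_fun_power_diff[of "p + 2" c0] by (simp add: K_def tail_fun_def s_def eval_nat_numeral)
    qed (simp_all add: tail_fun_def s_def poly_fun_zero exp_add)
  qed
  moreover have "poly_fun (K + 2) (\<lambda>t. (t + c0) ^ (i + 1))" if "i \<in> {1..K}" for i
    using poly_fun_power by (rule poly_fun_mono) (use that in auto)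
  ultimately have "poly_fun (K + 2) g"
    unfolding g_def by (intro poly_fun_add poly_fun_sum poly_fun_cmult)
  then obtain R where R: "\<And>t. g t = R 0 + R 1 * t + R 2 * t\<^sup>2 + (\<Sum>j=1..K. R (j + 2) * t ^ (j + 2))"
    using poly_fun_expand by blast
  have "K \<le> p" by (simp add: K_def)
  then obtain B :: "real ^ 'p \<Rightarrow> real ^ 'p" and q where B: "linear B" "inj B" and q: "quadratic q"
    and B0: "\<And>z. B z $ e 0 = z $ e 0"
    and Bs: "\<And>z. (\<Sum>i=1..K. B z $ e i * (z $ e 0 + c0) ^ (i + 1))
      = (\<Sum>j=1..K. (s * z $ e j - R (j + 2) * z $ e 0) * (z $ e 0) ^ (j + 1)) + q z"
    using shear_exists[OF e _ s, of K c0 "\<lambda>j. R (j + 2)"] by blast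
  define q' where "q' z = q z + (R 0 + (1 * z $ e 0 + 0) * (R 2 * z $ e 0 + R 1))" for z
  have lin: "linear (\<lambda>z :: real ^ 'p. m * z $ e 0)" for m
    by (simp add: linear_iff algebra_simps)
  have "quadratic q'"
    unfolding q'_def by (intro quadratic_add q quadratic_const quadratic_mult_affine lin)
  moreover have "f_fun e p k (B z + c) = s * f_fun e p k z + q' z" for z
  proof -
    let ?t = "z $ e 0"
    have "f_fun e p k (B z + c) = (\<Sum>i=1..K. B z $ e i * (?t + c0) ^ (i + 1)) + g ?t + s * tail_fun p k ?t"
      by (simp add: f_fun_eq g_def B0 K_def c0_def distrib_right sum.distrib)
    also have "\<dots> = s * (\<Sum>j=1..K. z $ e j * ?t ^ (j + 1)) - (\<Sum>j=1..K. R (j + 2) * ?t ^ (j + 2))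
        + q z + g ?t + s * tail_fun p k ?t"
      unfolding Bs by (simp add: left_diff_distrib sum_subtractf sum_distrib_left mult.assoc)
    also have "\<dots> = s * f_fun e p k z + q' z"
      unfolding R by (simp add: q'_def f_fun_eq K_def algebra_simps power2_eq_square)
    finally show ?thesis .
  qed
  ultimately show thesis using that B s by blast
qed

lemma affinely_related_f_fun:
  fixes e :: "nat \<Rightarrow> 'p::finite"
  assumes e: "bij_betw e {0..p} UNIV" and k: "k \<le> p + 2"
  shows "affinely_related (potential (f_fun e p k)) y y'"
proof -
  have 0: "affinely_related (potential (f_fun e p k)) 0 (c, d)" for c d
  proof -
    obtain B :: "real ^ 'p \<Rightarrow> real ^ 'p" and s q where B: "linear B" "inj B" "0 < s" "quadratic q"
      and f: "\<And>z. f_fun e p k (B z + c) = s * f_fun e p k z + q z"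
      using f_fun_translation[OF e k] by blast
    have "f_fun e p k (B z + c) = s * f_fun e p k z + q z + 0" for z by (simp add: f)
    from potential_lift[OF B this, of d] obtain L L' l \<gamma> where L: "linear L" "linear L'"
      "\<And>v. L' (L v) = v" "\<And>v. L (L' v) = v"
      and "\<And>\<eta>. potential (f_fun e p k) (L \<eta> + (c, d)) = s * potential (f_fun e p k) \<eta> + l \<bullet> \<eta> + \<gamma> + 0"
      by blast
    moreover have "L 0 + (c, d) = (c, d)" by (simp add: linear_0[OF L(1)])
    ultimately show ?thesis
      unfolding affinely_related_def using B(3) by (metis add.right_neutral)
  qed
  show ?thesis
    using affinely_related_trans[OF affinely_related_sym[OF 0] 0, of "fst y" "snd y" "fst y'" "snd y'"]
    by simp
qed

subsection \<open>Comparison of jets\<close>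

text \<open>Differentiation lowers the index by one, which is the recursion of
  \<open>vanishes_to\<close>.\<close>

definition exp_remainder :: "nat \<Rightarrow> real \<Rightarrow> real"
  where "exp_remainder n t = exp t - (\<Sum>i<n. t ^ i / fact i)"

lemma DERIV_exp_remainder: "(exp_remainder (Suc n) has_real_derivative exp_remainder n t) (at t)"
proof -
  have "((\<lambda>t. \<Sum>i<Suc n. t ^ i / fact i) has_real_derivative (\<Sum>i<n. t ^ i / fact i)) (at t)"
  proof (induction n)
    case (Suc n)
    have "((\<lambda>t. t ^ Suc n / fact (Suc n)) has_real_derivative t ^ n / fact n) (at t)"
      using DERIV_cdivide[OF DERIV_pow[of "Suc n" t], of "fact (Suc n)"]
      by (simp add: fact_Suc del: of_nat_Suc power_Suc)
    from DERIV_add[OF Suc this] show ?case by simp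
  qed (auto intro!: derivative_eq_intros)
  then show ?thesis
    unfolding exp_remainder_def by (rule DERIV_diff[OF DERIV_exp])
qed

lemma smooth_map_exp_remainder: "smooth_map (\<lambda>z :: real ^ 'p::finite. exp_remainder n (z $ a))"
proof -
  have "smooth_map (\<lambda>z :: real ^ 'p. \<Sum>i<n. inverse (fact i) * (z $ a) ^ i)"
    by (intro smooth_map_sum smooth_map_cmult smooth_map_power smooth_map_vec_nth)
  with smooth_map_diff[OF smooth_map_comp_linear[OF linear_vec_nth_real smooth_map_exp, of a] this]
  show ?thesis by (simp add: exp_remainder_def divide_inverse mult.commute)
qed

lemma vanishes_to_cmult:
  "smooth_map F \<Longrightarrow> vanishes_to n F P \<Longrightarrow> vanishes_to n (\<lambda>x. c * F x) P"
  using vanishes_to_mult[of "\<lambda>_. c" F 0 P n] by (simp add: smooth_map_const)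

lemma vanishes_to_exp_remainder: "vanishes_to n (\<lambda>z :: real ^ 'p::finite. exp_remainder n (z $ a)) 0"
proof (induction n)
  case (Suc n)
  have "dir_deriv (\<lambda>z :: real ^ 'p. exp_remainder (Suc n) (z $ a)) z u = u $ a * exp_remainder n (z $ a)" for z u
  proof -
    have "((\<lambda>z :: real ^ 'p. z $ a) has_derivative (\<lambda>u. u $ a)) (at z)"
      by (intro bounded_linear_imp_has_derivative bounded_linear_vec_nth)
    from diff_chain_at[OF this DERIV_exp_remainder[unfolded has_field_derivative_def]]
    show ?thesis by (intro dir_deriv_eqI) (simp add: o_def mult.commute)
  qed
  moreover have "exp_remainder (Suc n) 0 = 0"
    by (simp add: exp_remainder_def sum.lessThan_Suc_shift del: sum.lessThan_Suc)
  ultimately show ?case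
    using vanishes_to_cmult[OF smooth_map_exp_remainder Suc] by simp
qed simp

lemma vanishes_to_comp_linear:
  fixes T :: "'a::euclidean_space \<Rightarrow> 'b::real_normed_vector"
  assumes "linear T"
  shows "smooth_map F \<Longrightarrow> vanishes_to n F (T y) \<Longrightarrow> vanishes_to n (\<lambda>x. F (T x)) y"
proof (induction n arbitrary: F)
  case (Suc n)
  have "vanishes_to n (\<lambda>x. dir_deriv F (T x) (T u)) y" for u
    using Suc.prems by (intro Suc.IH[of "\<lambda>Q. dir_deriv F Q (T u)"] smooth_map_dir_deriv) simp_all
  with Suc.prems show ?case
    using assms by (simp add: dir_deriv_comp_linear smooth_map_differentiable linear_conv_bounded_linear)
qed simp

lemma vanishes_to_vec_nth: "vanishes_to 1 (\<lambda>z :: real ^ 'p::finite. z $ a) 0"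
  by simp

lemma vanishes_to_vec_nth_power: "vanishes_to n (\<lambda>z :: real ^ 'p::finite. (z $ a) ^ n) 0"
  using vanishes_to_power[OF smooth_map_vec_nth vanishes_to_vec_nth, of n] by simp

lemma vanishes_to_monomials:
  fixes e :: "nat \<Rightarrow> 'p::finite"
  assumes "\<And>i. i \<in> I \<Longrightarrow> n \<le> i + 2"
  shows "vanishes_to n (\<lambda>z :: real ^ 'p. \<Sum>i\<in>I. z $ e i * (z $ e 0) ^ (i + 1)) 0"
proof (intro vanishes_to_sum conjI)
  fix i assume "i \<in> I"
  have "vanishes_to (1 + (i + 1)) (\<lambda>z :: real ^ 'p. z $ e i * (z $ e 0) ^ (i + 1)) 0"
    by (intro vanishes_to_mult vanishes_to_vec_nth_power vanishes_to_vec_nth smooth_map_power smooth_map_vec_nth)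
  then show "vanishes_to n (\<lambda>z :: real ^ 'p. z $ e i * (z $ e 0) ^ (i + 1)) 0"
    by (rule vanishes_to_mono) (use assms[OF \<open>i \<in> I\<close>] in simp)
  show "smooth_map (\<lambda>z :: real ^ 'p. z $ e i * (z $ e 0) ^ (i + 1))"
    by (intro smooth_map_mult smooth_map_power smooth_map_vec_nth)
qed

lemma smooth_map_monomials:
  fixes e :: "nat \<Rightarrow> 'p::finite"
  shows "smooth_map (\<lambda>z :: real ^ 'p. \<Sum>i\<in>I. z $ e i * (z $ e 0) ^ (i + 1))"
  by (intro smooth_map_sum smooth_map_mult smooth_map_power smooth_map_vec_nth)

lemma sum_split_at:
  fixes h :: "nat \<Rightarrow> real"
  assumes "j \<le> n"
  shows "(\<Sum>i=1..n. h i) = (\<Sum>i=1..j. h i) + (\<Sum>i=j+1..n. h i)"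
  using assms by (induction n rule: dec_induct) simp_all

text \<open>
  The lowest order terms of the exponential are absorbed by the shear; the factor
  \<open>s = 1 / (p + 3)!\<close> matches its term of order \<open>p + 3\<close> with the one of \<open>f\<^sub>p\<^sub>+\<^sub>1\<close>.
\<close>

lemma f_fun_jet:
  fixes e :: "nat \<Rightarrow> 'p::finite"
  assumes e: "bij_betw e {0..p} UNIV" and jk: "j < k" and k: "k \<le> p + 2"
  obtains B :: "real ^ 'p \<Rightarrow> real ^ 'p" and s q r where "linear B" "inj B" "0 < s" "quadratic q"
    "smooth_map r" "vanishes_to (j + 3) r 0"
    "\<And>z. f_fun e p k (B z) = s * f_fun e p j z + q z + r z"
proof (cases "k = p + 2")
  case False
  with jk k have jp: "j \<le> p" and kp: "k \<le> p + 1" by simp_all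
  \<comment> \<open>Without the exponential the identity works in place of a shear: f_k - f_j
    consists of terms of degree at least j + 3.\<close>
  define r where "r z = (\<Sum>i=j+1..min k p. z $ e i * (z $ e 0) ^ (i + 1)) + tail_fun p k (z $ e 0)"
    for z :: "real ^ 'p"
  have tail: "tail_fun p k (z $ e 0) = (if k \<le> p then 0 else 1) * (z $ e 0) ^ (p + 3)" for z :: "real ^ 'p"
    using kp by (simp add: tail_fun_def)
  have "smooth_map r"
    unfolding r_def tail
    by (intro smooth_map_add smooth_map_monomials smooth_map_cmult smooth_map_power smooth_map_vec_nth)
  moreover have "vanishes_to (j + 3) r 0"
    unfolding r_def tail
    by (intro vanishes_to_add vanishes_to_cmult smooth_map_monomials smooth_map_cmult smooth_map_power
        smooth_map_vec_nth vanishes_to_monomials vanishes_to_mono[OF vanishes_to_vec_nth_power])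
      (use jp in auto)
  moreover have "f_fun e p k (id z) = 1 * f_fun e p j z + 0 + r z" for z
    using sum_split_at[of j "min k p" "\<lambda>i. z $ e i * (z $ e 0) ^ (i + 1)"] jp jk
    by (simp add: f_fun_eq r_def) (simp add: tail_fun_def min_def)
  ultimately show thesis
    using that[of id 1 "\<lambda>_. 0" r] by (simp add: linear_id quadratic_const)
next
  case True
  define s :: real where "s = 1 / fact (p + 3)"
  have s: "0 < s" by (simp add: s_def)
  obtain B :: "real ^ 'p \<Rightarrow> real ^ 'p" and q where B: "linear B" "inj B" and q: "quadratic q"
    and B0: "\<And>z. B z $ e 0 = z $ e 0"
    and Bs: "\<And>z. (\<Sum>i=1..p. B z $ e i * (z $ e 0 + 0) ^ (i + 1))
      = (\<Sum>i=1..p. (s * z $ e i - (1 / fact (i + 2)) * z $ e 0) * (z $ e 0) ^ (i + 1)) + q z"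
    using shear_exists[OF e _ s, of p 0 "\<lambda>i. 1 / fact (i + 2)"] by blast
  define q' where "q' z = q z + (1 + (1 * z $ e 0 + 0) * (1/2 * z $ e 0 + 1))" for z
  have lin: "linear (\<lambda>z :: real ^ 'p. m * z $ e 0)" for m
    by (simp add: linear_iff algebra_simps)
  have q': "quadratic q'"
    unfolding q'_def by (intro quadratic_add q quadratic_const quadratic_mult_affine lin)
  have exp_eq: "exp t - (\<Sum>i=1..p. 1 / fact (i + 2) * t * t ^ (i + 1))
      = 1 + t + t\<^sup>2 / 2 + exp_remainder (p + 3) t" for t :: real
  proof -
    have "(\<Sum>i<p+3. t ^ i / fact i) = 1 + t + t\<^sup>2 / 2 + (\<Sum>i=1..p. 1 / fact (i + 2) * t * t ^ (i + 1))"
      by (induction p) (simp_all add: eval_nat_numeral)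
    then show ?thesis by (simp add: exp_remainder_def)
  qed
  have main: "f_fun e p k (B z) = s * (\<Sum>i=1..p. z $ e i * (z $ e 0) ^ (i + 1)) + q' z + exp_remainder (p + 3) (z $ e 0)" for z
  proof -
    have "f_fun e p k (B z) = (\<Sum>i=1..p. B z $ e i * (z $ e 0 + 0) ^ (i + 1)) + exp (z $ e 0)"
      using True by (simp add: f_fun_eq tail_fun_def B0)
    also have "\<dots> = s * (\<Sum>i=1..p. z $ e i * (z $ e 0) ^ (i + 1)) + q z
        + (exp (z $ e 0) - (\<Sum>i=1..p. 1 / fact (i + 2) * z $ e 0 * (z $ e 0) ^ (i + 1)))"
      unfolding Bs by (simp only: left_diff_distrib sum_subtractf sum_distrib_left) (simp add: mult.assoc)
    also have "\<dots> = s * (\<Sum>i=1..p. z $ e i * (z $ e 0) ^ (i + 1)) + q' z + exp_remainder (p + 3) (z $ e 0)"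
      unfolding exp_eq by (simp add: q'_def algebra_simps power2_eq_square)
    finally show ?thesis .
  qed
  show thesis
  proof (cases "j \<le> p")
    case jp: True
    define r where "r z = s * (\<Sum>i=j+1..p. z $ e i * (z $ e 0) ^ (i + 1)) + exp_remainder (p + 3) (z $ e 0)"
      for z :: "real ^ 'p"
    have "smooth_map r"
      unfolding r_def by (intro smooth_map_add smooth_map_monomials smooth_map_cmult smooth_map_exp_remainder)
    moreover have "vanishes_to (j + 3) r 0"
      unfolding r_def
      by (intro vanishes_to_add vanishes_to_cmult smooth_map_monomials smooth_map_cmult
          smooth_map_exp_remainder vanishes_to_monomials vanishes_to_mono[OF vanishes_to_exp_remainder])
        (use jp in auto)
    moreover have "f_fun e p k (B z) = s * f_fun e p j z + q' z + r z" for z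
      unfolding main using sum_split_at[OF jp, of "\<lambda>i. z $ e i * (z $ e 0) ^ (i + 1)"] jp
      by (simp add: f_fun_eq r_def tail_fun_def min_def algebra_simps)
    ultimately show thesis using that[OF B s q'] by blast
  next
    case False
    with True jk have j: "j = p + 1" by simp
    have "exp_remainder (p + 3) t = s * t ^ (p + 3) + exp_remainder (p + 4) t" for t
      by (simp add: exp_remainder_def s_def eval_nat_numeral)
    then have "f_fun e p k (B z) = s * f_fun e p j z + q' z + exp_remainder (j + 3) (z $ e 0)" for z
      unfolding main by (simp add: f_fun_eq tail_fun_def j algebra_simps)
    then show thesis
      using that[OF B s q' smooth_map_exp_remainder vanishes_to_exp_remainder] by blast
  qed
qed

text \<open>The jets are compared at the origins only; affine homogeneity of both potentials moves
  the comparison to arbitrary points.\<close>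

lemma jet_equivalent_f_fun:
  fixes e :: "nat \<Rightarrow> 'p::finite"
  assumes e: "bij_betw e {0..p} UNIV" and jk: "j < k" and k: "k \<le> p + 2"
  shows "jet_equivalent j (potential (f_fun e p k)) y (potential (f_fun e p j)) y'"
proof -
  obtain B :: "real ^ 'p \<Rightarrow> real ^ 'p" and s q r where B: "linear B" "inj B" "0 < s" "quadratic q"
    and r: "smooth_map r" "vanishes_to (j + 3) r 0"
    and f: "\<And>z. f_fun e p k (B z) = s * f_fun e p j z + q z + r z"
    using f_fun_jet[OF assms] by blast
  have "f_fun e p k (B z + 0) = s * f_fun e p j z + q z + r z" for z by (simp add: f)
  from potential_lift[OF B this, of 0] obtain L L' l \<gamma> where L: "linear L" "linear L'"
      "\<And>v. L' (L v) = v" "\<And>v. L (L' v) = v"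
    and L_eq: "\<And>\<eta>. potential (f_fun e p k) (L \<eta> + (0, 0)) = s * potential (f_fun e p j) \<eta> + l \<bullet> \<eta> + \<gamma> + r (fst \<eta>)"
    by blast
  have smooth: "smooth_map (potential (f_fun e p i))" for i
    by (intro smooth_map_potential smooth_map_f_fun)
  have "jet_equivalent j (potential (f_fun e p j)) 0 (potential (f_fun e p k)) (L 0 + (0, 0))"
    by (rule jet_equivalentI[OF L B(3) L_eq smooth smooth])
      (simp_all add: smooth_map_comp_linear[OF linear_fst] vanishes_to_comp_linear[OF linear_fst] r)
  then have "jet_equivalent j (potential (f_fun e p j)) 0 (potential (f_fun e p k)) 0"
    by (simp add: linear_0[OF L(1)] flip: zero_prod_def)
  moreover have "jet_equivalent j (potential (f_fun e p k)) y (potential (f_fun e p k)) 0"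
    "jet_equivalent j (potential (f_fun e p j)) 0 (potential (f_fun e p j)) y'"
    using jk k by (auto intro!: affinely_related_jet_equivalent affinely_related_f_fun e smooth)
  ultimately show ?thesis
    using jet_equivalent_sym jet_equivalent_trans by blast
qed

lemma H_metric_eq: "H_metric e p k = wave_metric (potential (f_fun e p k))"
  by (simp add: H_metric_def M_metric_eq_wave_metric)

lemma homogeneous_H_metric:
  "bij_betw e {0..p} UNIV \<Longrightarrow> k \<le> p + 2 \<Longrightarrow> homogeneous_space (H_metric e p k)"
  unfolding H_metric_eq by (intro homogeneous_wave_metric affinely_related_f_fun)

lemma modeled_on_H_metric:
  assumes "bij_betw e {0..p} UNIV" "j < k" "k \<le> p + 2"
  shows "modeled_on j (H_metric e p k) (H_metric e p j)"
  unfolding modeled_on_def H_metric_eq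
  by (intro allI jet_equivalent_model_isomorphism jet_equivalent_f_fun assms smooth_map_potential smooth_map_f_fun)

subsection \<open>Distinguishing the models\<close>

text \<open>The bound on \<open>j\<close> excludes the exponential, which is never the potential
  with the smaller index.\<close>

lemma degree_potential_f_fun:
  fixes e :: "nat \<Rightarrow> 'p::finite"
  assumes "j \<le> p + 1"
  shows "degree_at_most (j + 2) (potential (f_fun e p j))"
proof -
  have l: "degree_at_most 1 (\<lambda>y :: (real ^ 'p) \<times> (real ^ 'p). fst y $ a)"
    "degree_at_most 1 (\<lambda>y :: (real ^ 'p) \<times> (real ^ 'p). snd y $ a)" for a
    by (rule degree_at_most_linear, simp add: linear_iff)+
  have pow: "degree_at_most n (\<lambda>y :: (real ^ 'p) \<times> (real ^ 'p). (fst y $ a) ^ n)" for n a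
    using degree_at_most_power[OF l(1)] by simp
  have tail: "degree_at_most (j + 2) (\<lambda>y :: (real ^ 'p) \<times> (real ^ 'p). tail_fun p j (fst y $ e 0))"
  proof (cases "j \<le> p")
    case True
    then show ?thesis using degree_at_most_const[of "j + 2" 0] by (simp only: tail_fun_def if_True)
  next
    case False
    with assms have "j = p + 1" by simp
    then have "tail_fun p j t = t ^ (j + 2)" for t
      by (simp add: tail_fun_def eval_nat_numeral)
    with pow[of "j + 2"] show ?thesis by simp
  qed
  have mon: "degree_at_most (j + 2) (\<lambda>y :: (real ^ 'p) \<times> (real ^ 'p). fst y $ e i * (fst y $ e 0) ^ (i + 1))"
    if "i \<in> {1..min j p}" for i
    using degree_at_most_mult[OF l(1) pow] by (rule degree_at_most_mono) (use that in auto)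
  have pair: "degree_at_most (j + 2) (\<lambda>y :: (real ^ 'p) \<times> (real ^ 'p). fst y $ a * snd y $ a)" for a
    using degree_at_most_mult[OF l(1) l(2)] by (rule degree_at_most_mono) simp
  show ?thesis
    unfolding potential_def[abs_def] f_fun_eq inner_vec_def inner_real_def
    by (intro degree_at_most_add degree_at_most_sum mon tail pair)
qed

text \<open>Repeated derivatives in one direction are ordinary derivatives of the restriction to a
  line, so a candidate sequence \<open>g\<close> can be checked one derivative at a time.\<close>

lemma iter_deriv_replicate_along_line:
  assumes "smooth_map F" and "\<And>t. ((\<lambda>t. g n t) has_real_derivative g (Suc n) t) (at t)"
    and "\<And>t. iter_deriv (replicate n v) F (t *\<^sub>R v) = g n t"
  shows "iter_deriv (replicate (Suc n) v) F (t *\<^sub>R v) = g (Suc n) t"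
proof -
  have "((\<lambda>t. iter_deriv (replicate n v) F (0 + t *\<^sub>R v)) has_real_derivative
      dir_deriv (iter_deriv (replicate n v) F) (0 + t *\<^sub>R v) v) (at t)"
    by (intro DERIV_along_line smooth_map_differentiable smooth_map_iter_deriv assms)
  then have "((\<lambda>t. g n t) has_real_derivative
      dir_deriv (iter_deriv (replicate n v) F) (t *\<^sub>R v) v) (at t)"
    by (simp add: assms(3))
  with assms(2) have "dir_deriv (iter_deriv (replicate n v) F) (t *\<^sub>R v) v = g (Suc n) t"
    using DERIV_unique by blast
  then show ?thesis by simp
qed

text \<open>The coefficient is m! / (m - n)!, written as a rising factorial so that
  \<open>pochhammer_rec\<close> supplies the inductive step.\<close>

lemma iter_deriv_power_along_line:
  assumes F: "smooth_map F" "\<And>t. F (t *\<^sub>R v) = t ^ m"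
  shows "n \<le> m \<Longrightarrow> iter_deriv (replicate n v) F (t *\<^sub>R v) = pochhammer (real (m - n) + 1) n * t ^ (m - n)"
proof (induction n arbitrary: t)
  case (Suc n)
  then obtain d where d: "m = Suc n + d" using le_Suc_ex by blast
  have "((\<lambda>t. pochhammer (real (m - n) + 1) n * t ^ (m - n)) has_real_derivative
      pochhammer (real (m - Suc n) + 1) (Suc n) * t ^ (m - Suc n)) (at t)" for t
    using DERIV_cmult[OF DERIV_pow[of "Suc d" t], of "pochhammer (real (m - n) + 1) n"]
    by (simp add: d pochhammer_rec algebra_simps)
  from iter_deriv_replicate_along_line[OF F(1), of "\<lambda>n t. pochhammer (real (m - n) + 1) n * t ^ (m - n)", OF this]
  show ?case using Suc by simp
qed (simp add: F)

lemma iter_deriv_exp_along_line: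
  assumes F: "smooth_map F" "\<And>t. F (t *\<^sub>R v) = exp t"
  shows "iter_deriv (replicate n v) F (t *\<^sub>R v) = exp t"
proof (induction n arbitrary: t)
  case (Suc n)
  show ?case
    by (rule iter_deriv_replicate_along_line[OF F(1), of "\<lambda>n t. exp t"]) (auto intro: DERIV_exp Suc)
qed (simp add: F)

lemma iter_deriv_f_fun_nonzero:
  fixes e :: "nat \<Rightarrow> 'p::finite"
  assumes e: "bij_betw e {0..p} UNIV" and k: "1 \<le> k" "k \<le> p + 2"
  obtains v where "iter_deriv (replicate (k + 2) v) (potential (f_fun e p k)) 0 \<noteq> 0"
proof -
  have inj: "e i = e j \<longleftrightarrow> i = j" if "i \<le> p" "j \<le> p" for i j
    using e that by (auto simp: bij_betw_def inj_on_eq_iff)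
  \<comment> \<open>For k \<le> p, only the monomial z_k z_0^(k+1) survives on the line through e_0
    + e_k; for larger k, the direction e_0 isolates the tail. The tilde part is 0, which removes the
    pairing.\<close>
  define z :: "real ^ 'p" where "z = (if k \<le> p then axis (e 0) 1 + axis (e k) 1 else axis (e 0) 1)"
  have z0: "z $ e 0 = 1" using k inj[of 0 k] by (auto simp: z_def axis_def)
  have zi: "z $ e i = (if i = k then 1 else 0)" if "1 \<le> i" "i \<le> p" for i
    using that k inj[of 0 i] inj[of k i] by (auto simp: z_def axis_def)
  have F: "potential (f_fun e p k) (t *\<^sub>R (z, 0)) = (if k = p + 2 then exp t else t ^ (k + 2))" for t
  proof -
    have "(\<Sum>i=1..min k p. (t *\<^sub>R z) $ e i * ((t *\<^sub>R z) $ e 0) ^ (i + 1))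
        = (\<Sum>i=1..min k p. if i = k then t ^ (k + 2) else 0)"
      by (intro sum.cong refl) (simp add: z0 zi)
    also have "\<dots> = (if k \<le> p then t ^ (k + 2) else 0)"
      using k by (simp add: min_def)
    finally have pot: "potential (f_fun e p k) (t *\<^sub>R (z, 0)) = (if k \<le> p then t ^ (k + 2) else 0) + tail_fun p k t"
      by (simp add: potential_def f_fun_eq z0)
    consider "k \<le> p" | "k = p + 1" | "k = p + 2" using k by linarith
    then show ?thesis
      unfolding pot by cases (simp_all add: tail_fun_def eval_nat_numeral)
  qed
  have smooth: "smooth_map (potential (f_fun e p k))"
    by (intro smooth_map_potential smooth_map_f_fun)
  have "iter_deriv (replicate (k + 2) (z, 0)) (potential (f_fun e p k)) (0 *\<^sub>R (z, 0)) \<noteq> 0"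
  proof (cases "k = p + 2")
    case True
    then show ?thesis
      by (subst iter_deriv_exp_along_line[OF smooth]) (unfold F, simp_all)
  next
    case False
    then show ?thesis
      by (subst iter_deriv_power_along_line[OF smooth, of _ "k + 2"])
       (simp_all only: F if_False diff_self_eq_0 order_refl, simp add: pochhammer_fact[symmetric])
  qed
  then show thesis by (intro that[of "(z, 0)"]) (simp only: scaleR_zero_left not_False_eq_True)
qed

lemma not_modeled_on_H_metric:
  fixes e :: "nat \<Rightarrow> 'p::finite"
  assumes e: "bij_betw e {0..p} UNIV" and jk: "j < k" and k: "k \<le> p + 2"
  shows "\<not> modeled_on k (H_metric e p j) (H_metric e p k)"
proof
  assume "modeled_on k (H_metric e p j) (H_metric e p k)"
  then obtain \<phi> where \<phi>: "model_isomorphism k (H_metric e p j) 0 (H_metric e p k) 0 \<phi>"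
    unfolding modeled_on_def by blast
  then have bij: "bij \<phi>" by (simp add: model_isomorphism_def)
  obtain v where v: "iter_deriv (replicate (k + 2) v) (potential (f_fun e p k)) 0 \<noteq> 0"
    using iter_deriv_f_fun_nonzero[OF e _ k] jk by auto
  have smooth: "smooth_map (potential (f_fun e p i))" for i
    by (intro smooth_map_potential smooth_map_f_fun)
  \<comment> \<open>Each of the two final pairs has wedge \<open>v\<close>, so this component is the
    repeated derivative along \<open>v\<close>.\<close>
  define \<xi>s :: "(real ^ 'p coord) list" where
    "\<xi>s = replicate k (mk_point 0 v 0 0) @ [mk_point 1 0 0 0, mk_point 0 v 0 0, mk_point 1 0 0 0, mk_point 0 v 0 0]"
  have len: "length \<xi>s = 4 + k" by (simp add: \<xi>s_def)
  have "nabla_curvature (H_metric e p k) k 0 \<xi>s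
      = - iter_deriv (replicate k v @ [v, v]) (potential (f_fun e p k)) 0"
    unfolding H_metric_eq nabla_curvature_wave_metric[OF smooth len]
    by (simp add: \<xi>s_def nth_append wedge_def)
  also have "replicate n v @ [v, v] = replicate (n + 2) v" for n
    by (induction n) simp_all
  finally have nz: "nabla_curvature (H_metric e p k) k 0 \<xi>s \<noteq> 0" using v by simp
  define \<zeta>s where "\<zeta>s = map (inv \<phi>) \<xi>s"
  have len': "length \<zeta>s = 4 + k" by (simp add: \<zeta>s_def len)
  have "map \<phi> \<zeta>s = \<xi>s"
    using bij by (simp add: \<zeta>s_def o_def surj_f_inv_f bij_is_surj)
  with \<phi> len' have "nabla_curvature (H_metric e p k) k 0 \<xi>s = nabla_curvature (H_metric e p j) k 0 \<zeta>s"
    unfolding model_isomorphism_def by (metis order_refl)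
  also have "\<dots> = 0"
    unfolding H_metric_eq nabla_curvature_wave_metric[OF smooth len']
    by (subst iter_deriv_degree[OF degree_potential_f_fun]) (use jk k len' in auto)
  finally show False using nz by simp
qed

section \<open>The symmetric space\<close>

lemma potential_zero: "potential (\<lambda>_. 0) y = fst y \<bullet> snd y"
  by (simp add: potential_def)

lemma smooth_map_potential_zero: "smooth_map (potential (\<lambda>_. 0) :: (real ^ 'p::finite) \<times> (real ^ 'p) \<Rightarrow> real)"
  by (intro smooth_map_potential smooth_map_const)

lemma S_metric_eq_wave_metric: "S_metric = wave_metric (potential (\<lambda>_. 0))"
  by (simp add: S_metric_def M_metric_eq_wave_metric)

lemma symmetric_S_metric: "symmetric_space (S_metric :: 'p::finite coord metric)"
  unfolding symmetric_space_def
proof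
  fix P :: "real ^ 'p coord"
  let ?F = "potential (\<lambda>_. 0) :: (real ^ 'p) \<times> (real ^ 'p) \<Rightarrow> real"
  let ?L = "uminus :: (real ^ 'p) \<times> (real ^ 'p) \<Rightarrow> (real ^ 'p) \<times> (real ^ 'p)"
  let ?y = "y_coord P"
  \<comment> \<open>The potential has degree two, so y \<mapsto> 2 y_P - y changes it by an affine
    function. That function vanishes at y_P, which makes the differential there minus the
    identity.\<close>
  let ?l = "(- 2 *\<^sub>R snd ?y, - 2 *\<^sub>R fst ?y)" and ?c = "4 * (fst ?y \<bullet> snd ?y)"
  have lin: "linear ?L" by (simp add: linear_iff)
  have F: "(- 1)\<^sup>2 * ?F (- \<eta> + 2 *\<^sub>R ?y) = ?F \<eta> + ?l \<bullet> \<eta> + ?c" for \<eta>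
    by (simp add: potential_zero inner_prod_def algebra_simps inner_commute)
  have adj: "adjoint ?L = ?L" by (rule adjoint_unique) simp
  obtain \<sigma> where \<sigma>: "isometry_of (wave_metric ?F) \<sigma>" "\<sigma> P = P"
    and d: "\<And>u. dir_deriv \<sigma> P u = mk_point (- 1 * x_coord u) (- y_coord u)
       (inverse (- 1) * (xs_coord u + x_coord u * (?l \<bullet> ?y + ?c))) (adjoint ?L (ys_coord u))"
    using wave_metric_isometry[OF lin lin _ _ _ F, of P P] by (auto simp: scaleR_2)
  have "?l \<bullet> ?y + ?c = 0" by (simp add: inner_prod_def inner_commute)
  then have "dir_deriv \<sigma> P u = - u" for u
    unfolding d adj by (intro point_eqI) simp_all
  with \<sigma> show "\<exists>\<sigma>. isometry_of S_metric \<sigma> \<and> \<sigma> P = P \<and> (\<forall>u. dir_deriv \<sigma> P u = - u)"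
    unfolding S_metric_eq_wave_metric by blast
qed

section \<open>Holonomy of the symmetric space\<close>

lemma grad_potential_zero:
  "grad (potential (\<lambda>_. 0)) y = (snd y, fst (y :: (real ^ 'p::finite) \<times> (real ^ 'p)))"
proof -
  have "grad (potential (\<lambda>_. 0)) y \<bullet> w = (snd y, fst y) \<bullet> w" for w
  proof -
    have "((\<lambda>y. fst y \<bullet> snd y) has_derivative (\<lambda>w. fst y \<bullet> snd w + fst w \<bullet> snd y)) (at y)"
      by (intro has_derivative_inner has_derivative_fst has_derivative_snd has_derivative_ident)
    then have "dir_deriv (potential (\<lambda>_. 0)) y w = fst y \<bullet> snd w + fst w \<bullet> snd y"
      by (intro dir_deriv_eqI) (simp add: potential_zero[abs_def])
    then show ?thesis
      unfolding grad_inner[OF smooth_map_differentiable[OF smooth_map_potential_zero]]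
      by (simp add: inner_prod_def inner_commute)
  qed
  then show ?thesis by (metis vector_eq_rdot)
qed

lemma has_vector_derivative_scaleR_const:
  "(f has_real_derivative d) (at t) \<Longrightarrow> ((\<lambda>t. f t *\<^sub>R A) has_vector_derivative d *\<^sub>R A) (at t)"
  using has_vector_derivative_scaleR[OF _ has_vector_derivative_const, of f d t UNIV A] by simp

text \<open>
  The loop \<open>x = t - t\<^sup>2\<close>, \<open>y = y\<^sub>P + (t\<^sup>2 - t\<^sup>3) \<eta>\<close> has
  \<open>\<integral> (y - y\<^sub>P) dx = - \<eta> / 60\<close>. Since \<open>x\<close>- and \<open>y\<close>-components of a parallel field are
  constant, its holonomy is read off by integration.
\<close>

lemma holonomy_S_metric:
  fixes P :: "real ^ 'p::finite coord"
  shows "(\<lambda>v. v + mk_point 0 0 (y_coord v \<bullet> \<omega>) (- (x_coord v *\<^sub>R \<omega>))) \<in> holonomy_group S_metric P"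
proof -
  define sw where "sw y = (snd y, fst y)" for y :: "(real ^ 'p) \<times> (real ^ 'p)"
  \<comment> \<open>\<open>sw\<close> is the gradient of the potential and an involution; the factor
    -60 undoes the integral -1/60.\<close>
  define \<eta> where "\<eta> = - 60 *\<^sub>R sw \<omega>"
  have sw\<eta>: "sw \<eta> = - 60 *\<^sub>R \<omega>" by (simp add: sw_def \<eta>_def prod_eq_iff)
  let ?y = "y_coord P"
  define \<gamma> where "\<gamma> t = P + (t - t^2) *\<^sub>R mk_point 1 0 0 0 + (t^2 - t^3) *\<^sub>R mk_point 0 \<eta> 0 0" for t :: real
  define \<gamma>' where "\<gamma>' t = (1 - 2 * t) *\<^sub>R mk_point 1 0 0 0 + (2 * t - 3 * t^2) *\<^sub>R mk_point 0 \<eta> 0 0" for t :: real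
  have \<gamma>: "(\<gamma> has_vector_derivative \<gamma>' t) (at t)" for t
  proof -
    have 1: "((\<lambda>t. t - t^2) has_real_derivative 1 - 2 * t) (at t)"
      and 2: "((\<lambda>t. t^2 - t^3) has_real_derivative 2 * t - 3 * t^2) (at t)"
      by (auto intro!: derivative_eq_intros)
    show ?thesis
      unfolding \<gamma>_def[abs_def] \<gamma>'_def
      using has_vector_derivative_add[OF has_vector_derivative_add[OF has_vector_derivative_const
          has_vector_derivative_scaleR_const[OF 1]] has_vector_derivative_scaleR_const[OF 2]]
      by simp
  qed
  have "continuous_on {0..1} \<gamma>'"
    unfolding \<gamma>'_def[abs_def] by (intro continuous_intros)
  with \<gamma> have "\<gamma> C1_differentiable_on {0..1}"
    unfolding C1_differentiable_on_def by blast
  then have valid: "valid_path \<gamma>"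
    unfolding valid_path_def by (rule C1_differentiable_imp_piecewise)
  have ends: "pathstart \<gamma> = P" "pathfinish \<gamma> = P"
    by (simp_all add: pathstart_def pathfinish_def \<gamma>_def)
  have "\<exists>Y. parallel_along S_metric \<gamma> Y \<and> Y 0 = v \<and>
      Y 1 = v + mk_point 0 0 (y_coord v \<bullet> \<omega>) (- (x_coord v *\<^sub>R \<omega>))" for v
  proof -
    \<comment> \<open>The antiderivative of (t^2 - t^3) (1 - 2 t), with value 1/3 - 3/4 + 2/5 =
      -1/60 at 1. The other coefficients in \<open>Y\<close> vanish at both ends, so only this term
      contributes to the holonomy.\<close>
    let ?H = "\<lambda>t::real. t^3 / 3 - 3 * t^4 / 4 + 2 * t^5 / 5"
    define Y where "Y t = v + (t - t^2) *\<^sub>R mk_point 0 0 (y_coord v \<bullet> sw ?y) (- (x_coord v *\<^sub>R sw ?y))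
      + ?H t *\<^sub>R mk_point 0 0 (y_coord v \<bullet> sw \<eta>) (- (x_coord v *\<^sub>R sw \<eta>))
      + (t^2 - t^3) *\<^sub>R mk_point 0 0 (x_coord v * (\<eta> \<bullet> sw ?y)) 0
      + ((t^2 - t^3)^2 / 2) *\<^sub>R mk_point 0 0 (x_coord v * (\<eta> \<bullet> sw \<eta>)) 0" for t
    have Y: "(Y has_vector_derivative
        (1 - 2 * t) *\<^sub>R mk_point 0 0 (y_coord v \<bullet> sw ?y) (- (x_coord v *\<^sub>R sw ?y))
      + (t^2 - 3 * t^3 + 2 * t^4) *\<^sub>R mk_point 0 0 (y_coord v \<bullet> sw \<eta>) (- (x_coord v *\<^sub>R sw \<eta>))
      + (2 * t - 3 * t^2) *\<^sub>R mk_point 0 0 (x_coord v * (\<eta> \<bullet> sw ?y)) 0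
      + ((t^2 - t^3) * (2 * t - 3 * t^2)) *\<^sub>R mk_point 0 0 (x_coord v * (\<eta> \<bullet> sw \<eta>)) 0) (at t)" for t
    proof -
      have 1: "((\<lambda>t. t - t^2) has_real_derivative 1 - 2 * t) (at t)"
        and 2: "(?H has_real_derivative t^2 - 3 * t^3 + 2 * t^4) (at t)"
        and 3: "((\<lambda>t. t^2 - t^3) has_real_derivative 2 * t - 3 * t^2) (at t)"
        and 4: "((\<lambda>t. (t^2 - t^3)^2 / 2) has_real_derivative (t^2 - t^3) * (2 * t - 3 * t^2)) (at t)"
        by (auto intro!: derivative_eq_intros simp: field_simps eval_nat_numeral)
      show ?thesis
        unfolding Y_def[abs_def]
        using has_vector_derivative_add[OF has_vector_derivative_add[OF has_vector_derivative_add[OF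
            has_vector_derivative_add[OF has_vector_derivative_const[of v]
            has_vector_derivative_scaleR_const[OF 1]] has_vector_derivative_scaleR_const[OF 2]]
            has_vector_derivative_scaleR_const[OF 3]] has_vector_derivative_scaleR_const[OF 4]]
        by simp
    qed
    have eq: "- levi_civita S_metric (\<gamma> t) (vector_derivative \<gamma> (at t)) (Y t) =
        (1 - 2 * t) *\<^sub>R mk_point 0 0 (y_coord v \<bullet> sw ?y) (- (x_coord v *\<^sub>R sw ?y))
      + (t^2 - 3 * t^3 + 2 * t^4) *\<^sub>R mk_point 0 0 (y_coord v \<bullet> sw \<eta>) (- (x_coord v *\<^sub>R sw \<eta>))
      + (2 * t - 3 * t^2) *\<^sub>R mk_point 0 0 (x_coord v * (\<eta> \<bullet> sw ?y)) 0
      + ((t^2 - t^3) * (2 * t - 3 * t^2)) *\<^sub>R mk_point 0 0 (x_coord v * (\<eta> \<bullet> sw \<eta>)) 0" for t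
    proof -
      have xy: "x_coord (Y t) = x_coord v" "y_coord (Y t) = y_coord v"
        "x_coord (\<gamma>' t) = 1 - 2 * t" "y_coord (\<gamma>' t) = (2 * t - 3 * t^2) *\<^sub>R \<eta>"
        by (simp_all add: Y_def \<gamma>'_def)
      have g: "grad (potential (\<lambda>_. 0)) (y_coord (\<gamma> t)) = sw ?y + (t^2 - t^3) *\<^sub>R sw \<eta>"
        by (simp add: grad_potential_zero \<gamma>_def sw_def)
      have p: "(t^2 - t^3) * (1 - 2 * t) = t^2 - 3 * t^3 + 2 * t^4"
        by (simp add: algebra_simps eval_nat_numeral)
      have "levi_civita S_metric (\<gamma> t) (vector_derivative \<gamma> (at t)) (Y t)
          = christoffel (potential (\<lambda>_. 0)) (\<gamma> t) (\<gamma>' t) (Y t)"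
        by (simp add: vector_derivative_at[OF \<gamma>] S_metric_eq_wave_metric
            levi_civita_wave_metric[OF smooth_map_potential_zero])
      also have "\<dots> = mk_point 0 0 (- ((sw ?y + (t^2 - t^3) *\<^sub>R sw \<eta>)
            \<bullet> ((1 - 2 * t) *\<^sub>R y_coord v + x_coord v *\<^sub>R (2 * t - 3 * t^2) *\<^sub>R \<eta>)))
          (((1 - 2 * t) * x_coord v) *\<^sub>R (sw ?y + (t^2 - t^3) *\<^sub>R sw \<eta>))"
        by (simp only: christoffel_def xy g)
      finally show ?thesis
        unfolding p[symmetric]
        by (intro point_eqI) (simp_all add: inner_add_left inner_add_right inner_commute algebra_simps)
    qed
    have "continuous_on {0..1} Y"
      by (intro continuous_at_imp_continuous_on ballI has_vector_derivative_continuous[OF Y])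
    moreover have "\<forall>t\<in>{0..1} - {}. (Y has_vector_derivative
        - levi_civita S_metric (\<gamma> t) (vector_derivative \<gamma> (at t)) (Y t)) (at t)"
      using Y unfolding eq by blast
    ultimately have "parallel_along S_metric \<gamma> Y"
      unfolding parallel_along_def by blast
    moreover have "Y 0 = v" by (simp add: Y_def)
    moreover have "Y 1 = v + mk_point 0 0 (y_coord v \<bullet> \<omega>) (- (x_coord v *\<^sub>R \<omega>))"
      by (intro point_eqI) (simp_all add: Y_def sw\<eta>)
    ultimately show ?thesis by blast
  qed
  with valid ends show ?thesis unfolding holonomy_group_def by blast
qed

text \<open>Subtracting the identity from the unipotent maps produces many null vectors in
  \<open>V\<close> from the single \<open>v\<close>. Orthogonality to them forces \<open>w\<close>
  to be purely starred, and orthogonality to \<open>v\<close> then makes \<open>w\<close> one of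
  them, hence an element of both spaces.\<close>

lemma invariant_complement_trivial:
  fixes V W :: "(real ^ 'p::finite coord) set"
  assumes V: "subspace V" and W: "subspace W" and VW: "V \<inter> W = {0}"
    and orth: "\<And>v w. v \<in> V \<Longrightarrow> w \<in> W \<Longrightarrow> wave_metric F P v w = 0"
    and inv: "\<And>\<omega> v. v \<in> V \<Longrightarrow> v + mk_point 0 0 (y_coord v \<bullet> \<omega>) (- (x_coord v *\<^sub>R \<omega>)) \<in> V"
      "\<And>\<omega> w. w \<in> W \<Longrightarrow> w + mk_point 0 0 (y_coord w \<bullet> \<omega>) (- (x_coord w *\<^sub>R \<omega>)) \<in> W"
    and v: "v \<in> V" "x_coord v \<noteq> 0"
  shows "W \<subseteq> {0}"
proof
  fix w assume w: "w \<in> W"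
  define \<theta> where "\<theta> \<omega> u = mk_point 0 0 (y_coord u \<bullet> \<omega>) (- (x_coord u *\<^sub>R \<omega>))"
    for \<omega> and u :: "real ^ 'p coord"
  have \<theta>V: "\<theta> \<omega> v \<in> V" and \<theta>W: "\<theta> \<omega> w \<in> W" for \<omega>
    using subspace_diff[OF V inv(1)[OF v(1)] v(1)] subspace_diff[OF W inv(2)[OF w] w]
    by (simp_all add: \<theta>_def)
  have "(x_coord w *\<^sub>R y_coord v - x_coord v *\<^sub>R y_coord w) \<bullet> \<omega> = 0" for \<omega>
    using orth[OF \<theta>V w, of \<omega>]
    by (simp add: wave_metric_def \<theta>_def inner_diff_left algebra_simps inner_commute)
  then have "x_coord w *\<^sub>R y_coord v - x_coord v *\<^sub>R y_coord w = 0"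
    by (metis inner_eq_zero_iff)
  then have yw: "x_coord v *\<^sub>R y_coord w = x_coord w *\<^sub>R y_coord v" by simp
  have xw: "x_coord w = 0"
  proof (rule ccontr)
    assume nz: "x_coord w \<noteq> 0"
    obtain \<omega> :: "(real ^ 'p) \<times> (real ^ 'p)" where \<omega>: "\<omega> \<noteq> 0"
      using nonempty_Basis nonzero_Basis by blast
    \<comment> \<open>The relation between the y-parts makes these two vectors coincide, although
      one lies in \<open>W\<close> and the other in \<open>V\<close>.\<close>
    have "x_coord v *\<^sub>R \<theta> \<omega> w = x_coord w *\<^sub>R \<theta> \<omega> v"
      using arg_cong[OF yw, of "\<lambda>y. y \<bullet> \<omega>"] by (intro point_eqI) (simp_all add: \<theta>_def)
    then have "x_coord v *\<^sub>R \<theta> \<omega> w \<in> V \<inter> W"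
      using subspace_scale[OF V \<theta>V, of "x_coord w" \<omega>] subspace_scale[OF W \<theta>W, of "x_coord v" \<omega>] by simp
    then have "x_coord v *\<^sub>R \<theta> \<omega> w = 0" using VW by blast
    then have "ys_coord (x_coord v *\<^sub>R \<theta> \<omega> w) = 0" by (simp only: coords_zero)
    with nz v \<omega> show False by (simp add: \<theta>_def)
  qed
  with yw v have yw: "y_coord w = 0" by simp
  have "x_coord v * xs_coord w + y_coord v \<bullet> ys_coord w = 0"
    using orth[OF v(1) w] by (simp add: wave_metric_def xw yw)
  \<comment> \<open>The choice of \<omega> matches the starred y-part; the starred x-part then
    agrees because \<open>w\<close> is orthogonal to \<open>v\<close>.\<close>
  then have "\<theta> (- (inverse (x_coord v) *\<^sub>R ys_coord w)) v = w"
    using v(2) by (intro point_eqI) (simp_all add: \<theta>_def xw yw field_simps)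
  with \<theta>V have "w \<in> V" by metis
  with w VW show "w \<in> {0}" by blast
qed

lemma indecomposable_S_metric: "indecomposable (S_metric :: 'p::finite coord metric)"
  unfolding indecomposable_def
proof (intro allI notI, elim exE conjE)
  fix P :: "real ^ 'p coord" and V W :: "(real ^ 'p coord) set"
  assume V: "subspace V" "V \<noteq> {0}" and W: "subspace W" "W \<noteq> {0}" and VW: "V \<inter> W = {0}"
    and span: "\<forall>u. \<exists>v\<in>V. \<exists>w\<in>W. u = v + w"
    and orth: "\<forall>v\<in>V. \<forall>w\<in>W. S_metric P v w = 0"
    and inv: "\<forall>\<tau>\<in>holonomy_group S_metric P. \<tau> ` V \<subseteq> V \<and> \<tau> ` W \<subseteq> W"
  have o1: "wave_metric (potential (\<lambda>_. 0)) P v w = 0" if "v \<in> V" "w \<in> W" for v w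
    using orth that by (simp add: S_metric_eq_wave_metric)
  have o2: "wave_metric (potential (\<lambda>_. 0)) P w v = 0" if "w \<in> W" "v \<in> V" for v w
    using o1[OF that(2,1)] wave_metric_commute by metis
  have WV: "W \<inter> V = {0}" using VW by (simp add: Int_commute)
  have iV: "v + mk_point 0 0 (y_coord v \<bullet> \<omega>) (- (x_coord v *\<^sub>R \<omega>)) \<in> V" if "v \<in> V" for v \<omega>
    using bspec[OF inv holonomy_S_metric[of \<omega>]] that by (simp add: image_subset_iff)
  have iW: "v + mk_point 0 0 (y_coord v \<bullet> \<omega>) (- (x_coord v *\<^sub>R \<omega>)) \<in> W" if "v \<in> W" for v \<omega>
    using bspec[OF inv holonomy_S_metric[of \<omega>]] that by (simp add: image_subset_iff)
  obtain v w where vw: "v \<in> V" "w \<in> W" "mk_point 1 0 0 0 = v + w"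
    using span by blast
  from arg_cong[OF vw(3), of x_coord] have "x_coord v \<noteq> 0 \<or> x_coord w \<noteq> 0" by auto
  then show False
  proof
    assume "x_coord v \<noteq> 0"
    have "W \<subseteq> {0}"
      by (rule invariant_complement_trivial[OF V(1) W(1) VW o1 iV iW vw(1) \<open>x_coord v \<noteq> 0\<close>])
    with W(2) subspace_0[OF W(1)] show False by (auto simp: subset_singleton_iff)
  next
    assume "x_coord w \<noteq> 0"
    have "V \<subseteq> {0}"
      by (rule invariant_complement_trivial[OF W(1) V(1) WV o2 iW iV vw(2) \<open>x_coord w \<noteq> 0\<close>])
    with V(2) subspace_0[OF V(1)] show False by (auto simp: subset_singleton_iff)
  qed
qed

section \<open>Geodesic symmetries\<close>

lemma dir_deriv_zero_constant:
  fixes f :: "'a::real_normed_vector \<Rightarrow> 'b::real_normed_vector"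
  assumes "\<And>x. f differentiable at x" "\<And>x u. dir_deriv f x u = 0"
  shows "f x = f y"
proof -
  have "dir_deriv f x = (\<lambda>_. 0)" for x by (intro ext assms(2))
  then have "(f has_derivative (\<lambda>_. 0)) (at x within UNIV)" for x
    using has_derivative_dir_deriv[OF assms(1), of x] by simp
  then obtain c where "\<And>x. f x = c"
    using has_derivative_zero_constant[OF convex_UNIV] by blast
  then show ?thesis by simp
qed

lemma affine_along_line:
  fixes f :: "'a::real_normed_vector \<Rightarrow> real"
  assumes "\<And>x. f differentiable at x" "\<And>t. dir_deriv f (P + t *\<^sub>R u) u = c"
  shows "f (P + t *\<^sub>R u) = f P + t * c"
proof -
  have "((\<lambda>t. f (P + t *\<^sub>R u) - t * c) has_real_derivative 0) (at t)" for t
    using DERIV_along_line[OF assms(1), where P = P and s = t and u = u] by (auto intro!: derivative_eq_intros simp: assms(2))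
  from DERIV_isconst_all[OF allI[OF this], of t 0] show ?thesis by simp
qed

text \<open>Compatibility with the metric for the pulled-back connection: \<open>a\<close> and
  \<open>b\<close> are vector fields along the map \<sigma>, not fields on the target.\<close>

lemma dir_deriv_wave_metric_along:
  fixes \<sigma> :: "real ^ 'n \<Rightarrow> real ^ ('p::finite coord)"
  assumes F: "smooth_map F" and \<sigma>: "\<sigma> differentiable at R" and a: "a differentiable at R"
    and b: "b differentiable at R"
  shows "dir_deriv (\<lambda>R. wave_metric F (\<sigma> R) (a R) (b R)) R w =
    wave_metric F (\<sigma> R) (dir_deriv a R w + christoffel F (\<sigma> R) (dir_deriv \<sigma> R w) (a R)) (b R)
    + wave_metric F (\<sigma> R) (a R) (dir_deriv b R w + christoffel F (\<sigma> R) (dir_deriv \<sigma> R w) (b R))"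
proof -
  have "(F has_derivative dir_deriv F (y_coord (\<sigma> R))) (at (y_coord (\<sigma> R)))"
    by (intro has_derivative_dir_deriv smooth_map_differentiable F)
  from diff_chain_at[OF bounded_linear.has_derivative[OF bounded_linear_coords(2) has_derivative_dir_deriv[OF \<sigma>]] this]
  have dF: "((\<lambda>R. F (y_coord (\<sigma> R))) has_derivative
      (\<lambda>w. grad F (y_coord (\<sigma> R)) \<bullet> y_coord (dir_deriv \<sigma> R w))) (at R)"
    by (simp add: o_def grad_inner smooth_map_differentiable F)
  note da = bounded_linear_coords[THEN bounded_linear.has_derivative, OF has_derivative_dir_deriv[OF a]]
  note db = bounded_linear_coords[THEN bounded_linear.has_derivative, OF has_derivative_dir_deriv[OF b]]
  show ?thesis
    unfolding wave_metric_def
    by (rule dir_deriv_eqI, (rule derivative_eq_intros dF da db refl)+)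
      (simp add: inner_add_left inner_add_right algebra_simps inner_commute)
qed

text \<open>
  Koszul's trick: both sides define a torsion free connection compatible with the metric along
  the isometry.
\<close>

lemma isometry_second_derivative:
  fixes \<sigma> :: "real ^ ('p::finite coord) \<Rightarrow> real ^ ('p coord)"
  assumes F: "smooth_map F" and iso: "isometry_of (wave_metric F) \<sigma>"
  shows "dir_deriv (\<lambda>R. dir_deriv \<sigma> R u) R w
    = dir_deriv \<sigma> R (christoffel F R w u) - christoffel F (\<sigma> R) (dir_deriv \<sigma> R w) (dir_deriv \<sigma> R u)"
proof -
  have \<sigma>: "smooth_map \<sigma>" and isom: "\<And>R u v. wave_metric F (\<sigma> R) (dir_deriv \<sigma> R u) (dir_deriv \<sigma> R v) = wave_metric F R u v"
    using iso by (simp_all add: isometry_of_def)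
  let ?s = "dir_deriv \<sigma> R" and ?A = "\<lambda>w u. dir_deriv (\<lambda>R. dir_deriv \<sigma> R u) R w"
  let ?\<Gamma> = "christoffel F R" and ?\<Gamma>' = "christoffel F (\<sigma> R)"
  let ?g = "wave_metric F (\<sigma> R)"
  \<comment> \<open>The Hessian of \<sigma> as a map between manifolds with connection; it vanishes
    exactly when \<sigma> respects the connections.\<close>
  define E where "E w u = ?A w u + ?\<Gamma>' (?s w) (?s u) - ?s (?\<Gamma> w u)" for w u
  have lin: "linear ?s" by (intro linear_dir_deriv smooth_map_differentiable \<sigma>)
  have "?s u = 0 \<Longrightarrow> u = 0" for u
    using isom[of R u] wave_metric_nondegenerate[of F R u] by simp
  then have "inj ?s" using linear_injective_0[OF lin] by blast
  \<comment> \<open>The Koszul argument tests \<open>E\<close> only against vectors in the image of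
    the differential, which must therefore be everything.\<close>
  then have surj: "surj ?s" using linear_injective_imp_surjective[OF lin] by blast
  have "?g (E w u) (?s v) = 0" for w u v
  proof (rule koszul_zero[of "\<lambda>w u v. ?g (E w u) (?s v)"])
    fix w u v
    have sym: "christoffel F Q x y = christoffel F Q y x" for Q x y
      by (rule point_eqI) (simp_all add: mult.commute add.commute)
    have "E w u = E u w"
      unfolding E_def by (simp add: dir_deriv_commute[OF \<sigma>, of u R w] sym[of _ w u] sym[of _ "?s w" "?s u"])
    then show "?g (E w u) (?s v) = ?g (E u w) (?s v)" by simp
    have "dir_deriv (\<lambda>R. wave_metric F (\<sigma> R) (dir_deriv \<sigma> R u) (dir_deriv \<sigma> R v)) R w
        = ?g (?A w u + ?\<Gamma>' (?s w) (?s u)) (?s v) + ?g (?s u) (?A w v + ?\<Gamma>' (?s w) (?s v))"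
      by (intro dir_deriv_wave_metric_along F smooth_map_differentiable smooth_map_dir_deriv \<sigma>)
    moreover have "dir_deriv (\<lambda>R. wave_metric F R u v) R w
        = wave_metric F R (?\<Gamma> w u) v + wave_metric F R u (?\<Gamma> w v)"
      using dir_deriv_wave_metric_along[OF F, of "\<lambda>R. R" R "\<lambda>_. u" "\<lambda>_. v" w]
      by (simp add: dir_deriv_bounded_linear[OF bounded_linear_ident])
    ultimately have "?g (?A w u + ?\<Gamma>' (?s w) (?s u)) (?s v) + ?g (?s u) (?A w v + ?\<Gamma>' (?s w) (?s v))
        = ?g (?s (?\<Gamma> w u)) (?s v) + ?g (?s u) (?s (?\<Gamma> w v))"
      unfolding isom by simp
    then show "?g (E w u) (?s v) + ?g (E w v) (?s u) = 0"
      by (simp add: E_def wave_metric_linear wave_metric_commute[of F "\<sigma> R" "?s u"])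
  qed
  then have "?g (E w u) v = 0" for v
    using surj by (metis surjD)
  then have "E w u = 0" by (rule wave_metric_nondegenerate)
  then show ?thesis by (simp add: E_def algebra_simps)
qed

text \<open>Once the x- and y-parts of the differential are known, the isometry equations become a
  system for the starred components of \<sigma>; its compatibility forces the odd part of
  \<open>F\<close> about y_P to be affine along lines through y_P.\<close>

lemma geodesic_symmetry_potential:
  fixes P :: "real ^ ('p::finite coord)" and F :: "(real ^ 'p) \<times> (real ^ 'p) \<Rightarrow> real"
  assumes F: "smooth_map F" and iso: "isometry_of (wave_metric F) \<sigma>"
    and "\<sigma> P = P" and dP: "\<And>u. dir_deriv \<sigma> P u = - u"
  shows "\<exists>A B. \<forall>t. F (y_coord P + t *\<^sub>R v) - F (y_coord P - t *\<^sub>R v) = A + B * t"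
proof -
  let ?s = "\<lambda>u R. dir_deriv \<sigma> R u"
  have \<sigma>: "smooth_map \<sigma>" and isom: "\<And>R u v. wave_metric F (\<sigma> R) (?s u R) (?s v R) = wave_metric F R u v"
    using iso by (simp_all add: isometry_of_def)
  have d\<sigma>: "\<sigma> differentiable at R" "?s u differentiable at R" for R u
    by (intro smooth_map_differentiable smooth_map_dir_deriv \<sigma>)+
  note second = isometry_second_derivative[OF F iso]
  note bl = bounded_linear_coords
  have const: "T (?s u R) = - T u"
    if T: "bounded_linear T" and "\<And>w R. T (dir_deriv (?s u) R w) = 0"
    for T :: "real ^ ('p coord) \<Rightarrow> 'b::real_normed_vector" and u R
  proof -
    have "T (?s u R) = T (?s u P)"
      by (rule dir_deriv_zero_constant[of "\<lambda>R. T (?s u R)"])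
        (auto simp: dir_deriv_bounded_linear_comp[OF T d\<sigma>(2)] that intro: differentiable_bounded_linear_comp[OF T d\<sigma>(2)])
    then show ?thesis
      by (simp add: dP linear_neg[OF bounded_linear.linear[OF T]])
  qed
  \<comment> \<open>For starred \<open>u\<close> the first Christoffel term in the second derivative
    is 0 and the second is starred, so the x- and y-parts of the differential are constant.\<close>
  have star: "x_coord (?s u R) = 0" "y_coord (?s u R) = 0" if "x_coord u = 0" "y_coord u = 0" for u R
  proof -
    have 0: "christoffel F R w u = 0" for R w by (rule christoffel_zero[OF that])
    have "dir_deriv \<sigma> R 0 = 0" for R by (rule linear_0[OF linear_dir_deriv[OF d\<sigma>(1)]])
    then show "x_coord (?s u R) = 0" "y_coord (?s u R) = 0"
      using const[OF bl(1), of u R] const[OF bl(2), of u R] that by (simp_all add: second 0)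
  qed
  \<comment> \<open>For arbitrary \<open>u\<close> the first Christoffel term is the image of a
    starred vector, hence has no x- and y-part by the previous step; the same constancy argument
    applies.\<close>
  have s_xy: "x_coord (?s u R) = - x_coord u" "y_coord (?s u R) = - y_coord u" for u R
    by (rule const[OF bl(1)], simp add: second star) (rule const[OF bl(2)], simp add: second star)
  have y\<sigma>: "y_coord (\<sigma> R) = 2 *\<^sub>R y_coord P - y_coord R" for R
  proof -
    have "y_coord (\<sigma> R) + y_coord R = y_coord (\<sigma> P) + y_coord P"
      by (rule dir_deriv_zero_constant[of "\<lambda>R. y_coord (\<sigma> R) + y_coord R"])
       (simp_all add: dir_deriv_add differentiable_bounded_linear_comp[OF bl(2) d\<sigma>(1)]
          bounded_linear_imp_differentiable[OF bl(2)] dir_deriv_bounded_linear_comp[OF bl(2) d\<sigma>(1)]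
          dir_deriv_bounded_linear[OF bl(2)] s_xy)
    then show ?thesis by (simp add: \<open>\<sigma> P = P\<close> scaleR_2 algebra_simps)
  qed
  define X where "X = (mk_point 1 0 0 0 :: real ^ ('p coord))"
  define V where "V = (mk_point 0 v 0 0 :: real ^ ('p coord))"
  define \<alpha> where "\<alpha> R = xs_coord (\<sigma> R)" for R
  define \<beta> where "\<beta> R = v \<bullet> ys_coord (\<sigma> R)" for R
  have d\<alpha>: "\<alpha> differentiable at R" for R
    unfolding \<alpha>_def[abs_def] by (rule differentiable_bounded_linear_comp[OF bl(3) d\<sigma>(1)])
  have D\<alpha>: "dir_deriv \<alpha> R u = xs_coord (?s u R)" for R u
    unfolding \<alpha>_def[abs_def] by (rule dir_deriv_bounded_linear_comp[OF bl(3) d\<sigma>(1)])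
  have bl_v: "bounded_linear (\<lambda>u. v \<bullet> ys_coord u)"
    by (rule bounded_linear_compose[OF bounded_linear_inner_right bl(4)])
  have d\<beta>: "\<beta> differentiable at R" for R
    unfolding \<beta>_def[abs_def] by (rule differentiable_bounded_linear_comp[OF bl_v d\<sigma>(1)])
  have D\<beta>: "dir_deriv \<beta> R u = v \<bullet> ys_coord (?s u R)" for R u
    unfolding \<beta>_def[abs_def] by (rule dir_deriv_bounded_linear_comp[OF bl_v d\<sigma>(1)])
  define G where "G y = F y - F (2 *\<^sub>R y_coord P - y)" for y
  have \<alpha>X: "dir_deriv \<alpha> R X = G (y_coord R)" for R
    using isom[of R X X] by (simp add: D\<alpha> G_def wave_metric_def s_xy y\<sigma> X_def)
  have \<alpha>V: "dir_deriv \<alpha> R V = - dir_deriv \<beta> R X" for R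
    using isom[of R X V] by (simp add: D\<alpha> D\<beta> wave_metric_def s_xy X_def V_def inner_commute)
  have \<beta>V: "dir_deriv \<beta> R V = 0" for R
    using isom[of R V V] by (simp add: D\<beta> wave_metric_def s_xy V_def inner_commute)
  \<comment> \<open>Invariance of \<beta> along \<open>V\<close> makes its X-derivative invariant
    too, so \<alpha> is affine along \<open>V\<close>. Then so is its increment in direction
    \<open>X\<close>, which is \<open>G\<close>.\<close>
  have \<beta>: "\<beta> (R + t *\<^sub>R V) = \<beta> R" for R t
    using affine_along_line[OF d\<beta>, of R V 0 t] by (simp add: \<beta>V)
  have "dir_deriv \<beta> (R + t *\<^sub>R V) X = dir_deriv \<beta> R X" for R t
    using dir_deriv_comp_affine[OF bounded_linear_ident d\<beta>, of "t *\<^sub>R V" R X] by (simp add: \<beta>)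
  then have \<alpha>V': "\<alpha> (R + t *\<^sub>R V) = \<alpha> R + t * dir_deriv \<alpha> R V" for R t
    by (intro affine_along_line d\<alpha>) (simp add: \<alpha>V)
  have \<alpha>X': "\<alpha> (R + X) = \<alpha> R + G (y_coord R)" for R
    using affine_along_line[OF d\<alpha>, of R X "G (y_coord R)" 1] by (simp add: \<alpha>X) (simp add: X_def)
  have "F (y_coord P + t *\<^sub>R v) - F (y_coord P - t *\<^sub>R v)
      = (\<alpha> (P + X) - \<alpha> P) + (dir_deriv \<alpha> (P + X) V - dir_deriv \<alpha> P V) * t" for t
  proof -
    have "F (y_coord P + t *\<^sub>R v) - F (y_coord P - t *\<^sub>R v) = G (y_coord (P + t *\<^sub>R V))"
      by (simp add: G_def V_def scaleR_2)
    also have "\<dots> = \<alpha> (P + t *\<^sub>R V + X) - \<alpha> (P + t *\<^sub>R V)" by (simp add: \<alpha>X')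
    also have "P + t *\<^sub>R V + X = P + X + t *\<^sub>R V" by simp
    finally show ?thesis unfolding \<alpha>V' by (simp add: algebra_simps)
  qed
  then show ?thesis by blast
qed

text \<open>The odd part of the tail cannot cancel the contribution of z_1 z_0^2. For an even power
  it is 0, for an odd power a direct estimate suffices, and for the exponential doubling the
  argument multiplies it by e + 1/e, which is at least 2.\<close>

lemma tail_fun_convex:
  assumes "1 \<le> p" "k \<le> p + 2"
  shows "0 \<le> (tail_fun p k 2 - tail_fun p k (- 2)) - 2 * (tail_fun p k 1 - tail_fun p k (- 1))"
proof -
  consider "k \<le> p" | "k = p + 1" | "k = p + 2" using assms by linarith
  then show ?thesis
  proof cases
    case 2
    have "(2::real) ^ 1 \<le> 2 ^ (p + 3)" by (rule power_increasing) simp_all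
    with 2 show ?thesis
      by (cases "even (p + 3)") (simp_all add: tail_fun_def power_minus_odd power_minus_even del: power_add)
  next
    case 3
    have e2: "exp 2 = exp 1 * exp (1::real)" "exp (- 2) = exp (- 1) * exp (- 1 :: real)"
      by (simp_all flip: exp_add)
    have e0: "exp 1 * exp (- 1) = (1::real)" by (simp flip: exp_add)
    have "exp (- 1) \<le> exp (1::real)" by simp
    \<comment> \<open>This product expands to e - 2 + 1/e.\<close>
    moreover have "0 \<le> (exp 1 - 1) * (exp 1 - 1) * exp (- 1 :: real)" by simp
    then have "2 \<le> exp 1 + exp (- 1 :: real)"
      using e0 by (simp add: algebra_simps)
    ultimately have "0 \<le> (exp 1 - exp (- 1)) * (exp 1 + exp (- 1) - 2 :: real)" by simp
    also have "\<dots> = (exp 2 - exp (- 2)) - 2 * (exp 1 - exp (- 1))"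
      by (simp add: e2 algebra_simps)
    finally show ?thesis using 3 by (simp add: tail_fun_def)
  qed (simp add: tail_fun_def)
qed

lemma not_symmetric_H_metric:
  fixes e :: "nat \<Rightarrow> 'p::finite"
  assumes e: "bij_betw e {0..p} UNIV" and p: "1 \<le> p" and k: "1 \<le> k" "k \<le> p + 2"
  shows "\<not> symmetric_space (H_metric e p k)"
proof
  let ?F = "potential (f_fun e p k)"
  assume "symmetric_space (H_metric e p k)"
  then obtain \<sigma> where \<sigma>: "isometry_of (wave_metric ?F) \<sigma>" "\<sigma> 0 = 0" "\<And>u. dir_deriv \<sigma> 0 u = - u"
    unfolding symmetric_space_def H_metric_eq by blast
  have inj: "e i = e j \<longleftrightarrow> i = j" if "i \<le> p" "j \<le> p" for i j
    using e that by (auto simp: bij_betw_def inj_on_eq_iff)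
  define z :: "real ^ 'p" where "z = axis (e 0) 1 + axis (e 1) 1"
  have z0: "z $ e 0 = 1" using p inj[of 0 1] by (auto simp: z_def axis_def)
  have zi: "z $ e i = (if i = 1 then 1 else 0)" if "1 \<le> i" "i \<le> p" for i
    using that p inj[of 0 i] inj[of 1 i] by (auto simp: z_def axis_def)
  have F: "?F (t *\<^sub>R (z, 0)) = t ^ 3 + tail_fun p k t" for t
  proof -
    have "(\<Sum>i=1..min k p. (t *\<^sub>R z) $ e i * ((t *\<^sub>R z) $ e 0) ^ (i + 1))
        = (\<Sum>i=1..min k p. if i = 1 then t ^ 3 else 0)"
      by (intro sum.cong refl) (simp add: z0 zi eval_nat_numeral)
    also have "\<dots> = t ^ 3"
      using k p by simp
    finally show ?thesis by (simp add: potential_def f_fun_eq z0)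
  qed
  have "smooth_map ?F" by (intro smooth_map_potential smooth_map_f_fun)
  from geodesic_symmetry_potential[OF this \<sigma>, of "(z, 0)"] obtain A B
    where AB: "\<And>t. ?F (t *\<^sub>R (z, 0)) - ?F ((- t) *\<^sub>R (z, 0)) = A + B * t"
    by auto
  have h: "t ^ 3 + tail_fun p k t - ((- t) ^ 3 + tail_fun p k (- t)) = A + B * t" for t
    using AB[of t] unfolding F .
  \<comment> \<open>The second difference of an affine function at 0, 1, 2 vanishes, whereas the odd
    function 2 t^3 contributes 16 - 2 * 2 = 12.\<close>
  from h[of 0] h[of 1] h[of 2] have
    "12 + ((tail_fun p k 2 - tail_fun p k (- 2)) - 2 * (tail_fun p k 1 - tail_fun p k (- 1))) = 0"
    by simp
  with tail_fun_convex[OF p k(2)] show False by linarith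
qed

theorem theorem1p8:
  fixes e :: "nat \<Rightarrow> 'p::finite" and p k :: nat
  assumes "bij_betw e {0..p} UNIV"
    and "1 \<le> p" and "1 \<le> k" and "k \<le> p + 2"
  shows "(symmetric_space (S_metric :: 'p coord metric) \<and>
          homogeneous_space (S_metric :: 'p coord metric) \<and>
          indecomposable (S_metric :: 'p coord metric) \<and>
          modeled_on 0 (H_metric e p k) (S_metric :: 'p coord metric))
       \<and> (\<forall>j. 1 \<le> j \<and> j < k \<longrightarrow>
            homogeneous_space (H_metric e p j) \<and>
            modeled_on j (H_metric e p k) (H_metric e p j) \<and>
            \<not> modeled_on k (H_metric e p j) (H_metric e p k))
       \<and> (homogeneous_space (H_metric e p k) \<and> \<not> symmetric_space (H_metric e p k))"
proof -
  have S: "S_metric = H_metric e p 0"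
    by (simp add: S_metric_def H_metric_def f_fun_zero)
  have "homogeneous_space (S_metric :: 'p coord metric)"
    unfolding S by (rule homogeneous_H_metric[OF assms(1)]) simp
  moreover have "modeled_on 0 (H_metric e p k) (S_metric :: 'p coord metric)"
    unfolding S by (rule modeled_on_H_metric[OF assms(1) _ assms(4)]) (use assms(3) in simp)
  ultimately show ?thesis
    using symmetric_S_metric indecomposable_S_metric homogeneous_H_metric[OF assms(1)]
      modeled_on_H_metric[OF assms(1) _ assms(4)] not_modeled_on_H_metric[OF assms(1) _ assms(4)]
      not_symmetric_H_metric[OF assms] assms(4)
    by (auto intro: less_imp_le)
qed

end
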